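(* There exist absolute constants $c,C>0$ such that for all integers $1\leq d<n$, $$ c\max\left\{1,\sqrt{\frac d{\ln(en/d)}}\right\}\leq\mathfrak r_{n,d}^{\rm unc}\leq C\max\left\{1,\sqrt{\frac d{\ln(en/d)}}\right\}. $$ In particular, the volume-one cube $Q_n=[-1/2,1/2]^n$ is extremal, up to absolute constants, among unconditional isotropic bodies in every projection dimension: setting $$ \mathfrak r_{n,d}(Q_n)=\sup\left\{s>0:\mathbb{P}\{r(P_FQ_n)\geq s\}\geq\tfrac12\right\}, $$ with $F$ Haar-distributed on $G_{n,n-d}$, one has $\mathfrak r_{n,d}^{\rm unc}\leq\mathfrak r_{n,d}(Q_n)\leq C\,\mathfrak r_{n,d}^{\rm unc}$ for all $1\leq d<n$.
   Context: A convex body $K\subseteq\mathbb{R}^n$ (compact convex set with nonempty interior) is isotropic if $|K|=1$, its barycenter is the origin and there is $L_K>0$ with $\int_K\langle x,\theta\rangle^2\,dx=L_K^2$ for all $\theta\in S^{n-1}$. It is unconditional if $(x_1,\ldots,x_n)\in K$ implies $(\varepsilon_1x_1,\ldots,\varepsilon_nx_n)\in K$ for all signs $\varepsilon_i\in\{-1,1\}$. $\mathcal I_n^{\rm unc}$ is the class of unconditional isotropic convex bodies (of volume one) in $\mathbb{R}^n$. $G_{n,n-d}$ is the Grassmannian of $(n-d)$-dimensional subspaces with its rotationally invariant (Haar) probability measure, $P_F$ is the orthogonal projection onto $F$, and $r(P_FK)=\max\{r>0:r(B_2^n\cap F)\subseteq P_FK\}$. For $1\leq d<n$ and $F$ Haar-distributed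 on $G_{n,n-d}$, $$ \mathfrak r_{n,d}^{\rm unc}=\sup\left\{s>0:\inf_{K\in\mathcal I_n^{\rm unc}}\mathbb{P}\{r(P_FK)\geq s\}\geq\frac12\right\}. $$ *)

theory Defs
  imports "HOL-Probability.Probability" "HOL-Library.Function_Algebras"
begin

text \<open>
  The dimension \<open>n\<close> is quantified inside the statement, so \<open>\<real>\<^sup>n\<close> is the library's
  \<^const>\<open>Euclidean_space\<close>: functions \<open>nat \<Rightarrow> real\<close> vanishing from index \<open>n\<close> on.
  The pointwise vector space structure makes the library's \<^const>\<open>convex\<close>,
  \<^const>\<open>subspace\<close>, \<^const>\<open>dim\<close> and \<^const>\<open>linear\<close> available for such functions.
\<close>

instantiation "fun" :: (type, real_vector) real_vector
begin

definition scaleR_fun :: "real \<Rightarrow> ('a \<Rightarrow> 'b) \<Rightarrow> 'a \<Rightarrow> 'b"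
  where "scaleR_fun c f = (\<lambda>x. c *\<^sub>R f x)"

instance
  by standard (auto simp: scaleR_fun_def fun_eq_iff scaleR_add_right scaleR_add_left)

end

abbreviation Rn :: "nat \<Rightarrow> (nat \<Rightarrow> real) set"
  where "Rn n \<equiv> topspace (Euclidean_space n)"

definition inner_Rn :: "nat \<Rightarrow> (nat \<Rightarrow> real) \<Rightarrow> (nat \<Rightarrow> real) \<Rightarrow> real"
  where "inner_Rn n x y = (\<Sum>i<n. x i * y i)"

abbreviation norm_Rn :: "nat \<Rightarrow> (nat \<Rightarrow> real) \<Rightarrow> real"
  where "norm_Rn n x \<equiv> L2_set x {..<n}"

definition ball_Rn :: "nat \<Rightarrow> (nat \<Rightarrow> real) set"
  where "ball_Rn n = {x \<in> Rn n. norm_Rn n x \<le> 1}"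

definition extend_Rn :: "nat \<Rightarrow> (nat \<Rightarrow> real) \<Rightarrow> nat \<Rightarrow> real"
  where "extend_Rn n x = (\<lambda>i. if i < n then x i else 0)"

text \<open>
  Lebesgue measure on \<open>\<real>\<^sup>n\<close>: the library's product measure lives on functions that are
  \<^term>\<open>undefined\<close> outside \<open>{..<n}\<close>, hence the transport to functions vanishing there.
\<close>

definition lborel_Rn :: "nat \<Rightarrow> (nat \<Rightarrow> real) measure"
  where "lborel_Rn n = distr (Pi\<^sub>M {..<n} (\<lambda>_. lborel)) borel (extend_Rn n)"

lemma measurable_extend_Rn: "extend_Rn n \<in> Pi\<^sub>M {..<n} (\<lambda>_. lborel) \<rightarrow>\<^sub>M borel"
proof (rule measurable_coordinatewise_then_product)
  fix i
  show "(\<lambda>x. extend_Rn n x i) \<in> borel_measurable (Pi\<^sub>M {..<n} (\<lambda>_. lborel))"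
  proof (cases "i < n")
    case True
    have "(\<lambda>x. x i) \<in> Pi\<^sub>M {..<n} (\<lambda>_. lborel :: real measure) \<rightarrow>\<^sub>M lborel"
      using True by (intro measurable_component_singleton) auto
    then show ?thesis
      using True by (simp add: extend_Rn_def)
  qed (simp add: extend_Rn_def)
qed


definition convex_body :: "nat \<Rightarrow> (nat \<Rightarrow> real) set \<Rightarrow> bool"
  where "convex_body n K \<longleftrightarrow>
    compactin (Euclidean_space n) K \<and> convex K \<and> Euclidean_space n interior_of K \<noteq> {}"

definition isotropic :: "nat \<Rightarrow> (nat \<Rightarrow> real) set \<Rightarrow> bool"
  where "isotropic n K \<longleftrightarrow>
    convex_body n K \<and>
    emeasure (lborel_Rn n) K = 1 \<and>
    (\<forall>i<n. (LINT x:K|lborel_Rn n. x i) = 0) \<and>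
    (\<exists>L>0. \<forall>\<theta>\<in>Rn n. norm_Rn n \<theta> = 1 \<longrightarrow>
       (LINT x:K|lborel_Rn n. (inner_Rn n x \<theta>)\<^sup>2) = L\<^sup>2)"

definition unconditional :: "nat \<Rightarrow> (nat \<Rightarrow> real) set \<Rightarrow> bool"
  where "unconditional n K \<longleftrightarrow>
    (\<forall>x\<in>K. \<forall>\<epsilon>\<in>{..<n} \<rightarrow> {-1, 1}. (\<lambda>i. \<epsilon> i * x i) \<in> K)"

definition unc_isotropic :: "nat \<Rightarrow> (nat \<Rightarrow> real) set set"
  where "unc_isotropic n = {K. isotropic n K \<and> unconditional n K}"

definition unit_cube :: "nat \<Rightarrow> (nat \<Rightarrow> real) set"
  where "unit_cube n = {x \<in> Rn n. \<forall>i<n. -1/2 \<le> x i \<and> x i \<le> 1/2}"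


definition grassmannian :: "nat \<Rightarrow> nat \<Rightarrow> (nat \<Rightarrow> real) set set"
  where "grassmannian n k = {F. F \<subseteq> Rn n \<and> subspace F \<and> dim F = k}"

definition orth_proj :: "nat \<Rightarrow> (nat \<Rightarrow> real) set \<Rightarrow> (nat \<Rightarrow> real) \<Rightarrow> nat \<Rightarrow> real"
  where "orth_proj n F x = (THE y. y \<in> F \<and> (\<forall>z\<in>F. inner_Rn n (x - y) z = 0))"

definition proj_matrix :: "nat \<Rightarrow> (nat \<Rightarrow> real) set \<Rightarrow> nat \<times> nat \<Rightarrow> real"
  where "proj_matrix n F =
    (\<lambda>(i, j)\<in>{..<n} \<times> {..<n}. orth_proj n F (\<lambda>l. if l = j then 1 else 0) i)"

text \<open>
  The usual topology of the Grassmannian is the one induced by the embedding that sends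
  \<open>F\<close> to the matrix of the orthogonal projection onto \<open>F\<close>; the following measurable space
  carries its Borel sets.
\<close>

definition grassmannian_borel :: "nat \<Rightarrow> nat \<Rightarrow> (nat \<Rightarrow> real) set measure"
  where "grassmannian_borel n k =
    vimage_algebra (grassmannian n k) (proj_matrix n) (Pi\<^sub>M ({..<n} \<times> {..<n}) (\<lambda>_. borel))"

text \<open>
  Only the restriction of such a map to \<^term>\<open>Rn n\<close> matters. Every orthogonal map of
  \<open>\<real>\<^sup>n\<close> is the restriction of one, as it can be extended by \<open>0\<close> on the remaining
  coordinates.
\<close>

definition orth_maps :: "nat \<Rightarrow> ((nat \<Rightarrow> real) \<Rightarrow> (nat \<Rightarrow> real)) set"
  where "orth_maps n =
    {U. linear U \<and> U ` Rn n \<subseteq> Rn n \<and>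
        (\<forall>x\<in>Rn n. \<forall>y\<in>Rn n. inner_Rn n (U x) (U y) = inner_Rn n x y)}"

definition is_haar_grassmannian :: "nat \<Rightarrow> nat \<Rightarrow> (nat \<Rightarrow> real) set measure \<Rightarrow> bool"
  where "is_haar_grassmannian n k \<mu> \<longleftrightarrow>
    sets \<mu> = sets (grassmannian_borel n k) \<and> prob_space \<mu> \<and>
    (\<forall>U\<in>orth_maps n. distr \<mu> (grassmannian_borel n k) (\<lambda>F. U ` F) = \<mu>)"

definition haar_grassmannian :: "nat \<Rightarrow> nat \<Rightarrow> (nat \<Rightarrow> real) set measure"
  where "haar_grassmannian n k = (THE \<mu>. is_haar_grassmannian n k \<mu>)"


definition proj_inradius :: "nat \<Rightarrow> (nat \<Rightarrow> real) set \<Rightarrow> (nat \<Rightarrow> real) set \<Rightarrow> real"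
  where "proj_inradius n K F =
    (GREATEST r. r > 0 \<and> (\<lambda>x. r *\<^sub>R x) ` (ball_Rn n \<inter> F) \<subseteq> orth_proj n F ` K)"

definition prob_inradius_ge :: "nat \<Rightarrow> nat \<Rightarrow> (nat \<Rightarrow> real) set \<Rightarrow> real \<Rightarrow> real"
  where "prob_inradius_ge n d K s =
    measure (haar_grassmannian n (n - d)) {F \<in> grassmannian n (n - d). proj_inradius n K F \<ge> s}"

definition r_unc :: "nat \<Rightarrow> nat \<Rightarrow> real"
  where "r_unc n d = Sup {s. s > 0 \<and> (INF K\<in>unc_isotropic n. prob_inradius_ge n d K s) \<ge> 1/2}"

definition r_body :: "nat \<Rightarrow> nat \<Rightarrow> (nat \<Rightarrow> real) set \<Rightarrow> real"
  where "r_body n d K = Sup {s. s > 0 \<and> prob_inradius_ge n d K s \<ge> 1/2}"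

end

theory Submission
  imports Defs
begin

text \<open>
  The inradius of \<open>P\<^sub>F K\<close> is the minimum of the support function \<open>h\<^sub>K\<close> on the unit sphere of \<open>F\<close>, and
  \<open>h\<close> of the cube is half the \<open>\<ell>\<^sub>1\<close>-norm. For an unconditional isotropic \<open>K\<close> one has \<open>h\<^sub>K \<ge> c \<parallel>\<cdot>\<parallel>\<^sub>1\<close>: averaging
  over \<open>K\<close> gives \<open>h\<^sub>K(\<theta>) \<ge> \<Sum> |\<theta>\<^sub>i| E|x\<^sub>i|\<close>, where \<open>E|x\<^sub>i|\<close> is comparable to the isotropic constant (reverse
  Hoelder for log-concave tails), which is bounded below because a Euclidean ball of radius
  \<open>c \<surd>n\<close> has volume at most \<open>1/2\<close>. So everything reduces to the minimum of \<open>\<parallel>\<theta>\<parallel>\<^sub>1\<close> on the sphere of \<open>F\<close>.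
  It is at most \<open>C\<close> times the claimed rate for every \<open>F\<close>, by a packing argument in the quotient by \<open>F\<close>
  (lower bound for the Gelfand widths of the \<open>\<ell>\<^sub>1\<close>-ball). It is at least \<open>c\<close> times the rate with probability
  \<open>1/2\<close>: the Haar measure is the law of the kernel of a Gaussian matrix with \<open>d\<close> rows, and such a matrix is
  two-sidedly bounded on sparse vectors with high probability, which forces kernel vectors to have large
  \<open>\<ell>\<^sub>1\<close>-norm.
\<close>

section \<open>Linear algebra in \<open>\<real>\<^sup>n\<close>\<close>

text \<open>\<open>haar_grassmannian\<close> is a \<open>THE\<close>, so no probability can be
  computed before existence and uniqueness are shown, and \<open>proj_inradius\<close> is a
  \<open>GREATEST\<close>, so the largest radius must be attained. Gaussian matrices settle the
  first point: rotating the rows shows that the law of the kernel is invariant, and the Gram-Schmidt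
  frame of the rows is a random orthogonal map along which any other invariant measure can be
  averaged. Unconditionality enters twice: sign changes let the support function see |x_i| in place
  of x_i, and they make one-dimensional level sets symmetric intervals, so that Prekopa-Leindler
  comes down to adding lengths. The rate has one source. With L = ln(en/d), the sparsity s of order
  d/L is the level at which the logarithm of the number of s-sparse patterns is of order d. Packing
  shows that a d-dimensional quotient cannot separate many more patterns; a net shows that d
  Gaussian rows control somewhat fewer. Both turn into a ratio of norms of order sqrt s. The lower
  bound rests on one event of subspaces that does not depend on the body; the upper bound holds for
  every F and involves no probability.\<close>

lemma scaleR_fun_apply [simp]: "(c *\<^sub>R f) x = c *\<^sub>R f x"
  by (simp add: scaleR_fun_def)

lemma sum_fun_apply: "(\<Sum>i\<in>I. f i) x = (\<Sum>i\<in>I. f i x)"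
  for f :: "'i \<Rightarrow> 'a \<Rightarrow> 'b::comm_monoid_add"
  by (induction I rule: infinite_finite_induct) auto

lemma mem_Rn: "x \<in> Rn n \<longleftrightarrow> (\<forall>i\<ge>n. x i = 0)"
  by (simp add: topspace_Euclidean_space)

lemma Rn_eqI: "x \<in> Rn n \<Longrightarrow> y \<in> Rn n \<Longrightarrow> (\<And>i. i < n \<Longrightarrow> x i = y i) \<Longrightarrow> x = y"
  unfolding mem_Rn by (metis ext leI)

lemma extend_Rn_mem [simp]: "extend_Rn n x \<in> Rn n"
  by (simp add: extend_Rn_def mem_Rn)

lemma extend_Rn_id: "x \<in> Rn n \<Longrightarrow> extend_Rn n x = x"
  by (auto simp: extend_Rn_def mem_Rn)

lemma subspace_Rn: "subspace (Rn n)"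
  by (auto simp: subspace_def mem_Rn)

definition unit_Rn :: "nat \<Rightarrow> nat \<Rightarrow> real"
  where "unit_Rn j = (\<lambda>l. if l = j then 1 else 0)"

lemma unit_Rn_mem [simp]: "j < n \<Longrightarrow> unit_Rn j \<in> Rn n"
  by (auto simp: mem_Rn unit_Rn_def)

lemma inner_Rn_unit_right [simp]: "j < n \<Longrightarrow> inner_Rn n x (unit_Rn j) = x j"
  by (simp add: inner_Rn_def unit_Rn_def if_distrib[of "(*) _"] cong: if_cong)

lemma inner_Rn_unit_left [simp]: "j < n \<Longrightarrow> inner_Rn n (unit_Rn j) x = x j"
  using inner_Rn_unit_right[of j n x] by (simp add: inner_Rn_def mult.commute)

lemma inner_Rn_commute: "inner_Rn n x y = inner_Rn n y x"
  by (simp add: inner_Rn_def mult.commute)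

lemma inner_Rn_add_left: "inner_Rn n (x + y) z = inner_Rn n x z + inner_Rn n y z"
  by (simp add: inner_Rn_def distrib_right sum.distrib)

lemma inner_Rn_add_right: "inner_Rn n z (x + y) = inner_Rn n z x + inner_Rn n z y"
  by (simp add: inner_Rn_def distrib_left sum.distrib)

lemma inner_Rn_diff_left: "inner_Rn n (x - y) z = inner_Rn n x z - inner_Rn n y z"
  by (simp add: inner_Rn_def left_diff_distrib sum_subtractf)

lemma inner_Rn_diff_right: "inner_Rn n z (x - y) = inner_Rn n z x - inner_Rn n z y"
  by (simp add: inner_Rn_def right_diff_distrib sum_subtractf)

lemma inner_Rn_scaleR_left: "inner_Rn n (c *\<^sub>R x) y = c * inner_Rn n x y"
  by (simp add: inner_Rn_def sum_distrib_left mult.assoc)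

lemma inner_Rn_scaleR_right: "inner_Rn n x (c *\<^sub>R y) = c * inner_Rn n x y"
  by (simp add: inner_Rn_def sum_distrib_left algebra_simps)

lemma inner_Rn_sum_left: "inner_Rn n (\<Sum>i\<in>I. f i) y = (\<Sum>i\<in>I. inner_Rn n (f i) y)"
  unfolding inner_Rn_def sum_fun_apply sum_distrib_right by (rule sum.swap)

lemma inner_Rn_sum_right: "inner_Rn n y (\<Sum>i\<in>I. f i) = (\<Sum>i\<in>I. inner_Rn n y (f i))"
  unfolding inner_Rn_def sum_fun_apply sum_distrib_left by (rule sum.swap)

lemma inner_Rn_zero [simp]: "inner_Rn n 0 x = 0" "inner_Rn n x 0 = 0"
  by (simp_all add: inner_Rn_def)

lemmas inner_Rn_simps =
  inner_Rn_add_left inner_Rn_add_right inner_Rn_diff_left inner_Rn_diff_right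
  inner_Rn_scaleR_left inner_Rn_scaleR_right inner_Rn_sum_left inner_Rn_sum_right

lemma inner_Rn_self: "inner_Rn n x x = (norm_Rn n x)\<^sup>2"
  by (simp add: inner_Rn_def L2_set_def sum_nonneg power2_eq_square)

lemma inner_Rn_self_nonneg: "0 \<le> inner_Rn n x x"
  by (simp add: inner_Rn_self)

lemma inner_Rn_self_eq_0: "x \<in> Rn n \<Longrightarrow> (inner_Rn n x x = 0) = (x = 0)"
proof
  assume x: "x \<in> Rn n" and 0: "inner_Rn n x x = 0"
  from 0 have "\<forall>i\<in>{..<n}. x i * x i = 0"
    unfolding inner_Rn_def by (intro sum_nonneg_eq_0_iff[THEN iffD1]) auto
  then show "x = 0"
    by (intro Rn_eqI[OF x]) (auto simp: mem_Rn)
qed simp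

lemma norm_Rn_eq_0: "x \<in> Rn n \<Longrightarrow> norm_Rn n x = 0 \<longleftrightarrow> x = 0"
  using inner_Rn_self_eq_0[of x n] by (simp add: inner_Rn_self)

lemma norm_Rn_zero [simp]: "norm_Rn n 0 = 0"
  by (simp add: L2_set_def)

lemma norm_Rn_scaleR: "norm_Rn n (c *\<^sub>R x) = \<bar>c\<bar> * norm_Rn n x"
  by (simp add: L2_set_def power_mult_distrib sum_distrib_left[symmetric] real_sqrt_mult)

lemma norm_Rn_triangle: "norm_Rn n (x + y) \<le> norm_Rn n x + norm_Rn n y"
  using L2_set_triangle_ineq[of x y "{..<n}"] by (simp add: plus_fun_def)

lemma Cauchy_Schwarz_Rn: "\<bar>inner_Rn n x y\<bar> \<le> norm_Rn n x * norm_Rn n y"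
  unfolding inner_Rn_def
  by (rule order_trans[OF sum_abs]) (simp add: abs_mult L2_set_mult_ineq)

section \<open>Orthonormal systems, their completion, and bases of subspaces\<close>

definition orthonormal_Rn :: "nat \<Rightarrow> nat \<Rightarrow> (nat \<Rightarrow> nat \<Rightarrow> real) \<Rightarrow> bool"
  where "orthonormal_Rn n m u \<longleftrightarrow> (\<forall>i<m. u i \<in> Rn n) \<and>
    (\<forall>i<m. \<forall>j<m. inner_Rn n (u i) (u j) = (if i = j then 1 else 0))"

lemma orthonormal_unit_Rn: "orthonormal_Rn n n unit_Rn"
  by (auto simp: orthonormal_Rn_def) (auto simp: unit_Rn_def)

definition residual_Rn :: "nat \<Rightarrow> nat \<Rightarrow> (nat \<Rightarrow> nat \<Rightarrow> real) \<Rightarrow> (nat \<Rightarrow> real) \<Rightarrow> nat \<Rightarrow> real"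
  where "residual_Rn n m u x = x - (\<Sum>i<m. inner_Rn n (u i) x *\<^sub>R u i)"

lemma sum_scaleR_mem_Rn: "(\<And>i. i \<in> I \<Longrightarrow> u i \<in> Rn n) \<Longrightarrow> (\<Sum>i\<in>I. c i *\<^sub>R u i) \<in> Rn n"
  by (intro subspace_sum[OF subspace_Rn] subspace_scale[OF subspace_Rn])

lemma residual_mem_Rn: "orthonormal_Rn n m u \<Longrightarrow> x \<in> Rn n \<Longrightarrow> residual_Rn n m u x \<in> Rn n"
  unfolding residual_Rn_def
  by (intro subspace_diff[OF subspace_Rn] sum_scaleR_mem_Rn) (auto simp: orthonormal_Rn_def)

lemma residual_orthogonal:
  assumes "orthonormal_Rn n m u" "j < m"
  shows "inner_Rn n (u j) (residual_Rn n m u x) = 0"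
proof -
  have "(\<Sum>i<m. inner_Rn n (u i) x * inner_Rn n (u j) (u i))
      = (\<Sum>i<m. if j = i then inner_Rn n (u i) x else 0)"
    using assms by (intro sum.cong) (auto simp: orthonormal_Rn_def)
  then show ?thesis
    using assms(2) by (simp add: residual_Rn_def inner_Rn_simps)
qed

lemma inner_residual_self:
  assumes "orthonormal_Rn n m u"
  shows "inner_Rn n (residual_Rn n m u x) (residual_Rn n m u x)
    = inner_Rn n x x - (\<Sum>i<m. (inner_Rn n (u i) x)\<^sup>2)"
proof -
  let ?r = "residual_Rn n m u x"
  have "inner_Rn n ?r ?r = inner_Rn n x ?r - (\<Sum>i<m. inner_Rn n (u i) x * inner_Rn n (u i) ?r)"
    by (subst (1) residual_Rn_def) (simp add: inner_Rn_simps)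
  also have "\<dots> = inner_Rn n x ?r"
    using residual_orthogonal[OF assms] by simp
  also have "\<dots> = inner_Rn n x x - (\<Sum>i<m. (inner_Rn n (u i) x)\<^sup>2)"
    by (simp add: residual_Rn_def inner_Rn_simps power2_eq_square inner_Rn_commute[of n x "u _"])
  finally show ?thesis .
qed

text \<open>The sum is the trace of the projection onto the complement of the system. It stands in
  for dimension theory: being nonnegative it bounds the size of an orthonormal system by n, the
  value 0 forces completeness, and a positive value supplies a further direction.\<close>

lemma sum_unit_residual:
  assumes "orthonormal_Rn n m u"
  shows "(\<Sum>l<n. inner_Rn n (residual_Rn n m u (unit_Rn l)) (residual_Rn n m u (unit_Rn l)))
    = real n - real m"
proof -
  have "(\<Sum>l<n. \<Sum>i<m. (u i l)\<^sup>2) = (\<Sum>i<m. \<Sum>l<n. (u i l)\<^sup>2)"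
    by (rule sum.swap)
  also have "\<dots> = (\<Sum>i<m. inner_Rn n (u i) (u i))"
    by (simp add: inner_Rn_def power2_eq_square)
  also have "\<dots> = real m"
    using assms by (simp add: orthonormal_Rn_def)
  finally have m: "(\<Sum>l<n. \<Sum>i<m. (u i l)\<^sup>2) = real m" .
  have "inner_Rn n (residual_Rn n m u (unit_Rn l)) (residual_Rn n m u (unit_Rn l))
      = 1 - (\<Sum>i<m. (u i l)\<^sup>2)" if "l < n" for l
  proof -
    have "unit_Rn l l = 1" by (simp add: unit_Rn_def)
    then show ?thesis
      unfolding inner_residual_self[OF assms] using that by simp
  qed
  then have "(\<Sum>l<n. inner_Rn n (residual_Rn n m u (unit_Rn l)) (residual_Rn n m u (unit_Rn l)))
      = (\<Sum>l<n. 1 - (\<Sum>i<m. (u i l)\<^sup>2))"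
    by (intro sum.cong) auto
  also have "\<dots> = real n - real m"
    unfolding sum_subtractf m by simp
  finally show ?thesis .
qed

lemma orthonormal_card_le:
  assumes "orthonormal_Rn n m u"
  shows "m \<le> n"
proof -
  have "0 \<le> real n - real m"
    unfolding sum_unit_residual[OF assms, symmetric]
    by (intro sum_nonneg inner_Rn_self_nonneg)
  then show ?thesis by simp
qed

text \<open>For m = n the trace above is 0, so every \<open>unit_Rn l\<close> lies in the span of u.
  The residual of x is orthogonal to that span, hence all its coordinates vanish.\<close>

lemma orthonormal_expansion:
  assumes u: "orthonormal_Rn n n u" and x: "x \<in> Rn n"
  shows "x = (\<Sum>i<n. inner_Rn n (u i) x *\<^sub>R u i)"
proof -
  have 0: "residual_Rn n n u (unit_Rn l) = 0" if "l < n" for l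
  proof -
    have "\<forall>l\<in>{..<n}. inner_Rn n (residual_Rn n n u (unit_Rn l)) (residual_Rn n n u (unit_Rn l)) = 0"
      using sum_unit_residual[OF u] inner_Rn_self_nonneg
      by (intro sum_nonneg_eq_0_iff[THEN iffD1]) auto
    with that show ?thesis
      by (simp add: inner_Rn_self_eq_0 residual_mem_Rn[OF u])
  qed
  let ?r = "residual_Rn n n u x"
  have "?r = 0"
  proof (rule Rn_eqI)
    show "?r \<in> Rn n" by (rule residual_mem_Rn[OF u x])
    fix l assume l: "l < n"
    have "unit_Rn l = (\<Sum>i<n. inner_Rn n (u i) (unit_Rn l) *\<^sub>R u i)"
      using 0[OF l] by (simp add: residual_Rn_def)
    then have "inner_Rn n (unit_Rn l) ?r = (\<Sum>i<n. inner_Rn n (u i) (unit_Rn l) * inner_Rn n (u i) ?r)"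
      by (metis (no_types, lifting) inner_Rn_scaleR_left inner_Rn_sum_left sum.cong)
    also have "\<dots> = 0"
      using residual_orthogonal[OF u] by simp
    finally show "?r l = 0 l" using l by simp
  qed (simp add: mem_Rn)
  then show ?thesis by (simp add: residual_Rn_def)
qed

lemma Parseval_Rn:
  assumes u: "orthonormal_Rn n n u" and x: "x \<in> Rn n"
  shows "inner_Rn n x y = (\<Sum>i<n. inner_Rn n (u i) x * inner_Rn n (u i) y)"
  by (subst (1) orthonormal_expansion[OF u x]) (simp add: inner_Rn_simps)

lemma orthonormal_Suc:
  assumes u: "orthonormal_Rn n m u" and a: "a \<in> Rn n" "inner_Rn n a a = 1"
    and o: "\<And>i. i < m \<Longrightarrow> inner_Rn n (u i) a = 0"
  shows "orthonormal_Rn n (Suc m) (u(m := a))"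
proof -
  have "inner_Rn n a (u i) = 0" if "i < m" for i
    using o[OF that] inner_Rn_commute[of n a "u i"] by simp
  then show ?thesis
    using u a o by (auto simp: orthonormal_Rn_def less_Suc_eq)
qed

lemma normalize_Rn:
  assumes "x \<in> Rn n" "x \<noteq> 0"
  shows "inner_Rn n ((1 / norm_Rn n x) *\<^sub>R x) ((1 / norm_Rn n x) *\<^sub>R x) = 1"
  using assms norm_Rn_eq_0[of x n]
  by (simp add: inner_Rn_self norm_Rn_scaleR power_mult_distrib power_divide)

lemma exists_unit_orthogonal:
  assumes u: "orthonormal_Rn n m u" and "m < n"
  shows "\<exists>a\<in>Rn n. inner_Rn n a a = 1 \<and> (\<forall>i<m. inner_Rn n (u i) a = 0)"
proof -
  have "\<exists>l<n. residual_Rn n m u (unit_Rn l) \<noteq> 0"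
  proof (rule ccontr)
    assume "\<not> ?thesis"
    then have "(\<Sum>l<n. inner_Rn n (residual_Rn n m u (unit_Rn l)) (residual_Rn n m u (unit_Rn l))) = 0"
      by (intro sum.neutral) auto
    then show False using sum_unit_residual[OF u] \<open>m < n\<close> by simp
  qed
  then obtain l where l: "l < n" "residual_Rn n m u (unit_Rn l) \<noteq> 0" by blast
  let ?r = "residual_Rn n m u (unit_Rn l)"
  have r: "?r \<in> Rn n" using l by (intro residual_mem_Rn[OF u]) simp
  show ?thesis
    using normalize_Rn[OF r l(2)] residual_orthogonal[OF u]
    by (intro bexI[of _ "(1 / norm_Rn n ?r) *\<^sub>R ?r"])
      (auto simp: inner_Rn_simps intro!: subspace_scale[OF subspace_Rn] r)
qed

lemma orthonormal_extend:
  assumes "orthonormal_Rn n m u"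
  shows "\<exists>v. orthonormal_Rn n n v \<and> (\<forall>i<m. v i = u i)"
  using assms
proof (induction "n - m" arbitrary: m u)
  case 0
  then show ?case using orthonormal_card_le[of n m u] by (metis diff_is_0_eq le_antisym)
next
  case (Suc k)
  then have mn: "m < n" by simp
  obtain a where a: "a \<in> Rn n" "inner_Rn n a a = 1" "\<forall>i<m. inner_Rn n (u i) a = 0"
    using exists_unit_orthogonal[OF Suc.prems mn] by blast
  have "orthonormal_Rn n (Suc m) (u(m := a))"
    using a by (intro orthonormal_Suc[OF Suc.prems]) auto
  moreover have "k = n - Suc m" using Suc.hyps(2) by simp
  ultimately obtain v where "orthonormal_Rn n n v" "\<forall>i<Suc m. v i = (u(m := a)) i"
    using Suc.hyps(1) by blast
  then show ?case by (intro exI[of _ v]) auto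
qed

lemma independent_orthonormal:
  assumes u: "orthonormal_Rn n m u" and I: "I \<subseteq> {..<m}"
  shows "independent (u ` I)" "inj_on u I"
proof -
  show inj: "inj_on u I"
  proof (rule inj_onI)
    fix i j assume "i \<in> I" "j \<in> I" "u i = u j"
    then show "i = j" using u I unfolding orthonormal_Rn_def
      by (metis lessThan_iff subsetD zero_neq_one)
  qed
  have fin: "finite I" using I finite_subset by blast
  show "independent (u ` I)"
  proof
    assume "dependent (u ` I)"
    then obtain c where c: "\<exists>v\<in>u ` I. c v \<noteq> 0" "(\<Sum>v\<in>u ` I. c v *\<^sub>R v) = 0"
      using dependent_finite[of "u ` I"] fin by auto
    from c(1) obtain j where j: "j \<in> I" "c (u j) \<noteq> 0" by auto
    have "0 = inner_Rn n (u j) (\<Sum>v\<in>u ` I. c v *\<^sub>R v)" using c(2) by simp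
    also have "\<dots> = (\<Sum>i\<in>I. c (u i) * inner_Rn n (u j) (u i))"
      by (simp add: sum.reindex[OF inj] inner_Rn_simps)
    also have "\<dots> = (\<Sum>i\<in>I. c (u i) * (if j = i then 1 else 0))"
      using u I j by (intro sum.cong) (auto simp: orthonormal_Rn_def subset_iff)
    also have "\<dots> = c (u j)" using j fin by (simp add: if_distrib[of "(*) _"] cong: if_cong)
    finally show False using j by simp
  qed
qed

text \<open>An orthonormal system in F of maximal length spans F: the residual of a missed vector
  stays in F and could be normalised and appended. This also ties the algebraic \<open>dim\<close>
  to orthonormal systems.\<close>

lemma subspace_orthonormal_basis:
  assumes F: "F \<subseteq> Rn n" "subspace F"
  shows "\<exists>u. orthonormal_Rn n (dim F) u \<and> F = span (u ` {..<dim F})"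
proof -
  let ?P = "\<lambda>m. \<exists>u. orthonormal_Rn n m u \<and> u ` {..<m} \<subseteq> F"
  have P0: "?P 0" by (auto simp: orthonormal_Rn_def)
  have bound: "\<And>m. ?P m \<Longrightarrow> m \<le> n" using orthonormal_card_le by blast
  define m where "m = Greatest ?P"
  have "?P m" unfolding m_def using P0 bound by (rule GreatestI_nat)
  then obtain u where u: "orthonormal_Rn n m u" "u ` {..<m} \<subseteq> F" by blast
  have sp: "F = span (u ` {..<m})"
  proof (intro antisym subsetI)
    fix x assume x: "x \<in> F"
    let ?r = "residual_Rn n m u x"
    have "(\<Sum>i<m. inner_Rn n (u i) x *\<^sub>R u i) \<in> span (u ` {..<m})"
      by (intro span_sum span_scale span_base) auto
    moreover have "?r = 0"
    proof (rule ccontr)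
      assume nz: "?r \<noteq> 0"
      have rn: "?r \<in> Rn n" using x F by (intro residual_mem_Rn[OF u(1)]) auto
      have "(\<Sum>i<m. inner_Rn n (u i) x *\<^sub>R u i) \<in> F"
        using u(2) by (intro subspace_sum[OF F(2)] subspace_scale[OF F(2)]) auto
      then have rF: "?r \<in> F" unfolding residual_Rn_def using x by (intro subspace_diff[OF F(2)])
      let ?a = "(1 / norm_Rn n ?r) *\<^sub>R ?r"
      have "orthonormal_Rn n (Suc m) (u(m := ?a))"
        using normalize_Rn[OF rn nz] residual_orthogonal[OF u(1)]
        by (intro orthonormal_Suc[OF u(1)]) (auto simp: inner_Rn_simps intro!: subspace_scale[OF subspace_Rn] rn)
      moreover have "(u(m := ?a)) ` {..<Suc m} \<subseteq> F"
        using u(2) rF by (auto simp: less_Suc_eq intro!: subspace_scale[OF F(2)])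
      ultimately have "?P (Suc m)" by blast
      then have "Suc m \<le> m" unfolding m_def using bound by (rule Greatest_le_nat)
      then show False by simp
    qed
    ultimately show "x \<in> span (u ` {..<m})" by (simp add: residual_Rn_def)
  next
    fix x assume "x \<in> span (u ` {..<m})"
    then show "x \<in> F" using span_minimal[OF u(2) F(2)] by blast
  qed
  have "dim F = m"
    using independent_orthonormal[OF u(1), of "{..<m}"] dim_eq_card_independent[of "u ` {..<m}"]
    by (simp add: sp card_image)
  then show ?thesis using u(1) sp by blast
qed

section \<open>The Grassmannian as a set of orthogonal complements\<close>

definition orth_comp_Rn :: "nat \<Rightarrow> nat \<Rightarrow> (nat \<Rightarrow> nat \<Rightarrow> real) \<Rightarrow> (nat \<Rightarrow> real) set"
  where "orth_comp_Rn n d u = {x \<in> Rn n. \<forall>i<d. inner_Rn n (u i) x = 0}"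

lemma subspace_orth_comp: "subspace (orth_comp_Rn n d u)"
  using subspace_Rn[of n] by (auto simp: subspace_def orth_comp_Rn_def inner_Rn_simps)

lemma orth_comp_expansion:
  assumes u: "orthonormal_Rn n n u" and "d \<le> n" "x \<in> orth_comp_Rn n d u"
  shows "x = (\<Sum>i\<in>{d..<n}. inner_Rn n (u i) x *\<^sub>R u i)"
proof -
  have x: "x \<in> Rn n" "\<And>i. i < d \<Longrightarrow> inner_Rn n (u i) x = 0"
    using assms(3) by (auto simp: orth_comp_Rn_def)
  have "x = (\<Sum>i<n. inner_Rn n (u i) x *\<^sub>R u i)"
    by (rule orthonormal_expansion[OF u x(1)])
  also have "\<dots> = (\<Sum>i\<in>{d..<n}. inner_Rn n (u i) x *\<^sub>R u i)"
    using x(2) by (intro sum.mono_neutral_right) auto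
  finally show ?thesis .
qed

lemma basis_mem_orth_comp:
  "orthonormal_Rn n n u \<Longrightarrow> i \<in> {d..<n} \<Longrightarrow> u i \<in> orth_comp_Rn n d u"
  by (auto simp: orth_comp_Rn_def orthonormal_Rn_def)

lemma orth_comp_eq_span:
  assumes u: "orthonormal_Rn n n u" and d: "d \<le> n"
  shows "orth_comp_Rn n d u = span (u ` {d..<n})"
proof (intro antisym subsetI)
  fix x assume "x \<in> orth_comp_Rn n d u"
  then have "x = (\<Sum>i\<in>{d..<n}. inner_Rn n (u i) x *\<^sub>R u i)"
    by (rule orth_comp_expansion[OF u d])
  also have "\<dots> \<in> span (u ` {d..<n})"
    by (intro span_sum span_scale span_base) auto
  finally show "x \<in> span (u ` {d..<n})" .
next
  fix x assume "x \<in> span (u ` {d..<n})"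
  moreover have "span (u ` {d..<n}) \<subseteq> orth_comp_Rn n d u"
    using basis_mem_orth_comp[OF u] by (intro span_minimal subspace_orth_comp) auto
  ultimately show "x \<in> orth_comp_Rn n d u" by blast
qed

text \<open>Codimension d is recorded by d vectors that annihilate F, the form in which kernels of
  matrices with d rows appear; the other n - d vectors of the frame span F and yield its
  projection.\<close>

lemma grassmannian_eq:
  assumes d: "d \<le> n"
  shows "grassmannian n (n - d) = {orth_comp_Rn n d u | u. orthonormal_Rn n n u}"
proof (intro antisym subsetI)
  fix F assume "F \<in> grassmannian n (n - d)"
  then have F: "F \<subseteq> Rn n" "subspace F" "dim F = n - d" by (auto simp: grassmannian_def)
  obtain w where w: "orthonormal_Rn n (n - d) w" "F = span (w ` {..<n - d})"
    using subspace_orthonormal_basis[OF F(1,2)] F(3) by auto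
  obtain v where v: "orthonormal_Rn n n v" "\<forall>i<n - d. v i = w i"
    using orthonormal_extend[OF w(1)] by blast
  \<comment> \<open>Reversing the order moves the basis of F to the last n - d positions, so that
    the first d vectors span the complement.\<close>
  define u where "u i = v (n - 1 - i)" for i
  have u: "orthonormal_Rn n n u"
    unfolding orthonormal_Rn_def
  proof (intro conjI allI impI)
    fix i j assume "i < n" "j < n"
    moreover have "(n - 1 - i = n - 1 - j) = (i = j)" using calculation by auto
    ultimately show "inner_Rn n (u i) (u j) = (if i = j then 1 else 0)" "u i \<in> Rn n"
      using v(1) by (auto simp: orthonormal_Rn_def u_def)
  qed
  have "u ` {d..<n} = w ` {..<n - d}"
  proof (intro antisym subsetI)
    fix x assume "x \<in> u ` {d..<n}"
    then obtain i where "x = u i" "d \<le> i" "i < n" by auto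
    then show "x \<in> w ` {..<n - d}"
      using v(2) by (intro image_eqI[of _ _ "n - 1 - i"]) (auto simp: u_def)
  next
    fix x assume "x \<in> w ` {..<n - d}"
    then obtain i where "x = w i" "i < n - d" by auto
    then show "x \<in> u ` {d..<n}"
      using v(2) by (intro image_eqI[of _ _ "n - 1 - i"]) (auto simp: u_def)
  qed
  then have "F = orth_comp_Rn n d u"
    using orth_comp_eq_span[OF u d] w(2) by simp
  then show "F \<in> {orth_comp_Rn n d u | u. orthonormal_Rn n n u}" using u by blast
next
  fix F assume "F \<in> {orth_comp_Rn n d u | u. orthonormal_Rn n n u}"
  then obtain u where u: "orthonormal_Rn n n u" and F: "F = orth_comp_Rn n d u" by blast
  have "dim F = n - d"
    using independent_orthonormal[OF u, of "{d..<n}"] dim_eq_card_independent[of "u ` {d..<n}"]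
    by (simp add: F orth_comp_eq_span[OF u d] card_image ivl_subset subset_iff)
  then show "F \<in> grassmannian n (n - d)"
    using subspace_orth_comp[of n d u] by (auto simp: F grassmannian_def orth_comp_Rn_def)
qed

lemma orth_proj_orth_comp:
  assumes u: "orthonormal_Rn n n u" and d: "d \<le> n" and x: "x \<in> Rn n"
  shows "orth_proj n (orth_comp_Rn n d u) x = (\<Sum>i\<in>{d..<n}. inner_Rn n (u i) x *\<^sub>R u i)"
    (is "_ = ?p")
  unfolding orth_proj_def
proof (rule the_equality, intro conjI ballI)
  show pF: "?p \<in> orth_comp_Rn n d u"
    using basis_mem_orth_comp[OF u]
    by (intro subspace_sum[OF subspace_orth_comp] subspace_scale[OF subspace_orth_comp]) auto
  show o: "inner_Rn n (x - ?p) z = 0" if "z \<in> orth_comp_Rn n d u" for z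
  proof -
    have "inner_Rn n x z = (\<Sum>i\<in>{d..<n}. inner_Rn n (u i) z * inner_Rn n x (u i))"
      by (subst (1) orth_comp_expansion[OF u d that]) (simp add: inner_Rn_simps)
    then show ?thesis
      by (simp add: inner_Rn_simps inner_Rn_commute mult.commute)
  qed
  fix y assume y: "y \<in> orth_comp_Rn n d u \<and> (\<forall>z\<in>orth_comp_Rn n d u. inner_Rn n (x - y) z = 0)"
  then have D: "?p - y \<in> orth_comp_Rn n d u" using pF by (intro subspace_diff[OF subspace_orth_comp]) auto
  have "inner_Rn n (?p - y) (?p - y) = inner_Rn n (x - y) (?p - y) - inner_Rn n (x - ?p) (?p - y)"
    by (simp add: inner_Rn_diff_left)
  also have "\<dots> = 0" using o[OF D] y D by simp
  finally have "?p - y = 0" using D by (subst (asm) inner_Rn_self_eq_0) (auto simp: orth_comp_Rn_def)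
  then show "y = ?p" by simp
qed

lemma proj_matrix_orth_comp:
  assumes u: "orthonormal_Rn n n u" and d: "d \<le> n" and "i < n" "j < n"
  shows "proj_matrix n (orth_comp_Rn n d u) (i, j) = (\<Sum>t\<in>{d..<n}. u t i * u t j)"
  using assms orth_proj_orth_comp[OF u d, of "unit_Rn j"]
  by (simp add: proj_matrix_def unit_Rn_def[symmetric] sum_fun_apply mult.commute)

text \<open>The orthogonal matrix with rows u_0, ..., u_(n-1), cut off so as to land in
  \<open>Rn n\<close>. Each member of \<open>orth_maps\<close> agrees on \<open>Rn n\<close> with
  such a map, which reduces measurability to matrix entries.\<close>

definition frame_map :: "nat \<Rightarrow> (nat \<Rightarrow> nat \<Rightarrow> real) \<Rightarrow> (nat \<Rightarrow> real) \<Rightarrow> nat \<Rightarrow> real"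
  where "frame_map n u x = (\<lambda>l. if l < n then inner_Rn n (u l) x else 0)"

lemma frame_map_mem [simp]: "frame_map n u x \<in> Rn n"
  by (simp add: frame_map_def mem_Rn)

lemma inner_frame_map:
  assumes "orthonormal_Rn n n u" "x \<in> Rn n"
  shows "inner_Rn n (frame_map n u x) (frame_map n u y) = inner_Rn n x y"
  unfolding Parseval_Rn[OF assms, of y] by (subst inner_Rn_def) (simp add: frame_map_def)

lemma frame_map_orth_maps: "orthonormal_Rn n n u \<Longrightarrow> frame_map n u \<in> orth_maps n"
  unfolding orth_maps_def
  by (auto simp: inner_frame_map intro!: linearI)
    (auto simp: frame_map_def inner_Rn_simps fun_eq_iff)

lemma orth_maps_mem: "U \<in> orth_maps n \<Longrightarrow> x \<in> Rn n \<Longrightarrow> U x \<in> Rn n"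
  by (auto simp: orth_maps_def)

lemma orth_maps_inner:
  "U \<in> orth_maps n \<Longrightarrow> x \<in> Rn n \<Longrightarrow> y \<in> Rn n \<Longrightarrow> inner_Rn n (U x) (U y) = inner_Rn n x y"
  by (auto simp: orth_maps_def)

lemma orth_maps_norm: "U \<in> orth_maps n \<Longrightarrow> x \<in> Rn n \<Longrightarrow> norm_Rn n (U x) = norm_Rn n x"
  using orth_maps_inner[of U n x x] by (simp add: inner_Rn_self)

lemma orth_maps_orthonormal:
  "U \<in> orth_maps n \<Longrightarrow> orthonormal_Rn n m u \<Longrightarrow> orthonormal_Rn n m (\<lambda>i. U (u i))"
  by (auto simp: orthonormal_Rn_def orth_maps_mem orth_maps_inner)

lemma orth_maps_image_orth_comp:
  assumes U: "U \<in> orth_maps n" and u: "orthonormal_Rn n n u" and d: "d \<le> n"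
  shows "U ` orth_comp_Rn n d u = orth_comp_Rn n d (\<lambda>i. U (u i))"
proof (intro antisym subsetI)
  fix y assume "y \<in> U ` orth_comp_Rn n d u"
  then show "y \<in> orth_comp_Rn n d (\<lambda>i. U (u i))"
    using U u d by (auto simp: orth_comp_Rn_def orth_maps_mem orth_maps_inner orthonormal_Rn_def)
next
  fix y assume y: "y \<in> orth_comp_Rn n d (\<lambda>i. U (u i))"
  have lin: "linear U" using U by (simp add: orth_maps_def)
  have "y = (\<Sum>i\<in>{d..<n}. inner_Rn n (U (u i)) y *\<^sub>R U (u i))"
    by (rule orth_comp_expansion[OF orth_maps_orthonormal[OF U u] d y])
  also have "\<dots> = U (\<Sum>i\<in>{d..<n}. inner_Rn n (U (u i)) y *\<^sub>R u i)"
    by (simp add: linear_sum[OF lin] linear_scale[OF lin])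
  also have "\<dots> \<in> U ` orth_comp_Rn n d u"
    using basis_mem_orth_comp[OF u]
    by (intro imageI subspace_sum[OF subspace_orth_comp] subspace_scale[OF subspace_orth_comp]) auto
  finally show "y \<in> U ` orth_comp_Rn n d u" .
qed

lemma orth_maps_apply:
  assumes "linear U" "x \<in> Rn n"
  shows "U x = (\<Sum>j<n. x j *\<^sub>R U (unit_Rn j))"
proof -
  have "x = (\<Sum>j<n. x j *\<^sub>R unit_Rn j)"
    using orthonormal_expansion[OF orthonormal_unit_Rn assms(2)] by simp
  then have "U x = U (\<Sum>j<n. x j *\<^sub>R unit_Rn j)" by simp
  then show ?thesis by (simp add: linear_sum[OF assms(1)] linear_scale[OF assms(1)])
qed

definition orth_rows :: "nat \<Rightarrow> ((nat \<Rightarrow> real) \<Rightarrow> nat \<Rightarrow> real) \<Rightarrow> nat \<Rightarrow> nat \<Rightarrow> real"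
  where "orth_rows n U l = (\<lambda>i. if i < n then U (unit_Rn i) l else 0)"

lemma frame_map_orth_rows:
  assumes U: "U \<in> orth_maps n" and x: "x \<in> Rn n"
  shows "frame_map n (orth_rows n U) x = U x"
proof (rule Rn_eqI)
  fix l assume "l < n"
  have "linear U" using U by (simp add: orth_maps_def)
  from orth_maps_apply[OF this x] have "U x l = (\<Sum>j<n. x j * U (unit_Rn j) l)"
    by (simp add: sum_fun_apply)
  then show "frame_map n (orth_rows n U) x l = U x l"
    using \<open>l < n\<close> by (simp add: frame_map_def orth_rows_def inner_Rn_def mult.commute)
qed (use U x orth_maps_mem in auto)

text \<open>The columns of U are orthonormal since U is isometric; Parseval for this basis, applied
  to two unit vectors, is orthonormality of the rows.\<close>

lemma orthonormal_orth_rows: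
  assumes U: "U \<in> orth_maps n"
  shows "orthonormal_Rn n n (orth_rows n U)"
proof -
  have c: "orthonormal_Rn n n (\<lambda>i. U (unit_Rn i))"
    by (rule orth_maps_orthonormal[OF U orthonormal_unit_Rn])
  show ?thesis unfolding orthonormal_Rn_def
  proof (intro conjI allI impI)
    fix l m assume "l < n" "m < n"
    moreover have "unit_Rn l m = (if l = m then 1 else 0)" by (simp add: unit_Rn_def)
    ultimately show "inner_Rn n (orth_rows n U l) (orth_rows n U m) = (if l = m then 1 else 0)"
      using Parseval_Rn[OF c, of "unit_Rn l" "unit_Rn m"]
      by (subst inner_Rn_def) (simp add: orth_rows_def)
  qed (simp add: orth_rows_def mem_Rn)
qed

lemma grassmannian_subset_Rn: "F \<in> grassmannian n k \<Longrightarrow> F \<subseteq> Rn n"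
  by (simp add: grassmannian_def)

lemma image_grassmannian:
  assumes U: "U \<in> orth_maps n" and d: "d \<le> n" and F: "F \<in> grassmannian n (n - d)"
  shows "U ` F \<in> grassmannian n (n - d)"
proof -
  obtain u where "orthonormal_Rn n n u" "F = orth_comp_Rn n d u"
    using F by (auto simp: grassmannian_eq[OF d])
  then have "U ` F = orth_comp_Rn n d (\<lambda>i. U (u i))" "orthonormal_Rn n n (\<lambda>i. U (u i))"
    using orth_maps_image_orth_comp[OF U _ d] orth_maps_orthonormal[OF U] by auto
  then show ?thesis
    unfolding grassmannian_eq[OF d] by blast
qed

text \<open>Conjugation of the projection by the orthogonal matrix with rows u. The new entries are
  polynomials in the frame and the old entries, whence measurability jointly in the frame and the
  subspace.\<close>

lemma proj_matrix_frame_map: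
  assumes u: "orthonormal_Rn n n u" and d: "d \<le> n" and F: "F \<in> grassmannian n (n - d)"
    and ij: "i < n" "j < n"
  shows "proj_matrix n (frame_map n u ` F) (i, j)
    = (\<Sum>k<n. \<Sum>l<n. u i k * proj_matrix n F (k, l) * u j l)"
proof -
  obtain v where v: "orthonormal_Rn n n v" and F: "F = orth_comp_Rn n d v"
    using F by (auto simp: grassmannian_eq[OF d])
  note U = frame_map_orth_maps[OF u]
  have "proj_matrix n (frame_map n u ` F) (i, j)
      = (\<Sum>t\<in>{d..<n}. frame_map n u (v t) i * frame_map n u (v t) j)"
    using proj_matrix_orth_comp[OF orth_maps_orthonormal[OF U v] d ij]
    by (simp add: F orth_maps_image_orth_comp[OF U v d])
  also have "\<dots> = (\<Sum>t\<in>{d..<n}. \<Sum>k<n. \<Sum>l<n. u i k * (v t k * v t l) * u j l)"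
    using ij by (simp add: frame_map_def inner_Rn_def sum_product algebra_simps)
  also have "\<dots> = (\<Sum>k<n. \<Sum>t\<in>{d..<n}. \<Sum>l<n. u i k * (v t k * v t l) * u j l)"
    by (rule sum.swap)
  also have "\<dots> = (\<Sum>k<n. \<Sum>l<n. \<Sum>t\<in>{d..<n}. u i k * (v t k * v t l) * u j l)"
    by (intro sum.cong refl sum.swap)
  also have "\<dots> = (\<Sum>k<n. \<Sum>l<n. u i k * proj_matrix n F (k, l) * u j l)"
    using proj_matrix_orth_comp[OF v d]
    by (intro sum.cong refl) (simp add: F sum_distrib_left sum_distrib_right)
  finally show ?thesis .
qed

section \<open>Lebesgue and Gaussian measure under orthogonal maps\<close>

lemma sets_lborel_Rn [simp, measurable_cong]: "sets (lborel_Rn n) = sets borel"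
  by (simp add: lborel_Rn_def)

lemma space_lborel_Rn [simp]: "space (lborel_Rn n) = UNIV"
  by (simp add: lborel_Rn_def)

lemma measurable_fun_coord [measurable]: "(\<lambda>x::nat \<Rightarrow> real. x i) \<in> borel_measurable borel"
  by (intro borel_measurable_continuous_onI continuous_on_product_coordinates)

lemma measurable_inner_Rn [measurable]:
  assumes [measurable]: "f \<in> borel_measurable M" "g \<in> borel_measurable M"
  shows "(\<lambda>x. inner_Rn n (f x) (g x)) \<in> borel_measurable M"
proof -
  have [measurable]: "(\<lambda>x. f x i) \<in> borel_measurable M" "(\<lambda>x. g x i) \<in> borel_measurable M" for i
    by measurable
  show ?thesis unfolding inner_Rn_def by measurable
qed

lemma measurable_fun_upd_coord [measurable]:
  assumes [measurable]: "g \<in> borel_measurable borel"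
  shows "(\<lambda>x::nat \<Rightarrow> real. x(p := g x)) \<in> borel_measurable borel"
proof (rule measurable_coordinatewise_then_product)
  fix i show "(\<lambda>x. (x(p := g x)) i) \<in> borel_measurable borel"
    by (cases "i = p") simp_all
qed

lemma measurable_fun_upd_value: "(\<lambda>t::real. y(p := t)) \<in> borel_measurable borel"
  for y :: "nat \<Rightarrow> real"
proof (rule measurable_coordinatewise_then_product)
  fix i show "(\<lambda>t. (y(p := t)) i) \<in> borel_measurable borel"
    by (cases "i = p") simp_all
qed

lemma measurable_extend_borel [measurable]: "extend_Rn n \<in> borel_measurable borel"
proof (rule measurable_coordinatewise_then_product)
  fix i show "(\<lambda>x. extend_Rn n x i) \<in> borel_measurable borel"
    by (cases "i < n") (simp_all add: extend_Rn_def)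
qed

lemma nn_integral_lborel_Rn:
  "f \<in> borel_measurable borel \<Longrightarrow>
    (\<integral>\<^sup>+x. f x \<partial>lborel_Rn n) = (\<integral>\<^sup>+x. f (extend_Rn n x) \<partial>Pi\<^sub>M {..<n} (\<lambda>_. lborel))"
  unfolding lborel_Rn_def by (rule nn_integral_distr[OF measurable_extend_Rn]) simp

lemma AE_lborel_Rn: "AE x in lborel_Rn n. x \<in> Rn n"
  unfolding lborel_Rn_def
proof (subst AE_distr_iff[OF measurable_extend_Rn])
  have "closed (Rn n)"
    using closedin_Euclidean_imp_closed[OF closedin_topspace] .
  then show "{x \<in> space borel. x \<in> Rn n} \<in> sets borel" by simp
qed simp

lemma extend_Rn_fun_upd: "p < n \<Longrightarrow> extend_Rn n (x(p := t)) = (extend_Rn n x)(p := t)"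
  by (auto simp: extend_Rn_def)

interpretation lborel_prod: product_sigma_finite "\<lambda>_::nat. lborel :: real measure"
  by standard

lemma nn_integral_lborel_Rn_coord:
  assumes [measurable]: "f \<in> borel_measurable borel" and p: "p < n"
  shows "(\<integral>\<^sup>+x. f x \<partial>lborel_Rn n) =
    (\<integral>\<^sup>+x. \<integral>\<^sup>+t. f ((extend_Rn n x)(p := t)) \<partial>lborel \<partial>Pi\<^sub>M ({..<n} - {p}) (\<lambda>_. lborel))"
proof -
  have eq: "{..<n} = insert p ({..<n} - {p})" using p by auto
  have m: "(\<lambda>x. f (extend_Rn n x)) \<in> borel_measurable (Pi\<^sub>M (insert p ({..<n} - {p})) (\<lambda>_. lborel))"
    using measurable_compose[OF measurable_extend_Rn assms(1), of n] eq by simp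
  have "(\<integral>\<^sup>+x. f x \<partial>lborel_Rn n)
      = (\<integral>\<^sup>+x. f (extend_Rn n x) \<partial>Pi\<^sub>M (insert p ({..<n} - {p})) (\<lambda>_. lborel))"
    unfolding nn_integral_lborel_Rn[OF assms(1)] by (simp only: eq[symmetric])
  also have "\<dots> = (\<integral>\<^sup>+x. \<integral>\<^sup>+t. f (extend_Rn n (x(p := t))) \<partial>lborel \<partial>Pi\<^sub>M ({..<n} - {p}) (\<lambda>_. lborel))"
    by (rule lborel_prod.product_nn_integral_insert[OF _ _ m]) auto
  finally show ?thesis
    by (simp only: extend_Rn_fun_upd[OF p])
qed

text \<open>Tonelli with the other coordinates frozen: \<phi> does not see the p-th coordinate, so
  what remains is a translation of the line, possibly with a flip.\<close>

lemma nn_integral_lborel_Rn_shear: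
  assumes [measurable]: "f \<in> borel_measurable borel" "\<phi> \<in> borel_measurable borel"
    and p: "p < n" and \<phi>: "\<And>x t. \<phi> (x(p := t)) = \<phi> x" and \<sigma>: "\<bar>\<sigma>\<bar> = (1::real)"
  shows "(\<integral>\<^sup>+x. f (x(p := \<sigma> * x p + \<phi> x)) \<partial>lborel_Rn n) = (\<integral>\<^sup>+x. f x \<partial>lborel_Rn n)"
proof -
  have "(\<integral>\<^sup>+t. f (y(p := \<sigma> * t + \<phi> y)) \<partial>lborel) = (\<integral>\<^sup>+t. f (y(p := t)) \<partial>lborel)" for y :: "nat \<Rightarrow> real"
  proof -
    note measurable_fun_upd_value [measurable]
    show ?thesis
      using nn_integral_real_affine[of "\<lambda>t. f (y(p := t))" \<sigma> "\<phi> y"] \<sigma> by (simp add: add.commute)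
  qed
  note * = this
  show ?thesis
    by (subst (1 2) nn_integral_lborel_Rn_coord[OF _ p]) (simp_all add: \<phi> *)
qed

definition reflect_Rn :: "nat \<Rightarrow> (nat \<Rightarrow> real) \<Rightarrow> (nat \<Rightarrow> real) \<Rightarrow> nat \<Rightarrow> real"
  where "reflect_Rn n a x = x - (2 * inner_Rn n a x) *\<^sub>R a"

lemma measurable_reflect_Rn [measurable]: "reflect_Rn n a \<in> borel_measurable borel"
  by (rule measurable_coordinatewise_then_product) (simp add: reflect_Rn_def)

lemma nn_integral_lborel_Rn_transvection:
  fixes c :: "nat \<Rightarrow> real"
  assumes [measurable]: "f \<in> borel_measurable borel"
    and J: "finite J" "J \<subseteq> {..<n}" "p \<notin> J"
  shows "(\<integral>\<^sup>+x. f (\<lambda>j. if j \<in> J then x j + c j * x p else x j) \<partial>lborel_Rn n) = (\<integral>\<^sup>+x. f x \<partial>lborel_Rn n)"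
  using J
proof (induction J rule: finite_induct)
  case (insert j J)
  let ?T = "\<lambda>x l. if l \<in> J then x l + c l * x p else x l"
  have [measurable]: "?T \<in> borel_measurable borel"
  proof (rule measurable_coordinatewise_then_product)
    fix i show "(\<lambda>x. ?T x i) \<in> borel_measurable borel" by (cases "i \<in> J") simp_all
  qed
  have [simp]: "j < n" "j \<noteq> p" "p \<noteq> j" using insert.prems by auto
  have eq: "(\<lambda>l. if l \<in> insert j J then x l + c l * x p else x l) = ?T (x(j := 1 * x j + c j * x p))" for x
    using insert by (auto simp: fun_eq_iff)
  have "(\<integral>\<^sup>+x. f (?T (x(j := 1 * x j + c j * x p))) \<partial>lborel_Rn n) = (\<integral>\<^sup>+x. f (?T x) \<partial>lborel_Rn n)"
    by (rule nn_integral_lborel_Rn_shear[where f="\<lambda>x. f (?T x)"]) auto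
  then show ?case unfolding eq using insert by simp
qed simp

text \<open>
  In the coordinates where \<open>x\<^sub>p\<close> is replaced by \<open>\<langle>a, x\<rangle> / a\<^sub>p\<close>, the reflection along \<open>a\<close> only
  translates the other coordinates by multiples of the \<open>p\<close>-th one and flips the sign of the latter.
\<close>

lemma nn_integral_lborel_Rn_reflect:
  assumes [measurable]: "f \<in> borel_measurable borel"
    and a: "a \<in> Rn n" "inner_Rn n a a = 1"
  shows "(\<integral>\<^sup>+x. f (reflect_Rn n a x) \<partial>lborel_Rn n) = (\<integral>\<^sup>+x. f x \<partial>lborel_Rn n)"
proof -
  obtain p where p: "p < n" "a p \<noteq> 0"
    using a inner_Rn_self_eq_0[of a n] Rn_eqI[of a n 0] by (force simp: mem_Rn)
  define J where "J = {..<n} - {p}"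
  define \<phi> where "\<phi> x = (\<Sum>j\<in>J. a j / a p * x j)" for x :: "nat \<Rightarrow> real"
  define T where "T x = (\<lambda>j. if j \<in> J then x j + (- 2 * a j * a p) * x p else x j)" for x
  have \<phi>p: "\<phi> (x(p := t)) = \<phi> x" for x t
    unfolding \<phi>_def by (intro sum.cong) (auto simp: J_def)
  have [measurable]: "\<phi> \<in> borel_measurable borel" unfolding \<phi>_def by measurable
  have [measurable]: "T \<in> borel_measurable borel"
  proof (rule measurable_coordinatewise_then_product)
    fix i show "(\<lambda>x. T x i) \<in> borel_measurable borel" by (cases "i \<in> J") (simp_all add: T_def)
  qed
  have sumJ: "(\<Sum>j\<in>J. g j) = (\<Sum>j<n. g j) - g p" for g :: "nat \<Rightarrow> real"
    unfolding J_def using p by (subst sum_diff1) auto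
  \<comment> \<open>\<open>L\<close> puts <a, x> / a_p in position p and \<open>L'\<close> undoes a
    map of this type; the factors 1 and -1 are spelled out to fit the shear lemma.\<close>
  define L where "L x = x(p := 1 * x p + \<phi> x)" for x :: "nat \<Rightarrow> real"
  define L' where "L' x = x(p := 1 * x p + (- \<phi> x))" for x :: "nat \<Rightarrow> real"
  define D where "D x = x(p := (-1) * x p + 0)" for x :: "nat \<Rightarrow> real"
  have [measurable]: "L' \<in> borel_measurable borel" "D \<in> borel_measurable borel"
    unfolding L'_def D_def by measurable
  have sa: "(\<Sum>j<n. (a j)\<^sup>2) = 1" using a(2) by (simp add: inner_Rn_def power2_eq_square)
  have \<phi>L: "x p + \<phi> x = inner_Rn n a x / a p" for x
    using p by (simp add: \<phi>_def sumJ inner_Rn_def sum_divide_distrib)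
  have Lp: "L x p = inner_Rn n a x / a p" "j \<noteq> p \<Longrightarrow> L x j = x j" for x j
    by (simp_all add: L_def \<phi>L)
  have TL: "D (T (L x)) j = (if j = p then - inner_Rn n a x / a p
      else if j < n then x j - 2 * inner_Rn n a x * a j else x j)" for x j
    using p by (auto simp: D_def T_def J_def Lp)
  have \<phi>T: "\<phi> (D (T (L x))) = (inner_Rn n a x - a p * x p) / a p - 2 * inner_Rn n a x * (1 - (a p)\<^sup>2) / a p" for x
  proof -
    have "\<phi> (D (T (L x))) = (\<Sum>j\<in>J. a j * x j / a p - 2 * inner_Rn n a x * ((a j)\<^sup>2 / a p))"
      unfolding \<phi>_def by (intro sum.cong) (auto simp: TL J_def algebra_simps power2_eq_square diff_divide_distrib)
    also have "\<dots> = (\<Sum>j\<in>J. a j * x j) / a p - 2 * inner_Rn n a x * ((\<Sum>j\<in>J. (a j)\<^sup>2) / a p)"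
      by (simp add: sum_subtractf sum_distrib_left sum_divide_distrib)
    finally show ?thesis by (simp add: sumJ sa inner_Rn_def)
  qed
  have R: "reflect_Rn n a x = L' (D (T (L x)))" for x
  proof
    fix j
    consider "j = p" | "j \<noteq> p" "j < n" | "j \<noteq> p" "\<not> j < n" by blast
    then show "reflect_Rn n a x j = L' (D (T (L x))) j"
    proof cases
      case 1
      have "L' (D (T (L x))) p = - inner_Rn n a x / a p - \<phi> (D (T (L x)))"
        by (simp add: L'_def TL)
      also have "\<dots> = x p - 2 * inner_Rn n a x * a p"
        unfolding \<phi>T using p by (simp add: field_simps power2_eq_square)
      finally show ?thesis using 1 by (simp add: reflect_Rn_def)
    next
      case 2
      then show ?thesis by (simp add: L'_def TL reflect_Rn_def)
    next
      case 3
      then have "a j = 0" using a(1) by (simp add: mem_Rn)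
      with 3 show ?thesis by (simp add: L'_def TL reflect_Rn_def)
    qed
  qed
  have "(\<integral>\<^sup>+x. f (reflect_Rn n a x) \<partial>lborel_Rn n) = (\<integral>\<^sup>+x. f (L' (D (T (L x)))) \<partial>lborel_Rn n)"
    by (simp add: R)
  also have "\<dots> = (\<integral>\<^sup>+x. f (L' (D (T x))) \<partial>lborel_Rn n)"
    unfolding L_def
    by (rule nn_integral_lborel_Rn_shear[where f="\<lambda>x. f (L' (D (T x)))", OF _ _ p(1) \<phi>p]) auto
  also have "\<dots> = (\<integral>\<^sup>+x. f (L' (D x)) \<partial>lborel_Rn n)"
    unfolding T_def
    by (rule nn_integral_lborel_Rn_transvection[where f="\<lambda>x. f (L' (D x))"]) (auto simp: J_def)
  also have "\<dots> = (\<integral>\<^sup>+x. f (L' x) \<partial>lborel_Rn n)"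
    unfolding D_def
    by (rule nn_integral_lborel_Rn_shear[where f="\<lambda>x. f (L' x)", OF _ _ p(1)]) auto
  also have "\<dots> = (\<integral>\<^sup>+x. f x \<partial>lborel_Rn n)"
    unfolding L'_def
    by (rule nn_integral_lborel_Rn_shear[OF _ _ p(1)]) (simp_all only: \<phi>p, simp_all)
  finally show ?thesis .
qed

lemma reflect_orth_maps:
  assumes a: "a \<in> Rn n" "inner_Rn n a a = 1"
  shows "reflect_Rn n a \<in> orth_maps n"
proof -
  have "linear (reflect_Rn n a)"
    by (intro linearI) (simp_all add: reflect_Rn_def inner_Rn_simps algebra_simps)
  moreover have "reflect_Rn n a x \<in> Rn n" if "x \<in> Rn n" for x
    using that a(1) by (auto simp: reflect_Rn_def intro!: subspace_diff[OF subspace_Rn] subspace_scale[OF subspace_Rn])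
  moreover have "inner_Rn n (reflect_Rn n a x) (reflect_Rn n a y) = inner_Rn n x y" for x y
    using a(2) inner_Rn_commute[of n x a] by (simp add: reflect_Rn_def inner_Rn_simps)
  ultimately show ?thesis by (auto simp: orth_maps_def)
qed

lemma reflect_reflect:
  assumes "inner_Rn n a a = 1"
  shows "reflect_Rn n a (reflect_Rn n a x) = x"
  using assms by (simp add: reflect_Rn_def inner_Rn_simps fun_eq_iff)

lemma orth_maps_compose:
  assumes "U \<in> orth_maps n" "V \<in> orth_maps n"
  shows "(\<lambda>x. U (V x)) \<in> orth_maps n"
  using assms linear_compose[of V U] by (auto simp: orth_maps_def o_def image_subset_iff)

lemma measurable_linear_extend:
  fixes U :: "(nat \<Rightarrow> real) \<Rightarrow> nat \<Rightarrow> real"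
  assumes U: "linear U"
  shows "(\<lambda>x. U (extend_Rn n x)) \<in> borel_measurable borel"
proof (rule measurable_coordinatewise_then_product)
  fix i
  have "U (extend_Rn n x) i = (\<Sum>j<n. x j * U (unit_Rn j) i)" for x
    using orth_maps_apply[OF U extend_Rn_mem, of n x] by (simp add: sum_fun_apply extend_Rn_def)
  then show "(\<lambda>x. U (extend_Rn n x) i) \<in> borel_measurable borel" by simp
qed

lemma nn_integral_lborel_Rn_cong:
  "(\<And>x. x \<in> Rn n \<Longrightarrow> f x = g x) \<Longrightarrow> (\<integral>\<^sup>+x. f x \<partial>lborel_Rn n) = (\<integral>\<^sup>+x. g x \<partial>lborel_Rn n)"
  using AE_lborel_Rn[of n] by (intro nn_integral_cong_AE) auto

text \<open>Householder reduction: if U fixes the unit vectors below k, the reflection along U e_k -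
  e_k carries U e_k to e_k and still fixes the earlier ones. After n rounds only the identity is
  left, so invariance under reflections suffices and no determinant appears.\<close>

lemma nn_integral_lborel_Rn_orth_map:
  assumes f: "f \<in> borel_measurable borel" and U: "U \<in> orth_maps n"
  shows "(\<integral>\<^sup>+x. f (U (extend_Rn n x)) \<partial>lborel_Rn n) = (\<integral>\<^sup>+x. f x \<partial>lborel_Rn n)"
proof -
  have "(\<integral>\<^sup>+x. f (U (extend_Rn n x)) \<partial>lborel_Rn n) = (\<integral>\<^sup>+x. f x \<partial>lborel_Rn n)"
    if "f \<in> borel_measurable borel" "U \<in> orth_maps n" "k \<le> n" "\<forall>i<k. U (unit_Rn i) = unit_Rn i" for f U k
    using that
  proof (induction "n - k" arbitrary: k f U)
    case 0
    then have "U x = x" if "x \<in> Rn n" for x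
      using orth_maps_apply[of U x n] that orthonormal_expansion[OF orthonormal_unit_Rn that]
      by (simp add: orth_maps_def)
    then show ?case
      by (intro nn_integral_lborel_Rn_cong) (simp add: extend_Rn_id)
  next
    case (Suc m)
    then have kn: "k < n" and m: "m = n - Suc k" by auto
    note f[measurable] = Suc.prems(1) and U = Suc.prems(2)
    show ?case
    proof (cases "U (unit_Rn k) = unit_Rn k")
      case True
      then show ?thesis
        using Suc.prems kn by (intro Suc.hyps(1)[OF m]) (auto simp: less_Suc_eq)
    next
      case False
      define w where "w = U (unit_Rn k) - unit_Rn k"
      have kk: "unit_Rn k k = 1" by (simp add: unit_Rn_def)
      have Uk: "U (unit_Rn k) \<in> Rn n" "inner_Rn n (U (unit_Rn k)) (U (unit_Rn k)) = 1"
        using kn orth_maps_mem[OF U] orth_maps_inner[OF U, of "unit_Rn k" "unit_Rn k"]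
        by (auto simp: kk)
      have w: "w \<in> Rn n" "w \<noteq> 0"
        using False Uk kn by (auto simp: w_def intro!: subspace_diff[OF subspace_Rn])
      define a where "a = (1 / norm_Rn n w) *\<^sub>R w"
      have a: "a \<in> Rn n" "inner_Rn n a a = 1"
        using normalize_Rn[OF w] w by (auto simp: a_def intro!: subspace_scale[OF subspace_Rn])
      define V where "V x = reflect_Rn n a (U x)" for x
      have V: "V \<in> orth_maps n"
        unfolding V_def by (rule orth_maps_compose[OF reflect_orth_maps[OF a] U])
      have wi: "inner_Rn n w (unit_Rn i) = 0" if "i < k" for i
      proof -
        have "U (unit_Rn i) = unit_Rn i" using that Suc.prems by simp
        then have "inner_Rn n (U (unit_Rn k)) (unit_Rn i) = inner_Rn n (unit_Rn k) (unit_Rn i)"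
          using orth_maps_inner[OF U, of "unit_Rn k" "unit_Rn i"] kn that by simp
        then show ?thesis by (simp add: w_def inner_Rn_diff_left)
      qed
      \<comment> \<open>With w = U e_k - e_k and both vectors of unit length, |w|^2 = 2 <w, U e_k>;
        the reflection therefore subtracts exactly w from U e_k.\<close>
      have ww: "inner_Rn n w w = 2 * inner_Rn n w (U (unit_Rn k))"
        using Uk kn inner_Rn_commute[of n "U (unit_Rn k)" "unit_Rn k"]
        by (simp add: w_def inner_Rn_simps kk)
      have nz: "inner_Rn n w w \<noteq> 0" using w inner_Rn_self_eq_0 by blast
      have "V (unit_Rn k) = U (unit_Rn k) - (2 * inner_Rn n w (U (unit_Rn k)) / (norm_Rn n w)\<^sup>2) *\<^sub>R w"
        by (simp add: V_def reflect_Rn_def a_def inner_Rn_simps power2_eq_square)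
      also have "2 * inner_Rn n w (U (unit_Rn k)) / (norm_Rn n w)\<^sup>2 = 1"
        using nz ww by (simp add: inner_Rn_self[symmetric])
      finally have Vk: "V (unit_Rn k) = unit_Rn k" by (simp add: w_def)
      have Vi: "V (unit_Rn i) = unit_Rn i" if "i < k" for i
        using wi[OF that] Suc.prems that by (simp add: V_def reflect_Rn_def a_def inner_Rn_simps)
      have "(\<integral>\<^sup>+x. f (U (extend_Rn n x)) \<partial>lborel_Rn n)
          = (\<integral>\<^sup>+x. f (reflect_Rn n a (V (extend_Rn n x))) \<partial>lborel_Rn n)"
        using a by (simp add: V_def reflect_reflect)
      also have "\<dots> = (\<integral>\<^sup>+x. f (reflect_Rn n a x) \<partial>lborel_Rn n)"
        using Vk Vi kn V by (intro Suc.hyps(1)[OF m, where f="\<lambda>x. f (reflect_Rn n a x)"]) (auto simp: less_Suc_eq)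
      also have "\<dots> = (\<integral>\<^sup>+x. f x \<partial>lborel_Rn n)"
        by (rule nn_integral_lborel_Rn_reflect[OF f a])
      finally show ?thesis .
    qed
  qed
  from this[OF f U, of 0] show ?thesis by simp
qed

lemma nn_integral_lborel_Rn_prod:
  fixes f :: "nat \<Rightarrow> real \<Rightarrow> ennreal"
  assumes [measurable]: "\<And>i. i < n \<Longrightarrow> f i \<in> borel_measurable borel"
  shows "(\<integral>\<^sup>+x. (\<Prod>i<n. f i (x i)) \<partial>lborel_Rn n) = (\<Prod>i<n. \<integral>\<^sup>+t. f i t \<partial>lborel)"
proof -
  have [measurable]: "(\<lambda>x::nat\<Rightarrow>real. \<Prod>i<n. f i (x i)) \<in> borel_measurable borel"
    by (intro borel_measurable_prod_ennreal measurable_compose[OF measurable_fun_coord]) auto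
  have "(\<integral>\<^sup>+x. (\<Prod>i<n. f i (x i)) \<partial>lborel_Rn n) = (\<integral>\<^sup>+x. (\<Prod>i<n. f i (x i)) \<partial>Pi\<^sub>M {..<n} (\<lambda>_. lborel))"
    by (subst nn_integral_lborel_Rn) (auto simp: extend_Rn_def)
  also have "\<dots> = (\<Prod>i<n. \<integral>\<^sup>+t. f i t \<partial>lborel)"
    by (rule lborel_prod.product_nn_integral_prod) auto
  finally show ?thesis .
qed

section \<open>The standard Gaussian measure\<close>

definition gauss_Rn :: "nat \<Rightarrow> (nat \<Rightarrow> real) measure"
  where "gauss_Rn n = density (lborel_Rn n) (\<lambda>x. \<Prod>i<n. ennreal (std_normal_density (x i)))"

lemma sets_gauss_Rn [simp, measurable_cong]: "sets (gauss_Rn n) = sets borel"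
  by (simp add: gauss_Rn_def)

lemma space_gauss_Rn [simp]: "space (gauss_Rn n) = UNIV"
  by (simp add: gauss_Rn_def)

lemma gauss_density_eq:
  "(\<Prod>i<n. ennreal (std_normal_density (x i))) = ennreal ((1 / sqrt (2 * pi)) ^ n * exp (- inner_Rn n x x / 2))"
proof -
  have "(\<Prod>i<n. ennreal (std_normal_density (x i))) = ennreal (\<Prod>i<n. std_normal_density (x i))"
    by (simp add: prod_ennreal)
  also have "(\<Prod>i<n. std_normal_density (x i)) = (1 / sqrt (2 * pi)) ^ n * exp (\<Sum>i<n. - (x i)\<^sup>2 / 2)"
    unfolding std_normal_density_def prod.distrib exp_sum[OF finite_lessThan] by simp
  also have "(\<Sum>i<n. - (x i)\<^sup>2 / 2) = - inner_Rn n x x / 2"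
    by (simp add: inner_Rn_def sum_negf sum_divide_distrib power2_eq_square)
  finally show ?thesis .
qed

lemma nn_integral_gauss_Rn:
  assumes [measurable]: "f \<in> borel_measurable borel"
  shows "(\<integral>\<^sup>+x. f x \<partial>gauss_Rn n) = (\<integral>\<^sup>+x. (\<Prod>i<n. ennreal (std_normal_density (x i))) * f x \<partial>lborel_Rn n)"
  unfolding gauss_Rn_def by (subst nn_integral_density) auto

lemma nn_integral_normal_density: "0 < \<sigma> \<Longrightarrow> (\<integral>\<^sup>+t. ennreal (normal_density \<mu> \<sigma> t) \<partial>lborel) = 1"
  by (simp add: nn_integral_eq_integral)

lemma prob_space_gauss_Rn: "prob_space (gauss_Rn n)"
proof
  have "emeasure (gauss_Rn n) UNIV = (\<integral>\<^sup>+x. 1 \<partial>gauss_Rn n)" by simp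
  also have "\<dots> = 1"
    by (subst nn_integral_gauss_Rn) (simp_all add: nn_integral_lborel_Rn_prod[where f="\<lambda>_ t. ennreal (std_normal_density t)"] nn_integral_normal_density)
  finally show "emeasure (gauss_Rn n) (space (gauss_Rn n)) = 1" by simp
qed

lemma nn_integral_gauss_Rn_orth_map:
  assumes f [measurable]: "f \<in> borel_measurable borel" and U: "U \<in> orth_maps n"
  shows "(\<integral>\<^sup>+x. f (U (extend_Rn n x)) \<partial>gauss_Rn n) = (\<integral>\<^sup>+x. f x \<partial>gauss_Rn n)"
proof -
  have lin: "linear U" using U by (simp add: orth_maps_def)
  have [measurable]: "(\<lambda>x. U (extend_Rn n x)) \<in> borel_measurable borel"
    by (rule measurable_linear_extend[OF lin])
  define g where "g x = (\<Prod>i<n. ennreal (std_normal_density (x i))) * f x" for x :: "nat \<Rightarrow> real"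
  have [measurable]: "g \<in> borel_measurable borel" unfolding g_def by measurable
  have "(\<integral>\<^sup>+x. f (U (extend_Rn n x)) \<partial>gauss_Rn n)
      = (\<integral>\<^sup>+x. (\<Prod>i<n. ennreal (std_normal_density (x i))) * f (U (extend_Rn n x)) \<partial>lborel_Rn n)"
    by (simp add: nn_integral_gauss_Rn)
  also have "\<dots> = (\<integral>\<^sup>+x. g (U (extend_Rn n x)) \<partial>lborel_Rn n)"
    by (rule nn_integral_lborel_Rn_cong)
      (simp add: g_def gauss_density_eq orth_maps_inner[OF U] extend_Rn_id)
  also have "\<dots> = (\<integral>\<^sup>+x. g x \<partial>lborel_Rn n)"
    by (rule nn_integral_lborel_Rn_orth_map[OF _ U]) simp
  also have "\<dots> = (\<integral>\<^sup>+x. f x \<partial>gauss_Rn n)"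
    by (simp add: nn_integral_gauss_Rn g_def)
  finally show ?thesis .
qed

lemma distr_gauss_Rn_orth_map:
  assumes U: "U \<in> orth_maps n"
  shows "distr (gauss_Rn n) (gauss_Rn n) (\<lambda>x. U (extend_Rn n x)) = gauss_Rn n"
proof (rule measure_eqI)
  have lin: "linear U" using U by (simp add: orth_maps_def)
  have m: "(\<lambda>x. U (extend_Rn n x)) \<in> gauss_Rn n \<rightarrow>\<^sub>M gauss_Rn n"
    using measurable_linear_extend[OF lin] by (simp cong: measurable_cong_sets)
  fix A assume "A \<in> sets (distr (gauss_Rn n) (gauss_Rn n) (\<lambda>x. U (extend_Rn n x)))"
  then have A: "A \<in> sets borel" by simp
  have "emeasure (distr (gauss_Rn n) (gauss_Rn n) (\<lambda>x. U (extend_Rn n x))) A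
      = (\<integral>\<^sup>+x. indicator A x \<partial>distr (gauss_Rn n) (gauss_Rn n) (\<lambda>x. U (extend_Rn n x)))"
    using A by simp
  also have "\<dots> = (\<integral>\<^sup>+x. indicator A (U (extend_Rn n x)) \<partial>gauss_Rn n)"
    using A by (intro nn_integral_distr m) simp
  also have "\<dots> = (\<integral>\<^sup>+x. indicator A x \<partial>gauss_Rn n)"
    using A by (intro nn_integral_gauss_Rn_orth_map[OF _ U]) simp
  finally show "emeasure (distr (gauss_Rn n) (gauss_Rn n) (\<lambda>x. U (extend_Rn n x))) A = emeasure (gauss_Rn n) A"
    using A by simp
qed simp

text \<open>Rotating a to the first axis turns <a, x> into |a| x_0, and the remaining coordinates
  integrate to 1.\<close>

lemma nn_integral_gauss_Rn_inner:
  assumes [measurable]: "f \<in> borel_measurable borel" and n: "0 < n" and a: "a \<in> Rn n"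
  shows "(\<integral>\<^sup>+x. f (inner_Rn n a x) \<partial>gauss_Rn n) = (\<integral>\<^sup>+t. ennreal (std_normal_density t) * f (norm_Rn n a * t) \<partial>lborel)"
proof -
  have "\<exists>v. orthonormal_Rn n n v \<and> a = norm_Rn n a *\<^sub>R v 0"
  proof (cases "a = 0")
    case True
    then show ?thesis using orthonormal_unit_Rn by auto
  next
    case False
    have "orthonormal_Rn n (Suc 0) (\<lambda>_. (1 / norm_Rn n a) *\<^sub>R a)"
      using normalize_Rn[OF a False] a by (auto simp: orthonormal_Rn_def intro!: subspace_scale[OF subspace_Rn])
    from orthonormal_extend[OF this] obtain v
      where "orthonormal_Rn n n v" "v 0 = (1 / norm_Rn n a) *\<^sub>R a" by auto
    then show ?thesis using False a norm_Rn_eq_0[OF a] by (intro exI[of _ v]) simp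
  qed
  then obtain v where v: "orthonormal_Rn n n v" and av: "a = norm_Rn n a *\<^sub>R v 0" by blast
  note U = frame_map_orth_maps[OF v]
  have in0: "inner_Rn n a x = norm_Rn n a * frame_map n v (extend_Rn n x) 0" for x
  proof -
    have "inner_Rn n a x = norm_Rn n a * inner_Rn n (v 0) x" by (subst av) (simp add: inner_Rn_simps)
    then show ?thesis using n by (simp add: frame_map_def inner_Rn_def extend_Rn_def)
  qed
  have "(\<integral>\<^sup>+x. f (inner_Rn n a x) \<partial>gauss_Rn n) = (\<integral>\<^sup>+x. f (norm_Rn n a * x 0) \<partial>gauss_Rn n)"
    unfolding in0 by (rule nn_integral_gauss_Rn_orth_map[OF _ U, where f="\<lambda>x. f (norm_Rn n a * x 0)"]) simp
  also have "\<dots> = (\<integral>\<^sup>+x. (\<Prod>i<n. ennreal (std_normal_density (x i)) * (if i = 0 then f (norm_Rn n a * x i) else 1)) \<partial>lborel_Rn n)"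
    using n by (subst nn_integral_gauss_Rn) (simp_all add: prod.distrib prod.delta)
  also have "\<dots> = (\<Prod>i<n. \<integral>\<^sup>+t. ennreal (std_normal_density t) * (if i = 0 then f (norm_Rn n a * t) else 1) \<partial>lborel)"
    by (rule nn_integral_lborel_Rn_prod) measurable
  also have "\<dots> = (\<Prod>i<n. if i = 0 then \<integral>\<^sup>+t. ennreal (std_normal_density t) * f (norm_Rn n a * t) \<partial>lborel else 1)"
    by (intro prod.cong) (auto simp: nn_integral_normal_density)
  also have "\<dots> = (\<integral>\<^sup>+t. ennreal (std_normal_density t) * f (norm_Rn n a * t) \<partial>lborel)"
    using n by (simp add: prod.delta)
  finally show ?thesis .
qed

lemma gauss_Rn_hyperplane:
  assumes n: "0 < n" and a: "a \<in> Rn n" "a \<noteq> 0"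
  shows "emeasure (gauss_Rn n) {x. inner_Rn n a x = 0} = 0"
proof -
  have "emeasure (gauss_Rn n) {x. inner_Rn n a x = 0} = (\<integral>\<^sup>+x. indicator {x. inner_Rn n a x = 0} x \<partial>gauss_Rn n)"
    by (subst nn_integral_indicator) (auto simp: measurable_sets_borel)
  also have "\<dots> = (\<integral>\<^sup>+x. indicator {0} (inner_Rn n a x) \<partial>gauss_Rn n)"
    by (intro nn_integral_cong) (auto split: split_indicator)
  also have "\<dots> = (\<integral>\<^sup>+t. ennreal (std_normal_density t) * indicator {0} (norm_Rn n a * t) \<partial>lborel)"
    by (rule nn_integral_gauss_Rn_inner[OF _ n a(1)]) simp
  also have "\<dots> = (\<integral>\<^sup>+(t::real). 0 \<partial>lborel)"
  proof (rule nn_integral_cong_AE)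
    have "AE t in lborel. t \<noteq> (0::real)" by (rule AE_lborel_singleton)
    then show "AE t in lborel. ennreal (std_normal_density t) * indicator {0} (norm_Rn n a * t) = 0"
      by eventually_elim (use norm_Rn_eq_0[OF a(1)] a(2) in auto)
  qed
  finally show ?thesis by simp
qed

lemma nn_integral_gauss_Rn_exp_square:
  assumes n: "0 < n" and a: "a \<in> Rn n" and c: "2 * c * inner_Rn n a a < 1"
  shows "(\<integral>\<^sup>+x. ennreal (exp (c * (inner_Rn n a x)\<^sup>2)) \<partial>gauss_Rn n) = ennreal (1 / sqrt (1 - 2 * c * inner_Rn n a a))"
proof -
  define \<sigma> where "\<sigma> = 1 / sqrt (1 - 2 * c * inner_Rn n a a)"
  have \<sigma>: "0 < \<sigma>" "\<sigma>\<^sup>2 = 1 / (1 - 2 * c * inner_Rn n a a)" using c by (simp_all add: \<sigma>_def power_divide)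
  have "std_normal_density t * exp (c * (norm_Rn n a * t)\<^sup>2) = \<sigma> * normal_density 0 \<sigma> t" for t
  proof -
    have "- t\<^sup>2 / (2 * \<sigma>\<^sup>2) = - t\<^sup>2 / 2 + c * (norm_Rn n a * t)\<^sup>2"
      using c by (simp add: \<sigma> inner_Rn_self field_simps power_mult_distrib)
    then have "exp (- t\<^sup>2 / (2 * \<sigma>\<^sup>2)) = exp (- t\<^sup>2 / 2) * exp (c * (norm_Rn n a * t)\<^sup>2)"
      by (simp add: mult_exp_exp)
    then show ?thesis using \<sigma>(1) by (simp add: normal_density_def real_sqrt_mult)
  qed
  note * = this
  have "(\<integral>\<^sup>+x. ennreal (exp (c * (inner_Rn n a x)\<^sup>2)) \<partial>gauss_Rn n)
      = (\<integral>\<^sup>+t. ennreal (std_normal_density t) * ennreal (exp (c * (norm_Rn n a * t)\<^sup>2)) \<partial>lborel)"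
    by (rule nn_integral_gauss_Rn_inner[OF _ n a]) simp
  also have "\<dots> = (\<integral>\<^sup>+t. ennreal \<sigma> * ennreal (normal_density 0 \<sigma> t) \<partial>lborel)"
    using \<sigma>(1) by (intro nn_integral_cong) (simp add: ennreal_mult'[symmetric] *)
  also have "\<dots> = ennreal \<sigma>"
    using \<sigma>(1) by (subst nn_integral_cmult) (auto simp: nn_integral_normal_density)
  finally show ?thesis by (simp add: \<sigma>_def)
qed

section \<open>The Haar measure on the Grassmannian\<close>

text \<open>Since 1 / 0 = 0, a row that depends on the earlier ones yields the zero vector, and the
  recursion stays total with values in \<open>Rn n\<close>.\<close>

fun gram_schmidt_Rn :: "nat \<Rightarrow> (nat \<Rightarrow> nat \<Rightarrow> real) \<Rightarrow> nat \<Rightarrow> nat \<Rightarrow> real" where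
  "gram_schmidt_Rn n G k =
    (let r = extend_Rn n (G k) - (\<Sum>j<k. inner_Rn n (gram_schmidt_Rn n G j) (extend_Rn n (G k)) *\<^sub>R gram_schmidt_Rn n G j)
     in (1 / norm_Rn n r) *\<^sub>R r)"

declare gram_schmidt_Rn.simps [simp del]

lemma gram_schmidt_residual:
  "gram_schmidt_Rn n G k = (1 / norm_Rn n (residual_Rn n k (gram_schmidt_Rn n G) (extend_Rn n (G k)))) *\<^sub>R
    residual_Rn n k (gram_schmidt_Rn n G) (extend_Rn n (G k))"
  by (subst gram_schmidt_Rn.simps) (simp add: residual_Rn_def Let_def)

lemma gram_schmidt_mem [simp]: "gram_schmidt_Rn n G k \<in> Rn n"
proof (induction k rule: less_induct)
  case (less k)
  show ?case
    by (subst gram_schmidt_Rn.simps)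
      (auto simp: Let_def intro!: subspace_scale[OF subspace_Rn] subspace_diff[OF subspace_Rn] sum_scaleR_mem_Rn less)
qed

lemma gram_schmidt_cong:
  "(\<And>j. j \<le> k \<Longrightarrow> G j = G' j) \<Longrightarrow> gram_schmidt_Rn n G k = gram_schmidt_Rn n G' k"
proof (induction k rule: less_induct)
  case (less k)
  have "gram_schmidt_Rn n G j = gram_schmidt_Rn n G' j" if "j < k" for j
    using less that by auto
  then show ?case
    using less.prems[of k] by (subst (1 2) gram_schmidt_Rn.simps) simp
qed

lemma orthonormal_gram_schmidt_Suc:
  assumes o: "orthonormal_Rn n k (gram_schmidt_Rn n G)"
    and r: "residual_Rn n k (gram_schmidt_Rn n G) (extend_Rn n (G k)) \<noteq> 0"
  shows "orthonormal_Rn n (Suc k) (gram_schmidt_Rn n G)"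
proof -
  let ?r = "residual_Rn n k (gram_schmidt_Rn n G) (extend_Rn n (G k))"
  have rm: "?r \<in> Rn n" by (rule residual_mem_Rn[OF o]) simp
  have "orthonormal_Rn n (Suc k) ((gram_schmidt_Rn n G)(k := gram_schmidt_Rn n G k))"
  proof (rule orthonormal_Suc[OF o])
    show "inner_Rn n (gram_schmidt_Rn n G k) (gram_schmidt_Rn n G k) = 1"
      unfolding gram_schmidt_residual[of n G k] by (rule normalize_Rn[OF rm r])
    show "inner_Rn n (gram_schmidt_Rn n G i) (gram_schmidt_Rn n G k) = 0" if "i < k" for i
      unfolding gram_schmidt_residual[of n G k]
      using residual_orthogonal[OF o that] by (simp add: inner_Rn_simps)
  qed simp
  then show ?thesis by simp
qed

text \<open>Each row is a combination of the first k + 1 output vectors even when some of them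
  vanish. Hence the complement of the frame lies in the kernel of the matrix.\<close>

lemma gram_schmidt_spans:
  assumes x: "x \<in> Rn n" and o: "\<And>i. i \<le> k \<Longrightarrow> inner_Rn n (gram_schmidt_Rn n G i) x = 0"
  shows "inner_Rn n (extend_Rn n (G k)) x = 0"
proof -
  let ?r = "residual_Rn n k (gram_schmidt_Rn n G) (extend_Rn n (G k))"
  have rm: "?r \<in> Rn n"
    unfolding residual_Rn_def by (intro subspace_diff[OF subspace_Rn] sum_scaleR_mem_Rn) auto
  have "inner_Rn n ?r x = 0"
  proof (cases "?r = 0")
    case False
    then have "norm_Rn n ?r \<noteq> 0" using rm norm_Rn_eq_0 by blast
    moreover have "(1 / norm_Rn n ?r) * inner_Rn n ?r x = 0"
      using o[of k] by (simp add: gram_schmidt_residual[of n G k] inner_Rn_simps)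
    ultimately show ?thesis by simp
  qed simp
  then show ?thesis
    using o by (simp add: residual_Rn_def inner_Rn_simps)
qed

text \<open>Only linear combinations, inner products and norms occur in the recursion, and U
  respects all of them. This equivariance hands the rotation invariance of the rows over to the
  frame.\<close>

lemma gram_schmidt_orth_map:
  assumes U: "U \<in> orth_maps n" and "\<And>j. j \<le> k \<Longrightarrow> G' j = U (extend_Rn n (G j))"
  shows "gram_schmidt_Rn n G' k = U (gram_schmidt_Rn n G k)"
  using assms(2)
proof (induction k rule: less_induct)
  case (less k)
  have lin: "linear U" using U by (simp add: orth_maps_def)
  have IH: "gram_schmidt_Rn n G' j = U (gram_schmidt_Rn n G j)" if "j < k" for j
    using less that by auto
  let ?r = "residual_Rn n k (gram_schmidt_Rn n G) (extend_Rn n (G k))"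
  have rm: "?r \<in> Rn n"
    unfolding residual_Rn_def by (intro subspace_diff[OF subspace_Rn] sum_scaleR_mem_Rn) auto
  have e: "extend_Rn n (G' k) = U (extend_Rn n (G k))"
    using less.prems[of k] orth_maps_mem[OF U] by (simp add: extend_Rn_id)
  have "residual_Rn n k (gram_schmidt_Rn n G') (extend_Rn n (G' k)) = U ?r"
    unfolding residual_Rn_def e
    by (simp add: IH orth_maps_inner[OF U] linear_diff[OF lin] linear_sum[OF lin] linear_scale[OF lin])
  then have "gram_schmidt_Rn n G' k = (1 / norm_Rn n ?r) *\<^sub>R U ?r"
    using orth_maps_norm[OF U rm] gram_schmidt_residual[of n G' k] by simp
  also have "\<dots> = U (gram_schmidt_Rn n G k)"
    by (simp only: gram_schmidt_residual[of n G k] linear_scale[OF lin])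
  finally show ?case .
qed

text \<open>All n rows are drawn: the first d cut out the random subspace, and the complete frame
  serves as a random orthogonal map in the proof of uniqueness.\<close>

definition gauss_mat :: "nat \<Rightarrow> (nat \<Rightarrow> nat \<Rightarrow> real) measure"
  where "gauss_mat n = Pi\<^sub>M {..<n} (\<lambda>_. gauss_Rn n)"

lemma product_prob_space_gauss: "product_prob_space (\<lambda>_::nat. gauss_Rn n)"
  by (rule product_prob_spaceI) (rule prob_space_gauss_Rn)

lemma product_sigma_finite_gauss: "product_sigma_finite (\<lambda>_::nat. gauss_Rn n)"
  using product_prob_space_gauss[of n] by (simp add: product_prob_space_def)

lemma prob_space_gauss_mat: "prob_space (gauss_mat n)"
  unfolding gauss_mat_def by (rule prob_space_PiM) (rule prob_space_gauss_Rn)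

lemma measurable_gauss_mat_row: "k < n \<Longrightarrow> (\<lambda>G. G k) \<in> borel_measurable (gauss_mat n)"
  using measurable_component_singleton[of k "{..<n}" "\<lambda>_. gauss_Rn n"]
  by (simp add: gauss_mat_def cong: measurable_cong_sets)

lemma measurable_fun_scaleR_diff_sum:
  fixes u :: "'b \<Rightarrow> 'a \<Rightarrow> nat \<Rightarrow> real"
  assumes [measurable]: "f \<in> borel_measurable M" "\<And>j. j \<in> J \<Longrightarrow> c j \<in> borel_measurable M"
    "\<And>j. j \<in> J \<Longrightarrow> u j \<in> borel_measurable M"
  shows "(\<lambda>x. f x - (\<Sum>j\<in>J. c j x *\<^sub>R u j x)) \<in> borel_measurable M"
proof (rule measurable_coordinatewise_then_product)
  fix i
  have [measurable]: "(\<lambda>x. f x i) \<in> borel_measurable M" "j \<in> J \<Longrightarrow> (\<lambda>x. u j x i) \<in> borel_measurable M" for j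
    by (auto intro: measurable_compose[OF _ measurable_fun_coord] assms)
  show "(\<lambda>x. (f x - (\<Sum>j\<in>J. c j x *\<^sub>R u j x)) i) \<in> borel_measurable M"
    by (simp add: sum_fun_apply) measurable
qed

lemma measurable_fun_scaleR:
  fixes f :: "'a \<Rightarrow> nat \<Rightarrow> real"
  assumes [measurable]: "f \<in> borel_measurable M" "c \<in> borel_measurable M"
  shows "(\<lambda>x. c x *\<^sub>R f x) \<in> borel_measurable M"
proof (rule measurable_coordinatewise_then_product)
  fix i
  have [measurable]: "(\<lambda>x. f x i) \<in> borel_measurable M"
    by (rule measurable_compose[OF _ measurable_fun_coord]) simp
  show "(\<lambda>x. (c x *\<^sub>R f x) i) \<in> borel_measurable M" by simp
qed

lemma norm_Rn_eq_sqrt: "norm_Rn n x = sqrt (inner_Rn n x x)"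
  by (simp add: inner_Rn_self)

lemma measurable_norm_Rn [measurable]:
  "f \<in> borel_measurable M \<Longrightarrow> (\<lambda>x. norm_Rn n (f x)) \<in> borel_measurable M"
  unfolding norm_Rn_eq_sqrt by measurable

lemma measurable_residual:
  assumes [measurable]: "f \<in> borel_measurable M" "\<And>j. j < k \<Longrightarrow> (\<lambda>x. u x j) \<in> borel_measurable M"
  shows "(\<lambda>x. residual_Rn n k (u x) (f x)) \<in> borel_measurable M"
  unfolding residual_Rn_def
  by (rule measurable_fun_scaleR_diff_sum) auto

lemma measurable_gram_schmidt:
  "k < n \<Longrightarrow> (\<lambda>G. gram_schmidt_Rn n G k) \<in> borel_measurable (gauss_mat n)"
proof (induction k rule: less_induct)
  case (less k)
  have [measurable]: "(\<lambda>G. extend_Rn n (G k)) \<in> borel_measurable (gauss_mat n)"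
    using measurable_compose[OF measurable_gauss_mat_row[OF less.prems] measurable_extend_borel] .
  have [measurable]: "(\<lambda>G. residual_Rn n k (gram_schmidt_Rn n G) (extend_Rn n (G k))) \<in> borel_measurable (gauss_mat n)"
    using less by (intro measurable_residual) auto
  show ?case
    by (subst gram_schmidt_residual) (rule measurable_fun_scaleR; measurable)
qed

lemma orthonormal_gram_schmidt_iff:
  "orthonormal_Rn n m (gram_schmidt_Rn n G) \<longleftrightarrow>
    (\<forall>i\<in>{..<m}. \<forall>j\<in>{..<m}. inner_Rn n (gram_schmidt_Rn n G i) (gram_schmidt_Rn n G j) = (if i = j then 1 else 0))"
  by (auto simp: orthonormal_Rn_def)

lemma measurable_orthonormal_gram_schmidt:
  assumes "m \<le> n"
  shows "Measurable.pred (gauss_mat n) (\<lambda>G. orthonormal_Rn n m (gram_schmidt_Rn n G))"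
proof -
  have "Measurable.pred (gauss_mat n)
     (\<lambda>G. inner_Rn n (gram_schmidt_Rn n G i) (gram_schmidt_Rn n G j) = (if i = j then 1 else 0))"
    if "i \<in> {..<m}" "j \<in> {..<m}" for i j
  proof -
  have [measurable]: "(\<lambda>G. gram_schmidt_Rn n G i) \<in> borel_measurable (gauss_mat n)"
    "(\<lambda>G. gram_schmidt_Rn n G j) \<in> borel_measurable (gauss_mat n)"
    using assms that by (auto intro: measurable_gram_schmidt)
  show ?thesis
    by measurable
  qed
  then show ?thesis
    unfolding orthonormal_gram_schmidt_iff by (intro pred_intros_finite finite_lessThan)
qed

text \<open>Fubini in row m: with the earlier rows fixed, failure at m puts the new row into the
  span of m < n unit vectors, hence into a hyperplane orthogonal to some unit vector a, and
  hyperplanes are Gaussian null sets.\<close>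

lemma AE_orthonormal_gram_schmidt: "AE G in gauss_mat n. orthonormal_Rn n n (gram_schmidt_Rn n G)"
proof -
  interpret product_sigma_finite "\<lambda>_::nat. gauss_Rn n" by (rule product_sigma_finite_gauss)
  have "AE G in gauss_mat n. orthonormal_Rn n m (gram_schmidt_Rn n G)" if "m \<le> n" for m
    using that
  proof (induction m)
    case 0
    then show ?case by (simp add: orthonormal_Rn_def)
  next
    case (Suc m)
    then have m: "m < n" by simp
    let ?r = "\<lambda>G. residual_Rn n m (gram_schmidt_Rn n G) (extend_Rn n (G m))"
    let ?B = "{G \<in> space (gauss_mat n). orthonormal_Rn n m (gram_schmidt_Rn n G) \<and> norm_Rn n (?r G) = 0}"
    have [measurable]: "(\<lambda>G. extend_Rn n (G m)) \<in> borel_measurable (gauss_mat n)"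
      using measurable_compose[OF measurable_gauss_mat_row[OF m] measurable_extend_borel] .
    have [measurable]: "?r \<in> borel_measurable (gauss_mat n)"
      using m by (intro measurable_residual measurable_gram_schmidt) auto
    have [measurable]: "Measurable.pred (gauss_mat n) (\<lambda>G. orthonormal_Rn n m (gram_schmidt_Rn n G))"
      using m by (intro measurable_orthonormal_gram_schmidt) simp
    have Bm: "?B \<in> sets (gauss_mat n)" by measurable
    have eq: "insert m ({..<n} - {m}) = {..<n}" using m by auto
    have mi: "indicator ?B \<in> borel_measurable (Pi\<^sub>M (insert m ({..<n} - {m})) (\<lambda>_. gauss_Rn n))"
      unfolding eq using Bm by (simp add: gauss_mat_def)
    have "emeasure (gauss_mat n) ?B = (\<integral>\<^sup>+G. indicator ?B G \<partial>gauss_mat n)"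
      using Bm by simp
    also have "\<dots> = (\<integral>\<^sup>+G. indicator ?B G \<partial>Pi\<^sub>M (insert m ({..<n} - {m})) (\<lambda>_. gauss_Rn n))"
      unfolding eq by (simp add: gauss_mat_def)
    also have "\<dots> = (\<integral>\<^sup>+G. \<integral>\<^sup>+y. indicator ?B (G(m := y)) \<partial>gauss_Rn n \<partial>Pi\<^sub>M ({..<n} - {m}) (\<lambda>_. gauss_Rn n))"
      by (rule product_nn_integral_insert[OF _ _ mi]) auto
    also have "\<dots> = (\<integral>\<^sup>+G. 0 \<partial>Pi\<^sub>M ({..<n} - {m}) (\<lambda>_. gauss_Rn n))"
    proof (rule nn_integral_cong)
      fix G :: "nat \<Rightarrow> nat \<Rightarrow> real"
      have gs: "gram_schmidt_Rn n (G(m := y)) j = gram_schmidt_Rn n G j" if "j < m" for j y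
        using that by (intro gram_schmidt_cong) auto
      have orth: "orthonormal_Rn n m (gram_schmidt_Rn n (G(m := y))) \<longleftrightarrow> orthonormal_Rn n m (gram_schmidt_Rn n G)" for y
        by (simp add: orthonormal_gram_schmidt_iff gs)
      show "(\<integral>\<^sup>+y. indicator ?B (G(m := y)) \<partial>gauss_Rn n) = 0"
      proof (cases "orthonormal_Rn n m (gram_schmidt_Rn n G)")
        case True
        obtain a where a: "a \<in> Rn n" "inner_Rn n a a = 1" "\<forall>i<m. inner_Rn n (gram_schmidt_Rn n G i) a = 0"
          using exists_unit_orthogonal[OF True m] by blast
        then have a0: "a \<noteq> 0" by auto
        have "(\<integral>\<^sup>+y. indicator ?B (G(m := y)) \<partial>gauss_Rn n) \<le> (\<integral>\<^sup>+y. indicator {y. inner_Rn n a y = 0} y \<partial>gauss_Rn n)"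
        proof (rule nn_integral_mono)
          fix y
          have "inner_Rn n a y = 0" if y: "norm_Rn n (?r (G(m := y))) = 0"
          proof -
          have "?r (G(m := y)) \<in> Rn n"
            unfolding residual_Rn_def by (intro subspace_diff[OF subspace_Rn] sum_scaleR_mem_Rn) auto
          then have "?r (G(m := y)) = 0" using y norm_Rn_eq_0 by blast
          then have "extend_Rn n y = (\<Sum>j<m. inner_Rn n (gram_schmidt_Rn n G j) (extend_Rn n y) *\<^sub>R gram_schmidt_Rn n G j)"
            by (simp add: residual_Rn_def gs)
          then have "inner_Rn n a (extend_Rn n y) = (\<Sum>j<m. inner_Rn n (gram_schmidt_Rn n G j) (extend_Rn n y) * inner_Rn n a (gram_schmidt_Rn n G j))"
            by (metis (no_types, lifting) inner_Rn_scaleR_right inner_Rn_sum_right sum.cong)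
          also have "\<dots> = 0" using a(3) by (simp add: inner_Rn_commute[of n a])
          finally show ?thesis by (simp add: inner_Rn_def extend_Rn_def)
          qed
          then show "(indicator ?B (G(m := y)) :: ennreal) \<le> indicator {y. inner_Rn n a y = 0} y"
            by (auto split: split_indicator)
        qed
        also have "\<dots> = 0"
          using gauss_Rn_hyperplane[OF _ a(1) a0] m
          by (subst nn_integral_indicator) (auto simp: measurable_sets_borel)
        finally show ?thesis by simp
      next
        case False
        then show ?thesis by (simp add: orth)
      qed
    qed
    finally have "?B \<in> null_sets (gauss_mat n)" using Bm by (simp add: null_sets_def)
    then have "AE G in gauss_mat n. G \<notin> ?B" by (rule AE_not_in)
    moreover have "AE G in gauss_mat n. orthonormal_Rn n m (gram_schmidt_Rn n G)" using Suc by simp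
    ultimately show ?case
      using AE_space
    proof eventually_elim
      case (elim G)
      then have "norm_Rn n (?r G) \<noteq> 0" by blast
      then have "?r G \<noteq> 0" by auto
      then show ?case using elim by (intro orthonormal_gram_schmidt_Suc) auto
    qed
  qed
  then show ?thesis by simp
qed

text \<open>Falling back to the standard basis on a null set makes this an orthonormal frame for
  every G, so that images and projections are always those of genuine members of the
  Grassmannian.\<close>

definition frame_Rn :: "nat \<Rightarrow> (nat \<Rightarrow> nat \<Rightarrow> real) \<Rightarrow> nat \<Rightarrow> nat \<Rightarrow> real"
  where "frame_Rn n G = (if orthonormal_Rn n n (gram_schmidt_Rn n G) then gram_schmidt_Rn n G else unit_Rn)"

lemma orthonormal_frame: "orthonormal_Rn n n (frame_Rn n G)"
  by (simp add: frame_Rn_def orthonormal_unit_Rn)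

lemma measurable_frame:
  assumes k: "k < n"
  shows "(\<lambda>G. frame_Rn n G k) \<in> borel_measurable (gauss_mat n)"
proof -
  have "(\<lambda>G. frame_Rn n G k)
      = (\<lambda>G. if orthonormal_Rn n n (gram_schmidt_Rn n G) then gram_schmidt_Rn n G k else unit_Rn k)"
    by (auto simp: frame_Rn_def fun_eq_iff)
  moreover have "\<dots> \<in> borel_measurable (gauss_mat n)"
    using measurable_orthonormal_gram_schmidt[of n n]
    by (intro measurable_If measurable_gram_schmidt[OF k]) (simp_all add: pred_def)
  ultimately show ?thesis by simp
qed

section \<open>Measurability of subspace-valued maps\<close>

lemma measurable_grassmannian_borel:
  assumes "\<And>\<omega>. \<omega> \<in> space N \<Longrightarrow> f \<omega> \<in> grassmannian n k"
    and "\<And>i j. i < n \<Longrightarrow> j < n \<Longrightarrow> (\<lambda>\<omega>. proj_matrix n (f \<omega>) (i, j)) \<in> borel_measurable N"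
  shows "f \<in> N \<rightarrow>\<^sub>M grassmannian_borel n k"
  unfolding grassmannian_borel_def
proof (rule measurable_vimage_algebra2)
  have "(\<lambda>\<omega>. proj_matrix n (f \<omega>)) = (\<lambda>\<omega>. \<lambda>p\<in>{..<n} \<times> {..<n}. proj_matrix n (f \<omega>) p)"
    unfolding proj_matrix_def by (simp only: restrict_restrict Int_absorb)
  moreover have "(\<lambda>\<omega>. proj_matrix n (f \<omega>) p) \<in> borel_measurable N" if "p \<in> {..<n} \<times> {..<n}" for p
    using assms(2)[of "fst p" "snd p"] that by (simp add: mem_Times_iff)
  ultimately show "(\<lambda>\<omega>. proj_matrix n (f \<omega>)) \<in> N \<rightarrow>\<^sub>M Pi\<^sub>M ({..<n} \<times> {..<n}) (\<lambda>_. borel)"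
    using measurable_restrict[of "{..<n} \<times> {..<n}" "\<lambda>p \<omega>. proj_matrix n (f \<omega>) p" N "\<lambda>_. borel"] by simp
qed (use assms(1) in auto)

lemma space_grassmannian_borel [simp]: "space (grassmannian_borel n k) = grassmannian n k"
  by (simp add: grassmannian_borel_def)

lemma measurable_proj_matrix:
  assumes "i < n" "j < n"
  shows "(\<lambda>F. proj_matrix n F (i, j)) \<in> borel_measurable (grassmannian_borel n k)"
proof -
  have "proj_matrix n \<in> grassmannian_borel n k \<rightarrow>\<^sub>M Pi\<^sub>M ({..<n} \<times> {..<n}) (\<lambda>_. borel)"
    unfolding grassmannian_borel_def
    by (rule measurable_vimage_algebra1) (auto simp: space_PiM proj_matrix_def)
  from measurable_compose[OF this measurable_component_singleton[of "(i, j)"]] show ?thesis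
    using assms by simp
qed

text \<open>Frame and subspace may both vary with \<omega>: the averaging argument for uniqueness
  applies Fubini to the pair.\<close>

lemma measurable_frame_map_image:
  assumes d: "d \<le> n" and u: "\<And>\<omega>. \<omega> \<in> space N \<Longrightarrow> orthonormal_Rn n n (u \<omega>)"
    and mu: "\<And>k. k < n \<Longrightarrow> (\<lambda>\<omega>. u \<omega> k) \<in> borel_measurable N"
    and F: "F \<in> N \<rightarrow>\<^sub>M grassmannian_borel n (n - d)"
  shows "(\<lambda>\<omega>. frame_map n (u \<omega>) ` F \<omega>) \<in> N \<rightarrow>\<^sub>M grassmannian_borel n (n - d)"
proof (rule measurable_grassmannian_borel)
  have Fm: "F \<omega> \<in> grassmannian n (n - d)" if "\<omega> \<in> space N" for \<omega>
    using measurable_space[OF F that] by simp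
  fix \<omega> assume "\<omega> \<in> space N"
  then show "frame_map n (u \<omega>) ` F \<omega> \<in> grassmannian n (n - d)"
    using image_grassmannian[OF frame_map_orth_maps[OF u] d Fm] by simp
next
  have Fm: "F \<omega> \<in> grassmannian n (n - d)" if "\<omega> \<in> space N" for \<omega>
    using measurable_space[OF F that] by simp
  fix i j assume ij: "i < n" "j < n"
  have "(\<lambda>\<omega>. \<Sum>k<n. \<Sum>l<n. u \<omega> i k * proj_matrix n (F \<omega>) (k, l) * u \<omega> j l) \<in> borel_measurable N"
    using ij by (intro borel_measurable_sum borel_measurable_times
        measurable_compose[OF mu measurable_fun_coord] measurable_compose[OF F measurable_proj_matrix]) auto
  then show "(\<lambda>\<omega>. proj_matrix n (frame_map n (u \<omega>) ` F \<omega>) (i, j)) \<in> borel_measurable N"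
    by (subst measurable_cong[OF proj_matrix_frame_map[OF u d Fm ij]]) auto
qed

lemma measurable_orth_map_image:
  assumes U: "U \<in> orth_maps n" and d: "d \<le> n"
  shows "(\<lambda>F. U ` F) \<in> grassmannian_borel n (n - d) \<rightarrow>\<^sub>M grassmannian_borel n (n - d)"
proof -
  have "(\<lambda>F. frame_map n (orth_rows n U) ` F) \<in> grassmannian_borel n (n - d) \<rightarrow>\<^sub>M grassmannian_borel n (n - d)"
    using orthonormal_orth_rows[OF U]
    by (intro measurable_frame_map_image[OF d, where u="\<lambda>_. orth_rows n U" and F="\<lambda>F. F"]) auto
  moreover have "frame_map n (orth_rows n U) ` F = U ` F" if "F \<in> grassmannian n (n - d)" for F
    using grassmannian_subset_Rn[OF that] frame_map_orth_rows[OF U] by (intro image_cong) auto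
  ultimately show ?thesis
    by (subst measurable_cong[where g="\<lambda>F. frame_map n (orth_rows n U) ` F"]) auto
qed

section \<open>Invariance of the Gaussian kernel and uniqueness of the Haar measure\<close>

definition act_mat :: "nat \<Rightarrow> ((nat \<Rightarrow> real) \<Rightarrow> nat \<Rightarrow> real) \<Rightarrow> (nat \<Rightarrow> nat \<Rightarrow> real) \<Rightarrow> nat \<Rightarrow> nat \<Rightarrow> real"
  where "act_mat n U = compose {..<n} (\<lambda>x. U (extend_Rn n x))"

lemma distr_act_mat:
  assumes U: "U \<in> orth_maps n"
  shows "distr (gauss_mat n) (gauss_mat n) (act_mat n U) = gauss_mat n"
proof -
  have lin: "linear U" using U by (simp add: orth_maps_def)
  have "distr (gauss_mat n) (gauss_mat n) (act_mat n U)
      = Pi\<^sub>M {..<n} (\<lambda>_. distr (gauss_Rn n) (gauss_Rn n) (\<lambda>x. U (extend_Rn n x)))"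
    unfolding gauss_mat_def act_mat_def
    using measurable_linear_extend[OF lin, of n]
    by (intro distr_PiM_finite_prob_space product_prob_space_gauss) (auto cong: measurable_cong_sets)
  then show ?thesis
    unfolding distr_gauss_Rn_orth_map[OF U] by (simp add: gauss_mat_def)
qed

lemma measurable_act_mat:
  assumes U: "U \<in> orth_maps n"
  shows "act_mat n U \<in> gauss_mat n \<rightarrow>\<^sub>M gauss_mat n"
proof -
  have lin: "linear U" using U by (simp add: orth_maps_def)
  have [measurable]: "(\<lambda>x. U (extend_Rn n x)) \<in> gauss_Rn n \<rightarrow>\<^sub>M gauss_Rn n"
    using measurable_linear_extend[OF lin, of n] by (simp cong: measurable_cong_sets)
  show ?thesis unfolding act_mat_def gauss_mat_def compose_def by measurable
qed

lemma frame_act_mat: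
  assumes U: "U \<in> orth_maps n" and o: "orthonormal_Rn n n (gram_schmidt_Rn n G)" and i: "i < n"
  shows "frame_Rn n (act_mat n U G) i = U (frame_Rn n G i)"
proof -
  have g: "gram_schmidt_Rn n (act_mat n U G) k = U (gram_schmidt_Rn n G k)" if "k < n" for k
    using that by (intro gram_schmidt_orth_map[OF U]) (auto simp: act_mat_def compose_def)
  have "orthonormal_Rn n n (gram_schmidt_Rn n (act_mat n U G))"
    using orth_maps_orthonormal[OF U o] by (simp add: orthonormal_Rn_def g)
  then show ?thesis using g[OF i] o by (simp add: frame_Rn_def)
qed

definition gauss_kernel :: "nat \<Rightarrow> nat \<Rightarrow> (nat \<Rightarrow> real) set measure"
  where "gauss_kernel n d =
    distr (gauss_mat n) (grassmannian_borel n (n - d)) (\<lambda>G. orth_comp_Rn n d (frame_Rn n G))"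

lemma orth_comp_cong: "(\<And>i. i < d \<Longrightarrow> u i = v i) \<Longrightarrow> orth_comp_Rn n d u = orth_comp_Rn n d v"
  by (simp add: orth_comp_Rn_def)

lemma measurable_orth_comp_frame:
  assumes d: "d \<le> n"
  shows "(\<lambda>G. orth_comp_Rn n d (frame_Rn n G)) \<in> gauss_mat n \<rightarrow>\<^sub>M grassmannian_borel n (n - d)"
proof (rule measurable_grassmannian_borel)
  fix G show "orth_comp_Rn n d (frame_Rn n G) \<in> grassmannian n (n - d)"
    using orthonormal_frame by (auto simp: grassmannian_eq[OF d])
next
  fix i j assume ij: "i < n" "j < n"
  have "(\<lambda>G. \<Sum>t\<in>{d..<n}. frame_Rn n G t i * frame_Rn n G t j) \<in> borel_measurable (gauss_mat n)"
    by (intro borel_measurable_sum borel_measurable_times measurable_compose[OF measurable_frame measurable_fun_coord]) auto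
  then show "(\<lambda>G. proj_matrix n (orth_comp_Rn n d (frame_Rn n G)) (i, j)) \<in> borel_measurable (gauss_mat n)"
    by (simp add: proj_matrix_orth_comp[OF orthonormal_frame d ij])
qed

text \<open>Rotating the kernel equals, almost surely, taking the kernel of the matrix with rotated
  rows, and rotating the rows does not change the law of the matrix.\<close>

lemma is_haar_gauss_kernel:
  assumes d: "d \<le> n"
  shows "is_haar_grassmannian n (n - d) (gauss_kernel n d)"
  unfolding is_haar_grassmannian_def
proof (intro conjI ballI)
  show "sets (gauss_kernel n d) = sets (grassmannian_borel n (n - d))"
    by (simp add: gauss_kernel_def)
  show "prob_space (gauss_kernel n d)"
    unfolding gauss_kernel_def
    by (rule prob_space.prob_space_distr[OF prob_space_gauss_mat measurable_orth_comp_frame[OF d]])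
  fix U assume U: "U \<in> orth_maps n"
  let ?gb = "grassmannian_borel n (n - d)"
  note mk = measurable_orth_comp_frame[OF d]
  have "distr (gauss_kernel n d) ?gb (\<lambda>F. U ` F)
      = distr (gauss_mat n) ?gb (\<lambda>G. U ` orth_comp_Rn n d (frame_Rn n G))"
    unfolding gauss_kernel_def
    by (subst distr_distr[OF measurable_orth_map_image[OF U d] mk]) (simp add: o_def)
  also have "\<dots> = distr (gauss_mat n) ?gb (\<lambda>G. orth_comp_Rn n d (frame_Rn n (act_mat n U G)))"
  proof (rule distr_cong_AE)
    show "AE G in gauss_mat n. U ` orth_comp_Rn n d (frame_Rn n G) = orth_comp_Rn n d (frame_Rn n (act_mat n U G))"
      using AE_orthonormal_gram_schmidt
    proof eventually_elim
      case (elim G)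
      have "U ` orth_comp_Rn n d (frame_Rn n G) = orth_comp_Rn n d (\<lambda>i. U (frame_Rn n G i))"
        by (rule orth_maps_image_orth_comp[OF U orthonormal_frame d])
      also have "\<dots> = orth_comp_Rn n d (frame_Rn n (act_mat n U G))"
        using frame_act_mat[OF U elim] d by (intro orth_comp_cong) auto
      finally show ?case .
    qed
    show "(\<lambda>G. U ` orth_comp_Rn n d (frame_Rn n G)) \<in> gauss_mat n \<rightarrow>\<^sub>M ?gb"
      by (rule measurable_compose[OF mk measurable_orth_map_image[OF U d]])
    show "(\<lambda>G. orth_comp_Rn n d (frame_Rn n (act_mat n U G))) \<in> gauss_mat n \<rightarrow>\<^sub>M ?gb"
      by (rule measurable_compose[OF measurable_act_mat[OF U] mk])
  qed simp_all
  also have "\<dots> = distr (distr (gauss_mat n) (gauss_mat n) (act_mat n U)) ?gb (\<lambda>G. orth_comp_Rn n d (frame_Rn n G))"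
    by (subst distr_distr[OF mk measurable_act_mat[OF U]]) (simp add: o_def)
  also have "\<dots> = gauss_kernel n d"
    by (simp add: distr_act_mat[OF U] gauss_kernel_def)
  finally show "distr (gauss_kernel n d) ?gb (\<lambda>F. U ` F) = gauss_kernel n d" .
qed

text \<open>Average the identity \<mu>(A) = \<mu>{F. T F in A} over the random orthogonal map T
  given by the Gaussian frame and exchange the integrals. The inner probability does not depend on
  F: if V carries F to the fixed subspace F_0, then T_G F = T_(VG) F_0 almost surely, and VG is
  distributed like G. What is left does not mention \<mu>, so there is at most one invariant
  measure.\<close>

lemma emeasure_haar_grassmannian:
  assumes d: "d \<le> n" and \<mu>: "is_haar_grassmannian n (n - d) \<mu>"
    and A: "A \<in> sets (grassmannian_borel n (n - d))"
  shows "emeasure \<mu> A = (\<integral>\<^sup>+G. indicator A (frame_map n (frame_Rn n G) ` orth_comp_Rn n d unit_Rn) \<partial>gauss_mat n)"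
    (is "_ = ?c")
proof -
  let ?gb = "grassmannian_borel n (n - d)"
  interpret P: prob_space "gauss_mat n" by (rule prob_space_gauss_mat)
  interpret \<mu>: prob_space \<mu> using \<mu> by (simp add: is_haar_grassmannian_def)
  interpret pair_sigma_finite "gauss_mat n" \<mu> ..
  have s\<mu> [measurable_cong]: "sets \<mu> = sets ?gb" using \<mu> by (simp add: is_haar_grassmannian_def)
  have sp\<mu>: "space \<mu> = grassmannian n (n - d)" using sets_eq_imp_space_eq[OF s\<mu>] by simp
  let ?T = "\<lambda>G. frame_map n (frame_Rn n G)"
  have T: "?T G \<in> orth_maps n" for G by (rule frame_map_orth_maps[OF orthonormal_frame])
  have joint: "(\<lambda>(G, F). ?T G ` F) \<in> gauss_mat n \<Otimes>\<^sub>M \<mu> \<rightarrow>\<^sub>M ?gb"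
    unfolding case_prod_beta
  proof (rule measurable_frame_map_image[OF d])
    show "(\<lambda>\<omega>. frame_Rn n (fst \<omega>) k) \<in> borel_measurable (gauss_mat n \<Otimes>\<^sub>M \<mu>)" if "k < n" for k
      by (rule measurable_compose[OF measurable_fst measurable_frame[OF that]])
    show "snd \<in> gauss_mat n \<Otimes>\<^sub>M \<mu> \<rightarrow>\<^sub>M ?gb"
      using measurable_snd[of "gauss_mat n" \<mu>] by (simp add: s\<mu> cong: measurable_cong_sets)
  qed (rule orthonormal_frame)
  have joint': "(\<lambda>(G, F). indicator A (?T G ` F) :: ennreal) \<in> borel_measurable (gauss_mat n \<Otimes>\<^sub>M \<mu>)"
    using measurable_compose[OF joint borel_measurable_indicator[OF A]] by (simp add: case_prod_beta')
  have inv: "emeasure \<mu> A = (\<integral>\<^sup>+F. indicator A (U ` F) \<partial>\<mu>)" if U: "U \<in> orth_maps n" for U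
  proof -
    have m: "(\<lambda>F. U ` F) \<in> \<mu> \<rightarrow>\<^sub>M ?gb"
      using measurable_orth_map_image[OF U d] by (simp add: s\<mu> cong: measurable_cong_sets)
    have "emeasure \<mu> A = emeasure (distr \<mu> ?gb (\<lambda>F. U ` F)) A"
      using \<mu> U by (simp add: is_haar_grassmannian_def)
    also have "\<dots> = (\<integral>\<^sup>+F. indicator A F \<partial>distr \<mu> ?gb (\<lambda>F. U ` F))"
      using A by simp
    also have "\<dots> = (\<integral>\<^sup>+F. indicator A (U ` F) \<partial>\<mu>)"
      using A by (intro nn_integral_distr m) simp
    finally show ?thesis .
  qed
  have const: "(\<integral>\<^sup>+G. indicator A (?T G ` F) \<partial>gauss_mat n) = ?c" if F: "F \<in> grassmannian n (n - d)" for F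
  proof -
    obtain v where v: "orthonormal_Rn n n v" and Fv: "F = orth_comp_Rn n d v"
      using F by (auto simp: grassmannian_eq[OF d])
    define V where "V = frame_map n v"
    have V: "V \<in> orth_maps n" unfolding V_def by (rule frame_map_orth_maps[OF v])
    have Vv: "V (v i) = unit_Rn i" if "i < n" for i
    proof (rule Rn_eqI)
      fix l assume "l < n"
      then show "V (v i) l = unit_Rn i l"
        using v that by (auto simp: V_def frame_map_def orthonormal_Rn_def unit_Rn_def)
    qed (use that in \<open>simp_all add: V_def\<close>)
    have VF: "V ` F = orth_comp_Rn n d unit_Rn"
      unfolding Fv orth_maps_image_orth_comp[OF V v d] using Vv d by (intro orth_comp_cong) auto
    have m0: "(\<lambda>G. ?T G ` orth_comp_Rn n d unit_Rn) \<in> gauss_mat n \<rightarrow>\<^sub>M ?gb"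
      using orthonormal_unit_Rn
      by (intro measurable_frame_map_image[OF d orthonormal_frame measurable_frame] measurable_const)
        (auto simp: grassmannian_eq[OF d])
    have "(\<integral>\<^sup>+G. indicator A (?T G ` F) \<partial>gauss_mat n)
        = (\<integral>\<^sup>+G. indicator A (?T (act_mat n V G) ` orth_comp_Rn n d unit_Rn) \<partial>gauss_mat n)"
    proof (rule nn_integral_cong_AE)
      show "AE G in gauss_mat n. (indicator A (?T G ` F) :: ennreal)
          = indicator A (?T (act_mat n V G) ` orth_comp_Rn n d unit_Rn)"
        using AE_orthonormal_gram_schmidt
      proof eventually_elim
        case (elim G)
        have "?T G x = ?T (act_mat n V G) (V x)" if "x \<in> F" for x
        proof -
          have "x \<in> Rn n" using that grassmannian_subset_Rn[OF F] by auto
          then show ?thesis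
            using orthonormal_frame[of n G] frame_act_mat[OF V elim]
            by (intro ext) (auto simp: frame_map_def orth_maps_inner[OF V] orthonormal_Rn_def)
        qed
        then have "?T G ` F = ?T (act_mat n V G) ` V ` F" by (simp add: image_image)
        then show ?case by (simp add: VF)
      qed
    qed
    also have "\<dots> = (\<integral>\<^sup>+G. indicator A (?T G ` orth_comp_Rn n d unit_Rn) \<partial>distr (gauss_mat n) (gauss_mat n) (act_mat n V))"
      using measurable_compose[OF m0 borel_measurable_indicator[OF A]]
      by (intro nn_integral_distr[symmetric] measurable_act_mat[OF V]) simp
    also have "\<dots> = ?c" by (simp add: distr_act_mat[OF V])
    finally show ?thesis .
  qed
  have "emeasure \<mu> A = (\<integral>\<^sup>+G. emeasure \<mu> A \<partial>gauss_mat n)"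
    by (simp add: P.emeasure_space_1)
  also have "\<dots> = (\<integral>\<^sup>+G. \<integral>\<^sup>+F. indicator A (?T G ` F) \<partial>\<mu> \<partial>gauss_mat n)"
    by (intro nn_integral_cong inv T)
  also have "\<dots> = (\<integral>\<^sup>+F. \<integral>\<^sup>+G. indicator A (?T G ` F) \<partial>gauss_mat n \<partial>\<mu>)"
    by (rule Fubini'[symmetric]) (rule joint')
  also have "\<dots> = (\<integral>\<^sup>+F. ?c \<partial>\<mu>)"
    by (intro nn_integral_cong const) (simp add: sp\<mu>)
  also have "\<dots> = ?c" by (simp add: \<mu>.emeasure_space_1)
  finally show ?thesis .
qed

theorem haar_grassmannian_eq:
  assumes d: "d \<le> n"
  shows "haar_grassmannian n (n - d) = gauss_kernel n d"
  unfolding haar_grassmannian_def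
proof (rule the_equality)
  show "is_haar_grassmannian n (n - d) (gauss_kernel n d)" by (rule is_haar_gauss_kernel[OF d])
  fix \<mu> assume \<mu>: "is_haar_grassmannian n (n - d) \<mu>"
  show "\<mu> = gauss_kernel n d"
  proof (rule measure_eqI)
    show "sets \<mu> = sets (gauss_kernel n d)"
      using \<mu> is_haar_gauss_kernel[OF d] by (simp add: is_haar_grassmannian_def)
    fix A assume "A \<in> sets \<mu>"
    then have "A \<in> sets (grassmannian_borel n (n - d))" using \<mu> by (simp add: is_haar_grassmannian_def)
    then show "emeasure \<mu> A = emeasure (gauss_kernel n d) A"
      by (simp add: emeasure_haar_grassmannian[OF d \<mu>] emeasure_haar_grassmannian[OF d is_haar_gauss_kernel[OF d]])
  qed
qed

section \<open>Support functions and the inradius of projections\<close>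

lemma continuous_on_inner_Rn: "continuous_on UNIV (\<lambda>x. inner_Rn n x y)"
  unfolding inner_Rn_def by (intro continuous_intros) auto

lemma continuous_on_inner_Rn_self_diff: "continuous_on UNIV (\<lambda>x. inner_Rn n (y - x) (y - x))"
  unfolding inner_Rn_def by (simp add: fun_diff_def) (intro continuous_intros; simp)

lemma continuous_on_norm_Rn_diff: "continuous_on UNIV (\<lambda>x. norm_Rn n (x - y))"
  unfolding L2_set_def by (simp add: fun_diff_def) (intro continuous_intros; simp)

definition supp_Rn :: "nat \<Rightarrow> (nat \<Rightarrow> real) set \<Rightarrow> (nat \<Rightarrow> real) \<Rightarrow> real"
  where "supp_Rn n K \<theta> = (SUP z\<in>K. inner_Rn n z \<theta>)"

lemma compact_bdd_inner: "compact K \<Longrightarrow> bdd_above ((\<lambda>z. inner_Rn n z \<theta>) ` K)"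
  by (intro bounded_imp_bdd_above compact_imp_bounded compact_continuous_image)
    (auto intro: continuous_on_subset[OF continuous_on_inner_Rn])

lemma inner_le_supp: "compact K \<Longrightarrow> z \<in> K \<Longrightarrow> inner_Rn n z \<theta> \<le> supp_Rn n K \<theta>"
  unfolding supp_Rn_def by (intro cSUP_upper compact_bdd_inner)

lemma supp_le: "K \<noteq> {} \<Longrightarrow> (\<And>z. z \<in> K \<Longrightarrow> inner_Rn n z \<theta> \<le> c) \<Longrightarrow> supp_Rn n K \<theta> \<le> c"
  unfolding supp_Rn_def by (rule cSUP_least)

lemma supp_scaleR:
  assumes K: "compact K" "K \<noteq> {}" and c: "0 \<le> c"
  shows "supp_Rn n K (c *\<^sub>R \<theta>) = c * supp_Rn n K \<theta>"
proof (cases "c = 0")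
  case True
  then show ?thesis using K(2) by (simp add: supp_Rn_def inner_Rn_scaleR_right)
next
  case False
  then have c: "0 < c" using c by simp
  show ?thesis
  proof (rule antisym)
    show "supp_Rn n K (c *\<^sub>R \<theta>) \<le> c * supp_Rn n K \<theta>"
      using c inner_le_supp[OF K(1)] by (intro supp_le[OF K(2)]) (simp add: inner_Rn_scaleR_right)
    have "supp_Rn n K \<theta> \<le> supp_Rn n K (c *\<^sub>R \<theta>) / c"
      using c inner_le_supp[OF K(1), of _ n "c *\<^sub>R \<theta>"]
      by (intro supp_le[OF K(2)]) (simp add: inner_Rn_scaleR_right field_simps)
    then show "c * supp_Rn n K \<theta> \<le> supp_Rn n K (c *\<^sub>R \<theta>)"
      using c by (simp add: field_simps)
  qed
qed

lemma compact_norm_Rn_bounded: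
  assumes "compact K"
  shows "\<exists>R\<ge>0. \<forall>x\<in>K. norm_Rn n x \<le> R"
proof -
  have "compact ((\<lambda>x. norm_Rn n (x - 0)) ` K)"
    by (intro compact_continuous_image continuous_on_subset[OF continuous_on_norm_Rn_diff] assms) auto
  then have "bdd_above ((\<lambda>x. norm_Rn n x) ` K)"
    by (simp add: bounded_imp_bdd_above compact_imp_bounded)
  then obtain R where "\<forall>x\<in>K. norm_Rn n x \<le> R" by (auto simp: bdd_above_def)
  then show ?thesis by (intro exI[of _ "max R 0"]) (auto simp: le_max_iff_disj)
qed

text \<open>The support function is R-Lipschitz for \<open>norm_Rn\<close> when K has radius at most
  R. This seminorm is continuous for the product topology, so continuity holds on all of
  \<open>nat => real\<close>.\<close>

lemma supp_continuous:
  assumes K: "compact K" "K \<noteq> {}"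
  shows "continuous_on UNIV (supp_Rn n K)"
proof -
  obtain R where R: "R \<ge> 0" "\<forall>x\<in>K. norm_Rn n x \<le> R" using compact_norm_Rn_bounded[OF K(1)] by blast
  have one: "supp_Rn n K x \<le> supp_Rn n K y + R * norm_Rn n (x - y)" for x y
  proof (rule supp_le[OF K(2)])
    fix z assume z: "z \<in> K"
    have "inner_Rn n z x = inner_Rn n z y + inner_Rn n z (x - y)" by (simp add: inner_Rn_simps)
    also have "inner_Rn n z (x - y) \<le> norm_Rn n z * norm_Rn n (x - y)"
      using Cauchy_Schwarz_Rn[of n z "x - y"] by linarith
    also have "\<dots> \<le> R * norm_Rn n (x - y)" using R(2) z by (intro mult_right_mono) auto
    finally show "inner_Rn n z x \<le> supp_Rn n K y + R * norm_Rn n (x - y)"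
      using inner_le_supp[OF K(1) z, of n y] by simp
  qed
  have sym: "norm_Rn n (y - x) = norm_Rn n (x - y)" for x y
    using norm_Rn_scaleR[of "-1" "x - y" n] by simp
  have two: "\<bar>supp_Rn n K x - supp_Rn n K y\<bar> \<le> R * norm_Rn n (x - y)" for x y
    using one[of x y] one[of y x] sym[of x y] by (auto simp: abs_le_iff)
  show ?thesis
    unfolding continuous_on_def
  proof
    fix y :: "nat \<Rightarrow> real"
    have "((\<lambda>x. R * norm_Rn n (x - y)) \<longlongrightarrow> R * norm_Rn n (y - y)) (at y)"
      using continuous_on_norm_Rn_diff[of y n, unfolded continuous_on_def, rule_format, of y]
      by (intro tendsto_mult tendsto_const) (simp only: UNIV_I)
    then have "((\<lambda>x. R * norm_Rn n (x - y)) \<longlongrightarrow> 0) (at y)"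
      by (simp only: diff_self norm_Rn_zero mult_zero_right)
    moreover have "\<forall>\<^sub>F x in at y. norm (supp_Rn n K x - supp_Rn n K y) \<le> R * norm_Rn n (x - y)"
      by (intro always_eventually allI) (simp only: real_norm_def two)
    ultimately have "((\<lambda>x. supp_Rn n K x - supp_Rn n K y) \<longlongrightarrow> 0) (at y)"
      by (rule Lim_null_comparison[rotated])
    then show "(supp_Rn n K \<longlongrightarrow> supp_Rn n K y) (at y within UNIV)"
      by (simp add: LIM_zero_iff)
  qed
qed

text \<open>If some w in C violated the inequality at the nearest point z, a short move from z
  towards w would come closer to y.\<close>

lemma closest_point_separation:
  assumes C: "compact C" "convex C" "C \<noteq> {}" "C \<subseteq> Rn n" and y: "y \<in> Rn n" "y \<notin> C"
  shows "\<exists>z\<in>C. y - z \<noteq> 0 \<and> (\<forall>w\<in>C. inner_Rn n w (y - z) \<le> inner_Rn n y (y - z) - inner_Rn n (y - z) (y - z))"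
proof -
  obtain z where z: "z \<in> C" and min: "\<And>w. w \<in> C \<Longrightarrow> inner_Rn n (y - z) (y - z) \<le> inner_Rn n (y - w) (y - w)"
    using continuous_attains_inf[OF C(1,3) continuous_on_subset[OF continuous_on_inner_Rn_self_diff]] by blast
  have "inner_Rn n (w - z) (y - z) \<le> 0" if w: "w \<in> C" for w
  proof (rule ccontr)
    assume "\<not> ?thesis"
    then have p: "inner_Rn n (w - z) (y - z) > 0" by simp
    define q where "q = inner_Rn n (w - z) (w - z)"
    have q0: "0 \<le> q" by (simp add: q_def inner_Rn_self_nonneg)
    \<comment> \<open>The cap 1 keeps the moved point in C; the denominator q + 1 is never 0 and
      makes the quadratic term too small to offset the linear gain.\<close>
    define t where "t = min 1 (inner_Rn n (w - z) (y - z) / (q + 1))"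
    have t: "0 < t" "t \<le> 1" "t \<le> inner_Rn n (w - z) (y - z) / (q + 1)"
      using p q0 by (auto simp: t_def)
    from t(3) have t3: "t * (q + 1) \<le> inner_Rn n (w - z) (y - z)"
      using q0 by (simp add: pos_le_divide_eq)
    have "(1 - t) *\<^sub>R z + t *\<^sub>R w \<in> C"
      using C(2) z w t unfolding convex_def by auto
    moreover have "(1 - t) *\<^sub>R z + t *\<^sub>R w = z + t *\<^sub>R (w - z)"
      by (simp add: algebra_simps fun_eq_iff)
    ultimately have "inner_Rn n (y - z) (y - z) \<le> inner_Rn n (y - (z + t *\<^sub>R (w - z))) (y - (z + t *\<^sub>R (w - z)))"
      using min by simp
    also have "y - (z + t *\<^sub>R (w - z)) = (y - z) - t *\<^sub>R (w - z)" by simp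
    also have "inner_Rn n \<dots> \<dots> = inner_Rn n (y - z) (y - z) - 2 * t * inner_Rn n (w - z) (y - z) + t * t * q"
      unfolding q_def inner_Rn_diff_left[of n "y - z" "t *\<^sub>R (w - z)"] inner_Rn_diff_right[of n _ "y - z" "t *\<^sub>R (w - z)"]
        inner_Rn_scaleR_left inner_Rn_scaleR_right inner_Rn_commute[of n "y - z" "w - z"]
      by (simp add: algebra_simps)
    finally have "2 * t * inner_Rn n (w - z) (y - z) \<le> t * t * q" by linarith
    then have "t * (2 * inner_Rn n (w - z) (y - z)) \<le> t * (t * q)" by (simp only: mult_ac)
    then have "2 * inner_Rn n (w - z) (y - z) \<le> t * q" using t(1) by simp
    also have "\<dots> \<le> t * (q + 1)" using t(1) by simp
    finally show False using t3 p by simp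
  qed
  moreover have "y - z \<noteq> 0" using z y by auto
  ultimately show ?thesis
    using z by (intro bexI[of _ z]) (auto simp: inner_Rn_diff_left)
qed

text \<open>\<open>orth_proj\<close> is a definite description. The matrix form is total, linear and
  continuous in x, and for fixed x measurable in F; the two agree on \<open>Rn n\<close>.\<close>

definition proj_Rn :: "nat \<Rightarrow> (nat \<Rightarrow> real) set \<Rightarrow> (nat \<Rightarrow> real) \<Rightarrow> nat \<Rightarrow> real"
  where "proj_Rn n F x = (\<lambda>i. if i < n then \<Sum>j<n. proj_matrix n F (i, j) * x j else 0)"

lemma proj_Rn_orth_comp:
  assumes u: "orthonormal_Rn n n u" and d: "d \<le> n"
  shows "proj_Rn n (orth_comp_Rn n d u) x = (\<Sum>t\<in>{d..<n}. inner_Rn n (u t) x *\<^sub>R u t)"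
proof (rule Rn_eqI)
  show "(\<Sum>t\<in>{d..<n}. inner_Rn n (u t) x *\<^sub>R u t) \<in> Rn n"
    using u by (intro sum_scaleR_mem_Rn) (auto simp: orthonormal_Rn_def)
  fix i assume i: "i < n"
  have "proj_Rn n (orth_comp_Rn n d u) x i = (\<Sum>j<n. \<Sum>t\<in>{d..<n}. u t i * u t j * x j)"
    using i by (simp add: proj_Rn_def proj_matrix_orth_comp[OF u d] sum_distrib_right)
  also have "\<dots> = (\<Sum>t\<in>{d..<n}. \<Sum>j<n. u t i * u t j * x j)" by (rule sum.swap)
  also have "\<dots> = (\<Sum>t\<in>{d..<n}. inner_Rn n (u t) x *\<^sub>R u t) i"
    by (simp add: sum_fun_apply inner_Rn_def sum_distrib_right sum_distrib_left mult_ac)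
  finally show "proj_Rn n (orth_comp_Rn n d u) x i = (\<Sum>t\<in>{d..<n}. inner_Rn n (u t) x *\<^sub>R u t) i" .
qed (simp add: proj_Rn_def mem_Rn)

lemma linear_proj_Rn: "linear (proj_Rn n F)"
  by (intro linearI) (auto simp: proj_Rn_def fun_eq_iff algebra_simps sum.distrib sum_distrib_left)

lemma continuous_on_proj_Rn: "continuous_on UNIV (proj_Rn n F)"
proof (rule continuous_on_coordinatewise_then_product)
  fix i
  have "continuous_on UNIV (\<lambda>x. \<Sum>j<n. proj_matrix n F (i, j) * x j)"
    by (intro continuous_intros) auto
  then show "continuous_on UNIV (\<lambda>x. proj_Rn n F x i)"
    by (cases "i < n") (simp_all add: proj_Rn_def)
qed

lemma orth_proj_eq_proj_Rn:
  assumes d: "d \<le> n" and F: "F \<in> grassmannian n (n - d)" and x: "x \<in> Rn n"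
  shows "orth_proj n F x = proj_Rn n F x"
  using F x by (auto simp: grassmannian_eq[OF d] proj_Rn_orth_comp[OF _ d] orth_proj_orth_comp[OF _ d])

lemma proj_Rn_mem:
  assumes d: "d \<le> n" and F: "F \<in> grassmannian n (n - d)"
  shows "proj_Rn n F x \<in> F"
proof -
  obtain u where u: "orthonormal_Rn n n u" and Fu: "F = orth_comp_Rn n d u"
    using F by (auto simp: grassmannian_eq[OF d])
  show ?thesis
    unfolding Fu proj_Rn_orth_comp[OF u d] using basis_mem_orth_comp[OF u]
    by (intro subspace_sum[OF subspace_orth_comp] subspace_scale[OF subspace_orth_comp]) auto
qed

lemma proj_Rn_id:
  assumes d: "d \<le> n" and F: "F \<in> grassmannian n (n - d)" and x: "x \<in> F"
  shows "proj_Rn n F x = x"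
  using F x orth_comp_expansion[OF _ d, symmetric]
  by (auto simp: grassmannian_eq[OF d] proj_Rn_orth_comp[OF _ d])

lemma inner_proj_Rn:
  assumes d: "d \<le> n" and F: "F \<in> grassmannian n (n - d)" and \<theta>: "\<theta> \<in> F"
  shows "inner_Rn n (proj_Rn n F x) \<theta> = inner_Rn n x \<theta>"
proof -
  obtain u where u: "orthonormal_Rn n n u" and Fu: "F = orth_comp_Rn n d u"
    using F by (auto simp: grassmannian_eq[OF d])
  have "inner_Rn n x \<theta> = (\<Sum>t\<in>{d..<n}. inner_Rn n (u t) \<theta> * inner_Rn n x (u t))"
    by (subst orth_comp_expansion[OF u d \<theta>[unfolded Fu]]) (simp add: inner_Rn_simps)
  also have "\<dots> = inner_Rn n (proj_Rn n F x) \<theta>"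
    unfolding Fu proj_Rn_orth_comp[OF u d]
    by (simp add: inner_Rn_simps mult.commute inner_Rn_commute[of n x "u _"])
  finally show ?thesis by simp
qed

text \<open>Duality with the support function: testing the ball at \<theta> / |\<theta>| gives one
  direction. For the other, a point of the ball missing from the compact convex set P_F K is
  separated from it by some \<theta> in F, and there P_F may be dropped from the inner
  product.\<close>

lemma ball_subset_proj_iff:
  assumes d: "d \<le> n" and F: "F \<in> grassmannian n (n - d)"
    and K: "compact K" "K \<noteq> {}" "convex K" "K \<subseteq> Rn n" and r: "0 < r"
  shows "(\<lambda>x. r *\<^sub>R x) ` (ball_Rn n \<inter> F) \<subseteq> orth_proj n F ` K \<longleftrightarrow> (\<forall>\<theta>\<in>F. r * norm_Rn n \<theta> \<le> supp_Rn n K \<theta>)"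
proof -
  have sF: "subspace F" "F \<subseteq> Rn n" using F by (auto simp: grassmannian_def)
  have img: "orth_proj n F ` K = proj_Rn n F ` K"
    using orth_proj_eq_proj_Rn[OF d F] K(4) by (intro image_cong) auto
  show ?thesis
    unfolding img
  proof (intro iffI ballI)
    fix \<theta> assume sub: "(\<lambda>x. r *\<^sub>R x) ` (ball_Rn n \<inter> F) \<subseteq> proj_Rn n F ` K" and \<theta>: "\<theta> \<in> F"
    show "r * norm_Rn n \<theta> \<le> supp_Rn n K \<theta>"
    proof (cases "\<theta> = 0")
      case True
      then show ?thesis using K(2) by (simp add: supp_Rn_def)
    next
      case False
      have \<theta>n: "\<theta> \<in> Rn n" using \<theta> sF by auto
      have nz: "norm_Rn n \<theta> > 0" using False norm_Rn_eq_0[OF \<theta>n] L2_set_nonneg[of \<theta> "{..<n}"] by linarith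
      let ?x = "(1 / norm_Rn n \<theta>) *\<^sub>R \<theta>"
      have "?x \<in> ball_Rn n \<inter> F"
        using \<theta> \<theta>n nz by (auto simp: ball_Rn_def norm_Rn_scaleR intro!: subspace_scale[OF sF(1)] subspace_scale[OF subspace_Rn])
      then obtain k where k: "k \<in> K" "r *\<^sub>R ?x = proj_Rn n F k" using sub by auto
      have "r * norm_Rn n \<theta> = inner_Rn n (r *\<^sub>R ?x) \<theta>"
        using nz by (simp add: inner_Rn_simps inner_Rn_self power2_eq_square)
      also have "\<dots> = inner_Rn n k \<theta>" unfolding k(2) by (rule inner_proj_Rn[OF d F \<theta>])
      also have "\<dots> \<le> supp_Rn n K \<theta>" by (rule inner_le_supp[OF K(1) k(1)])
      finally show ?thesis .
    qed
  next
    assume h: "\<forall>\<theta>\<in>F. r * norm_Rn n \<theta> \<le> supp_Rn n K \<theta>"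
    show "(\<lambda>x. r *\<^sub>R x) ` (ball_Rn n \<inter> F) \<subseteq> proj_Rn n F ` K"
    proof (rule ccontr)
      assume "\<not> ?thesis"
      then obtain x where x: "x \<in> ball_Rn n" "x \<in> F" "r *\<^sub>R x \<notin> proj_Rn n F ` K" by auto
      have C: "compact (proj_Rn n F ` K)"
        by (intro compact_continuous_image continuous_on_subset[OF continuous_on_proj_Rn] K(1)) auto
      have y: "r *\<^sub>R x \<in> F" using x by (intro subspace_scale[OF sF(1)])
      have "proj_Rn n F ` K \<subseteq> Rn n" using proj_Rn_mem[OF d F] sF by auto
      then obtain z where z: "z \<in> proj_Rn n F ` K" and nz: "r *\<^sub>R x - z \<noteq> 0"
        and sep: "\<forall>w\<in>proj_Rn n F ` K. inner_Rn n w (r *\<^sub>R x - z)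
          \<le> inner_Rn n (r *\<^sub>R x) (r *\<^sub>R x - z) - inner_Rn n (r *\<^sub>R x - z) (r *\<^sub>R x - z)"
        using closest_point_separation[OF C convex_linear_image[OF linear_proj_Rn K(3)], of n "r *\<^sub>R x"] x y sF K(2)
        by (metis (no_types, lifting) image_is_empty subset_iff)
      define \<theta> where "\<theta> = r *\<^sub>R x - z"
      have \<theta>: "\<theta> \<in> F" unfolding \<theta>_def using y z proj_Rn_mem[OF d F] by (intro subspace_diff[OF sF(1)]) auto
      then have \<theta>n: "\<theta> \<in> Rn n" using sF by auto
      have pos: "inner_Rn n \<theta> \<theta> > 0"
        using nz inner_Rn_self_eq_0[OF \<theta>n] inner_Rn_self_nonneg[of n \<theta>] unfolding \<theta>_def[symmetric] by simp
      have "supp_Rn n K \<theta> \<le> inner_Rn n (r *\<^sub>R x) \<theta> - inner_Rn n \<theta> \<theta>"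
      proof (rule supp_le[OF K(2)])
        fix k assume "k \<in> K"
        then show "inner_Rn n k \<theta> \<le> inner_Rn n (r *\<^sub>R x) \<theta> - inner_Rn n \<theta> \<theta>"
          using sep inner_proj_Rn[OF d F \<theta>, of k] by (auto simp: \<theta>_def[symmetric])
      qed
      also have "inner_Rn n (r *\<^sub>R x) \<theta> \<le> r * norm_Rn n \<theta>"
      proof -
        have "inner_Rn n x \<theta> \<le> norm_Rn n x * norm_Rn n \<theta>" using Cauchy_Schwarz_Rn[of n x \<theta>] by linarith
        also have "\<dots> \<le> 1 * norm_Rn n \<theta>" using x(1) by (intro mult_right_mono) (auto simp: ball_Rn_def)
        finally show ?thesis using r by (simp add: inner_Rn_simps)
      qed
      finally show False using h \<theta> pos by fastforce
    qed
  qed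
qed

lemma unit_vector_grassmannian:
  assumes d: "d < n" and F: "F \<in> grassmannian n (n - d)"
  shows "\<exists>\<theta>\<in>F. norm_Rn n \<theta> = 1"
proof -
  have d': "d \<le> n" using d by simp
  obtain u where u: "orthonormal_Rn n n u" and Fu: "F = orth_comp_Rn n d u"
    using F by (auto simp: grassmannian_eq[OF d'])
  have "(norm_Rn n (u d))\<^sup>2 = 1" using u d by (simp add: orthonormal_Rn_def inner_Rn_self[symmetric])
  then have "norm_Rn n (u d) = 1" using L2_set_nonneg[of "u d" "{..<n}"] by (simp add: power2_eq_1_iff)
  then show ?thesis using basis_mem_orth_comp[OF u, of d d] d by (auto simp: Fu)
qed

text \<open>By homogeneity a radius is admissible exactly when it is at most the infimum m of the
  support function over unit vectors of F. So m is itself admissible and the \<open>GREATEST\<close>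
  is attained; the lower bound c makes it positive.\<close>

lemma proj_inradius_ge_iff:
  assumes d: "d < n" and F: "F \<in> grassmannian n (n - d)"
    and K: "compact K" "K \<noteq> {}" "convex K" "K \<subseteq> Rn n"
    and c: "0 < c" "\<And>\<theta>. \<theta> \<in> Rn n \<Longrightarrow> c * norm_Rn n \<theta> \<le> supp_Rn n K \<theta>" and s: "0 < s"
  shows "proj_inradius n K F \<ge> s \<longleftrightarrow> (\<forall>\<theta>\<in>F. s * norm_Rn n \<theta> \<le> supp_Rn n K \<theta>)"
proof -
  have d': "d \<le> n" using d by simp
  have sF: "subspace F" "F \<subseteq> Rn n" using F by (auto simp: grassmannian_def)
  define m where "m = (INF \<theta>\<in>{\<theta>\<in>F. norm_Rn n \<theta> = 1}. supp_Rn n K \<theta>)"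
  have ne: "{\<theta>\<in>F. norm_Rn n \<theta> = 1} \<noteq> {}" using unit_vector_grassmannian[OF d F] by auto
  have cm: "c \<le> supp_Rn n K \<theta>" if "\<theta> \<in> F" "norm_Rn n \<theta> = 1" for \<theta>
    using c(2)[of \<theta>] that sF by auto
  have iff: "(\<forall>\<theta>\<in>F. r * norm_Rn n \<theta> \<le> supp_Rn n K \<theta>) \<longleftrightarrow> r \<le> m" for r
  proof
    assume "\<forall>\<theta>\<in>F. r * norm_Rn n \<theta> \<le> supp_Rn n K \<theta>"
    then show "r \<le> m" unfolding m_def by (intro cINF_greatest[OF ne]) force
  next
    assume r: "r \<le> m"
    show "\<forall>\<theta>\<in>F. r * norm_Rn n \<theta> \<le> supp_Rn n K \<theta>"
    proof
      fix \<theta> assume \<theta>: "\<theta> \<in> F"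
      have \<theta>n: "\<theta> \<in> Rn n" using \<theta> sF by auto
      show "r * norm_Rn n \<theta> \<le> supp_Rn n K \<theta>"
      proof (cases "\<theta> = 0")
        case True
        then show ?thesis using K(2) by (simp add: supp_Rn_def)
      next
        case False
        then have nz: "norm_Rn n \<theta> > 0" using norm_Rn_eq_0[OF \<theta>n] L2_set_nonneg[of \<theta> "{..<n}"] by linarith
        let ?x = "(1 / norm_Rn n \<theta>) *\<^sub>R \<theta>"
        have x: "?x \<in> {\<theta>\<in>F. norm_Rn n \<theta> = 1}"
          using nz \<theta> by (auto simp: norm_Rn_scaleR intro!: subspace_scale[OF sF(1)])
        have "m \<le> supp_Rn n K ?x"
          unfolding m_def using cm by (intro cINF_lower[OF _ x] bdd_belowI2[where m=c]) auto
        also have "\<dots> = (1 / norm_Rn n \<theta>) * supp_Rn n K \<theta>" using nz by (intro supp_scaleR[OF K(1,2)]) simp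
        finally have "m * norm_Rn n \<theta> \<le> supp_Rn n K \<theta>" using nz by (simp add: field_simps)
        moreover have "r * norm_Rn n \<theta> \<le> m * norm_Rn n \<theta>" using r nz by (intro mult_right_mono) auto
        ultimately show ?thesis by linarith
      qed
    qed
  qed
  have m: "0 < m" using iff[of c] c sF by (auto intro: less_le_trans)
  have "proj_inradius n K F = m"
    unfolding proj_inradius_def
  proof (rule Greatest_equality)
    show "m > 0 \<and> (\<lambda>x. m *\<^sub>R x) ` (ball_Rn n \<inter> F) \<subseteq> orth_proj n F ` K"
      using ball_subset_proj_iff[OF d' F K m] iff m by simp
  next
    fix r assume "r > 0 \<and> (\<lambda>x. r *\<^sub>R x) ` (ball_Rn n \<inter> F) \<subseteq> orth_proj n F ` K"
    then show "r \<le> m" using ball_subset_proj_iff[OF d' F K, of r] iff by simp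
  qed
  then show ?thesis using iff[of s] by simp
qed

text \<open>The subspace over which \<theta> ranges varies with F. Writing \<theta> as the
  projection of x frees the quantifier, and as the x violating the inequality form an open set, a
  countable dense set of x is enough.\<close>

lemma sets_supp_ge:
  assumes d: "d \<le> n" and K: "compact K" "K \<noteq> {}"
  shows "{F \<in> grassmannian n (n - d). \<forall>\<theta>\<in>F. s * norm_Rn n \<theta> \<le> supp_Rn n K \<theta>}
    \<in> sets (grassmannian_borel n (n - d))"
proof -
  let ?gb = "grassmannian_borel n (n - d)"
  obtain D :: "(nat \<Rightarrow> real) set" where D: "countable D" "\<And>X. open X \<Longrightarrow> X \<noteq> {} \<Longrightarrow> \<exists>x\<in>D. x \<in> X"
    using countable_dense_setE by blast
  have eq: "(\<forall>\<theta>\<in>F. s * norm_Rn n \<theta> \<le> supp_Rn n K \<theta>) \<longleftrightarrow>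
      (\<forall>x\<in>D. s * norm_Rn n (proj_Rn n F x) \<le> supp_Rn n K (proj_Rn n F x))"
    if F: "F \<in> grassmannian n (n - d)" for F
  proof
    assume "\<forall>\<theta>\<in>F. s * norm_Rn n \<theta> \<le> supp_Rn n K \<theta>"
    then show "\<forall>x\<in>D. s * norm_Rn n (proj_Rn n F x) \<le> supp_Rn n K (proj_Rn n F x)"
      using proj_Rn_mem[OF d F] by blast
  next
    assume h: "\<forall>x\<in>D. s * norm_Rn n (proj_Rn n F x) \<le> supp_Rn n K (proj_Rn n F x)"
    let ?X = "{x. supp_Rn n K (proj_Rn n F x) < s * norm_Rn n (proj_Rn n F x - 0)}"
    have "continuous_on UNIV (\<lambda>x. supp_Rn n K (proj_Rn n F x))"
      by (rule continuous_on_compose2[OF supp_continuous[OF K] continuous_on_proj_Rn]) simp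
    moreover have "continuous_on UNIV (\<lambda>x. norm_Rn n (proj_Rn n F x - 0))"
      by (rule continuous_on_compose2[OF continuous_on_norm_Rn_diff continuous_on_proj_Rn]) simp
    ultimately have "open ?X"
      by (intro open_Collect_less continuous_on_mult continuous_on_const)
    moreover have "\<not> (\<exists>x\<in>D. x \<in> ?X)" using h by (simp add: not_less)
    ultimately have X: "?X = {}" using D(2) by blast
    show "\<forall>\<theta>\<in>F. s * norm_Rn n \<theta> \<le> supp_Rn n K \<theta>"
    proof
      fix \<theta> assume "\<theta> \<in> F"
      moreover have "\<theta> \<notin> ?X" using X by blast
      ultimately show "s * norm_Rn n \<theta> \<le> supp_Rn n K \<theta>"
        using proj_Rn_id[OF d F, of \<theta>] by simp
    qed
  qed
  have mp: "(\<lambda>F. proj_Rn n F x) \<in> borel_measurable ?gb" for x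
  proof (rule measurable_coordinatewise_then_product)
    fix i show "(\<lambda>F. proj_Rn n F x i) \<in> borel_measurable ?gb"
    proof (cases "i < n")
      case True
      then show ?thesis
        unfolding proj_Rn_def
        by (simp, intro borel_measurable_sum borel_measurable_times measurable_proj_matrix) auto
    qed (simp add: proj_Rn_def)
  qed
  have [measurable]: "supp_Rn n K \<in> borel_measurable borel"
    by (rule borel_measurable_continuous_onI[OF supp_continuous[OF K]])
  have "Measurable.pred ?gb (\<lambda>F. s * norm_Rn n (proj_Rn n F x) \<le> supp_Rn n K (proj_Rn n F x))" for x
    using mp[of x] by measurable
  then have "{F \<in> space ?gb. \<forall>x\<in>D. s * norm_Rn n (proj_Rn n F x) \<le> supp_Rn n K (proj_Rn n F x)} \<in> sets ?gb"
    using D(1) by (intro sets.sets_Collect_countable_All') (auto simp: pred_def)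
  moreover have "{F \<in> grassmannian n (n - d). \<forall>\<theta>\<in>F. s * norm_Rn n \<theta> \<le> supp_Rn n K \<theta>}
      = {F \<in> space ?gb. \<forall>x\<in>D. s * norm_Rn n (proj_Rn n F x) \<le> supp_Rn n K (proj_Rn n F x)}"
    using eq by auto
  ultimately show ?thesis by simp
qed

section \<open>The Prekopa--Leindler inequality for unconditional functions\<close>

lemma nn_integral_layer_cake:
  fixes f :: "real \<Rightarrow> ennreal"
  assumes [measurable]: "f \<in> borel_measurable borel"
  shows "(\<integral>\<^sup>+x. f x \<partial>lborel) = (\<integral>\<^sup>+t. indicator {0..} t * emeasure lborel {x. ennreal t < f x} \<partial>lborel)"
proof -
  have 1: "f x = (\<integral>\<^sup>+t. indicator {(x, t). 0 \<le> t \<and> ennreal t < f x} (x, t) \<partial>lborel)" for x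
  proof (cases "f x")
    case (real r)
    have "(\<integral>\<^sup>+t. indicator {(x, t). 0 \<le> t \<and> ennreal t < f x} (x, t) \<partial>lborel) = (\<integral>\<^sup>+t. indicator {0..<r} t \<partial>lborel)"
      using real by (intro nn_integral_cong) (auto simp: ennreal_less_iff split: split_indicator)
    then show ?thesis using real by simp
  next
    case top
    have "(\<integral>\<^sup>+t. indicator {(x, t). 0 \<le> t \<and> ennreal t < f x} (x, t) \<partial>lborel) = (\<integral>\<^sup>+t. indicator {0::real..} t \<partial>lborel)"
      using top by (intro nn_integral_cong) (auto split: split_indicator)
    moreover have "emeasure lborel {0::real..} = top"
    proof (rule ccontr)
      assume "emeasure lborel {0::real..} \<noteq> top"
      then obtain r where r: "emeasure lborel {0::real..} = ennreal r" "0 \<le> r"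
        by (cases "emeasure lborel {0::real..}") auto
      have "emeasure lborel {0..r + 1} \<le> emeasure lborel {0::real..}" by (intro emeasure_mono) auto
      then show False using r by (simp add: ennreal_le_iff)
    qed
    ultimately show ?thesis using top by simp
  qed
  have "(\<integral>\<^sup>+x. f x \<partial>lborel) = (\<integral>\<^sup>+x. \<integral>\<^sup>+t. indicator {(x, t). 0 \<le> t \<and> ennreal t < f x} (x, t) \<partial>lborel \<partial>lborel)"
    by (intro nn_integral_cong 1)
  also have "\<dots> = (\<integral>\<^sup>+t. \<integral>\<^sup>+x. indicator {(x, t). 0 \<le> t \<and> ennreal t < f x} (x, t) \<partial>lborel \<partial>lborel)"
    by (rule lborel_pair.Fubini'[symmetric]) measurable
  also have "\<dots> = (\<integral>\<^sup>+t. indicator {0..} t * emeasure lborel {x. ennreal t < f x} \<partial>lborel)"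
  proof (rule nn_integral_cong)
    fix t :: real
    have "(\<integral>\<^sup>+x. indicator {(x, t). 0 \<le> t \<and> ennreal t < f x} (x, t) \<partial>lborel)
        = (\<integral>\<^sup>+x. indicator {0..} t * indicator {x. ennreal t < f x} x \<partial>lborel)"
      by (intro nn_integral_cong) (auto split: split_indicator)
    also have "\<dots> = indicator {0..} t * emeasure lborel {x. ennreal t < f x}"
      by (simp add: nn_integral_cmult_indicator)
    finally show "(\<integral>\<^sup>+x. indicator {(x, t). 0 \<le> t \<and> ennreal t < f x} (x, t) \<partial>lborel)
        = indicator {0..} t * emeasure lborel {x. ennreal t < f x}" .
  qed
  finally show ?thesis .
qed

text \<open>Brunn-Minkowski for sets around 0: any x in A and y in B put an interval of length |x| +
  |y| into H, so |x| + |y| \<le> |H|. Thus A has radius at most |H| - |y| for each y in B, which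
  bounds |y| by |H| - |A| / 2.\<close>

lemma emeasure_symmetric_levels:
  fixes A B H :: "real set"
  assumes ne: "A \<noteq> {}" "B \<noteq> {}" and H: "H \<in> sets borel"
    and sub: "\<And>x y z. x \<in> A \<Longrightarrow> y \<in> B \<Longrightarrow> \<bar>z\<bar> \<le> (\<bar>x\<bar> + \<bar>y\<bar>) / 2 \<Longrightarrow> z \<in> H"
  shows "emeasure lborel A + emeasure lborel B \<le> 2 * emeasure lborel H"
proof (cases "emeasure lborel H")
  case (real c)
  have bound: "\<bar>x\<bar> + \<bar>y\<bar> \<le> c" if "x \<in> A" "y \<in> B" for x y
  proof -
    define w where "w = (\<bar>x\<bar> + \<bar>y\<bar>) / 2"
    have w0: "0 \<le> w" by (simp add: w_def)
    have "{- w..w} \<subseteq> H"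
      unfolding w_def by (intro subsetI sub[OF that]) (simp only: atLeastAtMost_iff, linarith)
    then have "emeasure lborel {- w..w} \<le> ennreal c"
      unfolding real(2)[symmetric] using H by (intro emeasure_mono) auto
    then have "w + w \<le> c" using real(1) w0 by (simp add: ennreal_le_iff)
    then show ?thesis by (simp add: w_def)
  qed
  have A: "emeasure lborel A \<le> ennreal (2 * (c - \<bar>y\<bar>))" if "y \<in> B" for y
  proof -
    obtain x0 where "x0 \<in> A" using ne by auto
    then have c0: "0 \<le> c - \<bar>y\<bar>" using bound[OF _ that, of x0] by linarith
    have "A \<subseteq> {- (c - \<bar>y\<bar>)..c - \<bar>y\<bar>}" using bound[OF _ that] by force
    then have "emeasure lborel A \<le> emeasure lborel {- (c - \<bar>y\<bar>)..c - \<bar>y\<bar>}" by (intro emeasure_mono) auto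
    then show ?thesis using c0 by simp
  qed
  obtain y0 where "y0 \<in> B" using ne by auto
  then have "emeasure lborel A < top" using le_less_trans[OF A ennreal_less_top] by blast
  then obtain a where a: "0 \<le> a" "emeasure lborel A = ennreal a" by (cases "emeasure lborel A") auto
  have y: "\<bar>y\<bar> \<le> c - a / 2" if "y \<in> B" for y
  proof -
    obtain x0 where "x0 \<in> A" using ne by auto
    then have "0 \<le> c - \<bar>y\<bar>" using bound[OF _ that, of x0] by linarith
    then show ?thesis using A[OF that] a by (simp add: ennreal_le_iff)
  qed
  have c0: "0 \<le> c - a / 2" using y[OF \<open>y0 \<in> B\<close>] by linarith
  have "B \<subseteq> {- (c - a / 2)..c - a / 2}" using y by force
  then have "emeasure lborel B \<le> emeasure lborel {- (c - a / 2)..c - a / 2}" by (intro emeasure_mono) auto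
  also have "\<dots> = ennreal (2 * c - a)" using c0 by simp
  finally have "emeasure lborel A + emeasure lborel B \<le> ennreal a + ennreal (2 * c - a)"
    unfolding a(2) by (intro add_left_mono)
  also have "\<dots> = ennreal (2 * c)" using a(1) c0 by (simp add: ennreal_plus[symmetric] del: ennreal_plus)
  also have "\<dots> = 2 * emeasure lborel H" using real by (simp add: ennreal_mult)
  finally show ?thesis .
qed (simp add: ennreal_mult_top)

lemma ennreal_square_less:
  fixes a b c :: ennreal
  assumes "a \<le> t" "t < b" "t < c" "b \<noteq> top" "c \<noteq> top"
  shows "a * a < b * c"
proof -
  obtain t' where t: "t = ennreal t'" "0 \<le> t'" using assms by (cases t) auto
  obtain b' where b: "b = ennreal b'" "0 \<le> b'" using assms by (cases b) auto
  obtain c' where c: "c = ennreal c'" "0 \<le> c'" using assms by (cases c) auto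
  have "t' < b'" "t' < c'" using assms t b c by (auto simp: ennreal_less_iff)
  then have "t' * t' < b' * c'" using t(2) by (intro mult_strict_mono) auto
  then have "t * t < b * c" using t b c by (simp add: ennreal_mult[symmetric] ennreal_less_iff)
  moreover have "a * a \<le> t * t" using assms by (intro mult_mono) auto
  ultimately show ?thesis by simp
qed

text \<open>With equal maxima at 0, a level set of f is empty exactly when that of g is. The
  estimate for nonempty sets then applies at every relevant height and can be integrated.\<close>

lemma Prekopa_Leindler_equal_height:
  fixes f g h :: "real \<Rightarrow> ennreal"
  assumes [measurable]: "f \<in> borel_measurable borel" "g \<in> borel_measurable borel" "h \<in> borel_measurable borel"
    and f: "\<And>x y. \<bar>x\<bar> \<le> \<bar>y\<bar> \<Longrightarrow> f y \<le> f x" and g: "\<And>x y. \<bar>x\<bar> \<le> \<bar>y\<bar> \<Longrightarrow> g y \<le> g x"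
    and h: "\<And>x y z. \<bar>z\<bar> \<le> (\<bar>x\<bar> + \<bar>y\<bar>) / 2 \<Longrightarrow> f x * g y \<le> h z * h z"
    and 0: "f 0 = g 0" "f 0 \<noteq> top"
  shows "(\<integral>\<^sup>+x. f x \<partial>lborel) + (\<integral>\<^sup>+x. g x \<partial>lborel) \<le> 2 * (\<integral>\<^sup>+x. h x \<partial>lborel)"
proof -
  let ?L = "\<lambda>f t. indicator {0..} t * emeasure lborel {x::real. ennreal t < f x}"
  have meas [measurable]: "?L f \<in> borel_measurable lborel" if "f \<in> borel_measurable borel" for f :: "real \<Rightarrow> ennreal"
  proof -
    note that [measurable]
    have "{p \<in> space (lborel \<Otimes>\<^sub>M lborel). ennreal (fst p) < f (snd p)} \<in> sets (lborel \<Otimes>\<^sub>M lborel)"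
      by measurable
    from lborel.measurable_emeasure_Pair[OF this] show ?thesis
      by (simp add: vimage_def space_pair_measure)
  qed
  have lev: "emeasure lborel {x. ennreal t < f x} + emeasure lborel {x. ennreal t < g x}
      \<le> 2 * emeasure lborel {x. ennreal t < h x}" if t: "0 \<le> t" for t
  proof (cases "ennreal t < f 0")
    case False
    have "f x \<le> f 0" "g x \<le> g 0" for x using f[of 0 x] g[of 0 x] by auto
    then have "{x. ennreal t < f x} = {}" "{x. ennreal t < g x} = {}"
      using False 0(1) by (auto simp: not_less intro: order_trans)
    then show ?thesis by simp
  next
    case True
    show ?thesis
    proof (rule emeasure_symmetric_levels)
      show "{x. ennreal t < f x} \<noteq> {}" "{x. ennreal t < g x} \<noteq> {}" using True 0(1) by (auto intro: exI[of _ 0])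
      show "{x. ennreal t < h x} \<in> sets borel" by measurable
      fix x y z :: real assume xy: "x \<in> {x. ennreal t < f x}" "y \<in> {x. ennreal t < g x}" and z: "\<bar>z\<bar> \<le> (\<bar>x\<bar> + \<bar>y\<bar>) / 2"
      have "f x \<noteq> top" "g y \<noteq> top" using f[of 0 x] g[of 0 y] 0 by (auto simp: top_unique)
      then have "h z * h z < f x * g y" if "h z \<le> ennreal t"
        using xy that by (intro ennreal_square_less) auto
      then show "z \<in> {x. ennreal t < h x}" using h[OF z] by (auto simp: not_less[symmetric])
    qed
  qed
  have "(\<integral>\<^sup>+x. f x \<partial>lborel) + (\<integral>\<^sup>+x. g x \<partial>lborel) = (\<integral>\<^sup>+t. ?L f t + ?L g t \<partial>lborel)"
    by (subst (1 2) nn_integral_layer_cake) (simp_all add: nn_integral_add)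
  also have "\<dots> \<le> (\<integral>\<^sup>+t. 2 * ?L h t \<partial>lborel)"
    using lev by (intro nn_integral_mono) (auto split: split_indicator)
  also have "\<dots> = 2 * (\<integral>\<^sup>+x. h x \<partial>lborel)"
    by (subst nn_integral_layer_cake[of h]) (simp_all add: nn_integral_cmult)
  finally show ?thesis .
qed

lemma ennreal_AM_GM:
  fixes a b H :: ennreal
  assumes "a + b \<le> 2 * H"
  shows "a * b \<le> H * H"
proof (cases H)
  case (real c)
  then have "a + b \<le> ennreal (2 * c)" using assms by (simp add: ennreal_mult)
  then have "a \<le> ennreal (2 * c)" "b \<le> ennreal (2 * c)"
    by (auto intro: order_trans[rotated])
  then obtain a' b' where ab: "a = ennreal a'" "0 \<le> a'" "b = ennreal b'" "0 \<le> b'"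
    by (cases a; cases b) (auto simp: top_unique)
  then have le: "a' + b' \<le> 2 * c" using \<open>a + b \<le> ennreal (2 * c)\<close> real
    by (simp add: ennreal_plus[symmetric] ennreal_le_iff del: ennreal_plus)
  have "4 * (a' * b') \<le> (a' + b')\<^sup>2" using zero_le_power2[of "a' - b'"] by (simp add: power2_eq_square algebra_simps)
  also have "\<dots> \<le> (2 * c)\<^sup>2" using le ab by (intro power_mono) auto
  finally have "a' * b' \<le> c * c" by (simp add: power2_eq_square)
  then show ?thesis using ab real by (simp add: ennreal_mult[symmetric] ennreal_le_iff)
qed (simp add: ennreal_top_mult)

lemma Prekopa_Leindler_symmetric:
  fixes f g h :: "real \<Rightarrow> ennreal"
  assumes [measurable]: "f \<in> borel_measurable borel" "g \<in> borel_measurable borel" "h \<in> borel_measurable borel"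
    and f: "\<And>x y. \<bar>x\<bar> \<le> \<bar>y\<bar> \<Longrightarrow> f y \<le> f x" and g: "\<And>x y. \<bar>x\<bar> \<le> \<bar>y\<bar> \<Longrightarrow> g y \<le> g x"
    and h: "\<And>x y z. \<bar>z\<bar> \<le> (\<bar>x\<bar> + \<bar>y\<bar>) / 2 \<Longrightarrow> f x * g y \<le> h z * h z"
    and top: "f 0 \<noteq> top" "g 0 \<noteq> top"
  shows "(\<integral>\<^sup>+x. f x \<partial>lborel) * (\<integral>\<^sup>+x. g x \<partial>lborel) \<le> (\<integral>\<^sup>+x. h x \<partial>lborel) * (\<integral>\<^sup>+x. h x \<partial>lborel)"
proof (cases "f 0 = 0 \<or> g 0 = 0")
  case True
  then have "f = (\<lambda>_. 0) \<or> g = (\<lambda>_. 0)"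
    using f[of 0] g[of 0] by (auto simp: fun_eq_iff)
  then show ?thesis by auto
next
  case False
  obtain \<alpha> where \<alpha>: "f 0 = ennreal \<alpha>" "0 \<le> \<alpha>" using top by (cases "f 0") auto
  obtain \<beta> where \<beta>: "g 0 = ennreal \<beta>" "0 \<le> \<beta>" using top by (cases "g 0") auto
  have pos: "0 < \<alpha>" "0 < \<beta>" using False \<alpha> \<beta> by (auto simp: less_le)
  \<comment> \<open>Multiplying f by c and g by 1 / c equalises the heights and leaves every product
    f x * g y unchanged.\<close>
  define c where "c = sqrt (\<beta> / \<alpha>)"
  have c: "0 < c" "c * \<alpha> = \<beta> / c"
    using pos by (auto simp: c_def real_sqrt_divide field_simps)
  let ?F = "\<lambda>x. ennreal c * f x" and ?G = "\<lambda>x. ennreal (1 / c) * g x"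
  have cc: "ennreal c * ennreal (1 / c) = 1" using c(1) by (simp add: ennreal_mult[symmetric])
  have FG: "?F x * ?G y = f x * g y" for x y
    by (metis (no_types, lifting) cc mult.assoc mult.commute mult.left_neutral)
  have "(\<integral>\<^sup>+x. ?F x \<partial>lborel) + (\<integral>\<^sup>+x. ?G x \<partial>lborel) \<le> 2 * (\<integral>\<^sup>+x. h x \<partial>lborel)"
  proof (rule Prekopa_Leindler_equal_height)
    show "?F 0 = ?G 0" "?F 0 \<noteq> top"
      using c pos \<alpha> \<beta> by (auto simp: ennreal_mult[symmetric])
  qed (use f g h FG in \<open>auto intro!: mult_left_mono\<close>)
  then have "(\<integral>\<^sup>+x. ?F x \<partial>lborel) * (\<integral>\<^sup>+x. ?G x \<partial>lborel) \<le> (\<integral>\<^sup>+x. h x \<partial>lborel) * (\<integral>\<^sup>+x. h x \<partial>lborel)"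
    by (rule ennreal_AM_GM)
  also have "(\<integral>\<^sup>+x. ?F x \<partial>lborel) * (\<integral>\<^sup>+x. ?G x \<partial>lborel) = (ennreal c * ennreal (1 / c)) * ((\<integral>\<^sup>+x. f x \<partial>lborel) * (\<integral>\<^sup>+x. g x \<partial>lborel))"
    by (subst (1 2) nn_integral_cmult) (simp_all add: mult_ac)
  finally show ?thesis by (simp add: cc)
qed

text \<open>Induction on the dimension: integrating out one coordinate preserves monotonicity in the
  absolute values, and the one-dimensional inequality reproduces the midpoint hypothesis. The bound
  M and the radius R keep the marginals finite; M grows to 2 R M in each round.\<close>

lemma Prekopa_Leindler_unconditional:
  fixes f g h :: "(nat \<Rightarrow> real) \<Rightarrow> ennreal" and M R :: real
  assumes "finite I"
    and "f \<in> borel_measurable (Pi\<^sub>M I (\<lambda>_. lborel))" "g \<in> borel_measurable (Pi\<^sub>M I (\<lambda>_. lborel))"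
      "h \<in> borel_measurable (Pi\<^sub>M I (\<lambda>_. lborel))"
    and "\<And>x y. x \<in> extensional I \<Longrightarrow> y \<in> extensional I \<Longrightarrow> (\<And>i. i \<in> I \<Longrightarrow> \<bar>x i\<bar> \<le> \<bar>y i\<bar>) \<Longrightarrow> f y \<le> f x"
    and "\<And>x y. x \<in> extensional I \<Longrightarrow> y \<in> extensional I \<Longrightarrow> (\<And>i. i \<in> I \<Longrightarrow> \<bar>x i\<bar> \<le> \<bar>y i\<bar>) \<Longrightarrow> g y \<le> g x"
    and "\<And>x y z. x \<in> extensional I \<Longrightarrow> y \<in> extensional I \<Longrightarrow> z \<in> extensional I \<Longrightarrow>
      (\<And>i. i \<in> I \<Longrightarrow> \<bar>z i\<bar> \<le> (\<bar>x i\<bar> + \<bar>y i\<bar>) / 2) \<Longrightarrow> f x * g y \<le> h z * h z"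
    and "0 \<le> M" "0 \<le> R" "\<And>x. f x \<le> ennreal M" "\<And>x. g x \<le> ennreal M"
    and "\<And>x i. i \<in> I \<Longrightarrow> R < \<bar>x i\<bar> \<Longrightarrow> f x = 0" "\<And>x i. i \<in> I \<Longrightarrow> R < \<bar>x i\<bar> \<Longrightarrow> g x = 0"
  shows "(\<integral>\<^sup>+x. f x \<partial>Pi\<^sub>M I (\<lambda>_. lborel)) * (\<integral>\<^sup>+x. g x \<partial>Pi\<^sub>M I (\<lambda>_. lborel))
    \<le> (\<integral>\<^sup>+x. h x \<partial>Pi\<^sub>M I (\<lambda>_. lborel)) * (\<integral>\<^sup>+x. h x \<partial>Pi\<^sub>M I (\<lambda>_. lborel))"
  using assms
proof (induction I arbitrary: f g h M rule: finite_induct)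
  case empty
  have "f (\<lambda>k. undefined) * g (\<lambda>k. undefined) \<le> h (\<lambda>k. undefined) * h (\<lambda>k. undefined)"
    by (rule empty.prems(6)) auto
  then show ?case by (simp add: lborel_prod.nn_integral_empty)
next
  case (insert i I)
  let ?P = "\<lambda>I. Pi\<^sub>M I (\<lambda>_. lborel :: real measure)"
  note [measurable] = insert.prems(1-3)
  let ?m = "\<lambda>f x. \<integral>\<^sup>+t. f (x(i := t)) \<partial>lborel"
  have jm: "(\<lambda>(x, t). q (x(i := t))) \<in> borel_measurable (?P I \<Otimes>\<^sub>M lborel)"
    if "q \<in> borel_measurable (?P (insert i I))" for q :: "(nat \<Rightarrow> real) \<Rightarrow> ennreal"
    using measurable_compose[OF measurable_add_dim[of i I "\<lambda>_. lborel"] that] by (simp add: case_prod_beta')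
  have mm: "?m q \<in> borel_measurable (?P I)" if "q \<in> borel_measurable (?P (insert i I))" for q :: "(nat \<Rightarrow> real) \<Rightarrow> ennreal"
    by (rule lborel.borel_measurable_nn_integral) (rule jm[OF that])
  have om: "(\<lambda>t. q (x(i := t))) \<in> borel_measurable borel"
    if "q \<in> borel_measurable (?P (insert i I))" "x \<in> extensional I" for q :: "(nat \<Rightarrow> real) \<Rightarrow> ennreal" and x
    using measurable_compose[OF measurable_component_update[of x I "\<lambda>_. lborel" i] that(1)] that(2) insert.hyps(2)
    by (simp add: space_PiM PiE_def)
  have ext: "x(i := t) \<in> extensional (insert i I)" if "x \<in> extensional I" for x :: "nat \<Rightarrow> real" and t
    using that by (auto simp: extensional_def)
  have bnd: "?m q x \<le> ennreal (M * (2 * R))"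
    if "\<And>x. q x \<le> ennreal M" "\<And>x j. j \<in> insert i I \<Longrightarrow> R < \<bar>x j\<bar> \<Longrightarrow> q x = 0" for q :: "(nat \<Rightarrow> real) \<Rightarrow> ennreal" and x
  proof -
    have "?m q x \<le> (\<integral>\<^sup>+t. ennreal M * indicator {- R..R} t \<partial>lborel)"
    proof (rule nn_integral_mono)
      fix t
      show "q (x(i := t)) \<le> ennreal M * indicator {- R..R} t"
        using that(1)[of "x(i := t)"] that(2)[of i "x(i := t)"] by (auto split: split_indicator)
    qed
    also have "\<dots> = ennreal M * ennreal (2 * R)"
      using insert.prems(8) by (simp add: nn_integral_cmult_indicator)
    also have "\<dots> = ennreal (M * (2 * R))" using insert.prems(7,8) by (simp add: ennreal_mult)
    finally show ?thesis .
  qed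
  have vanish: "?m q x = 0"
    if "\<And>x j. j \<in> insert i I \<Longrightarrow> R < \<bar>x j\<bar> \<Longrightarrow> q x = 0" "j \<in> I" "R < \<bar>x j\<bar>" for q :: "(nat \<Rightarrow> real) \<Rightarrow> ennreal" and x j
  proof -
    have "q (x(i := t)) = 0" for t
      using that insert.hyps(2) by (intro that(1)[of j]) auto
    then show ?thesis by simp
  qed
  have "(\<integral>\<^sup>+x. ?m f x \<partial>?P I) * (\<integral>\<^sup>+x. ?m g x \<partial>?P I) \<le> (\<integral>\<^sup>+x. ?m h x \<partial>?P I) * (\<integral>\<^sup>+x. ?m h x \<partial>?P I)"
  proof (rule insert.IH[where M="M * (2 * R)"])
    show "?m f y \<le> ?m f x" if "x \<in> extensional I" "y \<in> extensional I" "\<And>j. j \<in> I \<Longrightarrow> \<bar>x j\<bar> \<le> \<bar>y j\<bar>" for x y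
      using that by (intro nn_integral_mono insert.prems(4) ext) auto
    show "?m g y \<le> ?m g x" if "x \<in> extensional I" "y \<in> extensional I" "\<And>j. j \<in> I \<Longrightarrow> \<bar>x j\<bar> \<le> \<bar>y j\<bar>" for x y
      using that by (intro nn_integral_mono insert.prems(5) ext) auto
    show "?m f x * ?m g y \<le> ?m h z * ?m h z"
      if "x \<in> extensional I" "y \<in> extensional I" "z \<in> extensional I" "\<And>j. j \<in> I \<Longrightarrow> \<bar>z j\<bar> \<le> (\<bar>x j\<bar> + \<bar>y j\<bar>) / 2" for x y z
    proof (rule Prekopa_Leindler_symmetric)
      show "f (x(i := t)) * g (y(i := s)) \<le> h (z(i := r)) * h (z(i := r))" if "\<bar>r\<bar> \<le> (\<bar>t\<bar> + \<bar>s\<bar>) / 2" for t s r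
        using that \<open>\<And>j. j \<in> I \<Longrightarrow> \<bar>z j\<bar> \<le> (\<bar>x j\<bar> + \<bar>y j\<bar>) / 2\<close> by (intro insert.prems(6) ext that) (auto intro: \<open>x \<in> _\<close> \<open>y \<in> _\<close> \<open>z \<in> _\<close>)
      show "f (x(i := t)) \<le> f (x(i := s))" if "\<bar>s\<bar> \<le> \<bar>t\<bar>" for s t
        using that by (intro insert.prems(4) ext \<open>x \<in> _\<close>) auto
      show "g (y(i := t)) \<le> g (y(i := s))" if "\<bar>s\<bar> \<le> \<bar>t\<bar>" for s t
        using that by (intro insert.prems(5) ext \<open>y \<in> _\<close>) auto
      show "f (x(i := 0)) \<noteq> top" "g (y(i := 0)) \<noteq> top"
        by (rule neq_top_trans[OF ennreal_neq_top insert.prems(9)], rule neq_top_trans[OF ennreal_neq_top insert.prems(10)])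
    qed (use that in \<open>auto intro!: om insert.prems(1-3)\<close>)
    show "0 \<le> M * (2 * R)" "0 \<le> R" using insert.prems(7,8) by auto
    show "?m f x \<le> ennreal (M * (2 * R))" for x by (rule bnd[OF insert.prems(9,11)])
    show "?m g x \<le> ennreal (M * (2 * R))" for x by (rule bnd[OF insert.prems(10,12)])
    show "?m f x = 0" if "j \<in> I" "R < \<bar>x j\<bar>" for x j using that insert.prems(11) by (intro vanish[of f j x]) auto
    show "?m g x = 0" if "j \<in> I" "R < \<bar>x j\<bar>" for x j using that insert.prems(12) by (intro vanish[of g j x]) auto
  qed (intro mm insert.prems(1-3))+
  then show ?case
    by (simp add: lborel_prod.product_nn_integral_insert[OF insert.hyps])
qed

section \<open>Unconditional isotropic bodies\<close>

definition l1_Rn :: "nat \<Rightarrow> (nat \<Rightarrow> real) \<Rightarrow> real"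
  where "l1_Rn n x = (\<Sum>i<n. \<bar>x i\<bar>)"

lemma convex_body_facts:
  assumes "convex_body n K"
  shows "compact K" "convex K" "K \<noteq> {}" "K \<subseteq> Rn n"
proof -
  have c: "compactin (Euclidean_space n) K" using assms by (simp add: convex_body_def)
  then show "K \<subseteq> Rn n" by (rule compactin_subset_topspace)
  show "compact K"
    using c by (simp add: Euclidean_space_def compactin_subtopology euclidean_product_topology compactin_euclidean_iff)
  show "convex K" using assms by (simp add: convex_body_def)
  have "Euclidean_space n interior_of K \<noteq> {}" using assms by (simp add: convex_body_def)
  then show "K \<noteq> {}" using interior_of_subset[of "Euclidean_space n" K] by auto
qed

text \<open>Coordinates are lowered one at a time: the vector with y_j in place of x_j is the
  combination of x and its mirror image in coordinate j with weights (1 + r) / 2 and (1 - r) / 2,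
  where r = y_j / x_j.\<close>

lemma unconditional_solid:
  assumes K: "convex K" "unconditional n K" and x: "x \<in> K" "x \<in> Rn n"
    and y: "y \<in> Rn n" "\<And>i. i < n \<Longrightarrow> \<bar>y i\<bar> \<le> \<bar>x i\<bar>"
  shows "y \<in> K"
proof -
  have "(\<lambda>j. if j \<in> J then y j else x j) \<in> K" if "finite J" "J \<subseteq> {..<n}" for J
    using that
  proof (induction J rule: finite_induct)
    case empty
    then show ?case using x by simp
  next
    case (insert j J)
    define w where "w = (\<lambda>l. if l \<in> J then y l else x l)"
    have w: "w \<in> K" "w j = x j" using insert by (auto simp: w_def)
    have eq: "(\<lambda>l. if l \<in> insert j J then y l else x l) = w(j := y j)"
      by (auto simp: w_def fun_eq_iff)
    have j: "j < n" using insert.prems by simp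
    show ?case
    proof (cases "x j = 0")
      case True
      then have "y j = w j" using y(2)[OF j] w by simp
      then show ?thesis unfolding eq using w(1) by (metis fun_upd_triv)
    next
      case False
      define \<epsilon> where "\<epsilon> i = (if i = j then -1 else 1 :: real)" for i :: nat
      have "\<epsilon> \<in> {..<n} \<rightarrow> {-1, 1}" by (auto simp: \<epsilon>_def)
      then have w': "(\<lambda>i. \<epsilon> i * w i) \<in> K" using K(2) w(1) by (auto simp: unconditional_def)
      define r where "r = y j / x j"
      define a b where "a = (1 + r) / 2" and "b = (1 - r) / 2"
      have "\<bar>r\<bar> \<le> 1" using y(2)[OF j] False by (simp add: r_def abs_divide field_simps)
      then have "-1 \<le> r \<and> r \<le> 1" by linarith
      then have ab: "0 \<le> a" "0 \<le> b" "a + b = 1" by (auto simp: a_def b_def field_simps)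
      have "a *\<^sub>R w + b *\<^sub>R (\<lambda>i. \<epsilon> i * w i) \<in> K"
        using K(1) w(1) w' ab unfolding convex_def by blast
      also have "a *\<^sub>R w + b *\<^sub>R (\<lambda>i. \<epsilon> i * w i) = w(j := y j)"
      proof
        fix l
        show "(a *\<^sub>R w + b *\<^sub>R (\<lambda>i. \<epsilon> i * w i)) l = (w(j := y j)) l"
        proof (cases "l = j")
          case True
          have "a * x j + b * (- x j) = y j" using False by (simp add: a_def b_def r_def field_simps)
          then show ?thesis using True w(2) by (simp add: \<epsilon>_def)
        next
          case l: False
          have "a * w l + b * w l = w l" using ab(3) by (metis distrib_right mult_1)
          then show ?thesis using l by (simp add: \<epsilon>_def)
        qed
      qed
      finally show ?thesis unfolding eq .
    qed
  qed
  from this[of "{..<n}"] have "(\<lambda>j. if j < n then y j else x j) \<in> K" by simp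
  also have "(\<lambda>j. if j < n then y j else x j) = y"
    using x(2) y(1) by (auto simp: mem_Rn fun_eq_iff)
  finally show ?thesis .
qed

text \<open>The integral of the indicator of K after this map is the mass of a tail of x_i on K,
  written as the integral of a function decreasing in every |x_j|, which is what the inequality
  above accepts.\<close>

definition shift_abs :: "nat \<Rightarrow> nat \<Rightarrow> real \<Rightarrow> (nat \<Rightarrow> real) \<Rightarrow> nat \<Rightarrow> real"
  where "shift_abs n i s x = (\<lambda>j. if j < n then \<bar>x j\<bar> + (if j = i then s else 0) else 0)"

lemma shift_abs_mem [simp]: "shift_abs n i s x \<in> Rn n"
  by (simp add: shift_abs_def mem_Rn)

lemma measurable_shift_abs [measurable]: "shift_abs n i s \<in> borel_measurable borel"
proof (rule measurable_coordinatewise_then_product)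
  fix j show "(\<lambda>x. shift_abs n i s x j) \<in> borel_measurable borel"
    by (cases "j < n") (simp_all add: shift_abs_def)
qed

lemma shift_abs_extend [simp]: "shift_abs n i s (extend_Rn n x) = shift_abs n i s x"
  by (auto simp: shift_abs_def extend_Rn_def)

text \<open>The shifts 2t and 0 have mean t: the midpoint of the two shifted points lies in K by
  convexity and dominates the point shifted by t, which then lies in K by solidity.\<close>

lemma unconditional_shift_log_concave:
  assumes K: "compact K" "convex K" "unconditional n K" "K \<subseteq> Rn n" and t: "0 \<le> t"
  shows "(\<integral>\<^sup>+x. indicator K (shift_abs n i (2 * t) x) \<partial>lborel_Rn n) * (\<integral>\<^sup>+x. indicator K (shift_abs n i 0 x) \<partial>lborel_Rn n)
    \<le> (\<integral>\<^sup>+x. indicator K (shift_abs n i t x) \<partial>lborel_Rn n) * (\<integral>\<^sup>+x. indicator K (shift_abs n i t x) \<partial>lborel_Rn n)"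
proof -
  have [measurable]: "K \<in> sets borel" using compact_imp_closed[OF K(1)] by simp
  obtain R where R: "R \<ge> 0" "\<forall>x\<in>K. norm_Rn n x \<le> R" using compact_norm_Rn_bounded[OF K(1)] by blast
  let ?q = "\<lambda>s x. indicator K (shift_abs n i s x) :: ennreal"
  have m: "?q s \<in> borel_measurable borel" for s by measurable
  have m': "?q s \<in> borel_measurable (Pi\<^sub>M {..<n} (\<lambda>_. lborel))" for s
    using measurable_compose[OF measurable_extend_Rn m[of s], of n] by simp
  have int: "(\<integral>\<^sup>+x. ?q s x \<partial>lborel_Rn n) = (\<integral>\<^sup>+x. ?q s x \<partial>Pi\<^sub>M {..<n} (\<lambda>_. lborel))" for s
    by (subst nn_integral_lborel_Rn[OF m]) simp
  have mono: "?q s y \<le> ?q s x" if "0 \<le> s" "\<And>j. j \<in> {..<n} \<Longrightarrow> \<bar>x j\<bar> \<le> \<bar>y j\<bar>" for s x y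
  proof -
    have "shift_abs n i s x \<in> K" if "shift_abs n i s y \<in> K"
      by (rule unconditional_solid[OF K(2,3) that shift_abs_mem shift_abs_mem])
        (use \<open>0 \<le> s\<close> \<open>\<And>j. j \<in> {..<n} \<Longrightarrow> \<bar>x j\<bar> \<le> \<bar>y j\<bar>\<close> in \<open>auto simp: shift_abs_def[of n i s]\<close>)
    then show ?thesis by (auto split: split_indicator)
  qed
  have vanish: "?q s x = 0" if "0 \<le> s" "j \<in> {..<n}" "R < \<bar>x j\<bar>" for s x j
  proof -
    have "shift_abs n i s x \<notin> K"
    proof
      assume "shift_abs n i s x \<in> K"
      then have "norm_Rn n (shift_abs n i s x) \<le> R" using R by auto
      moreover have "shift_abs n i s x j \<le> norm_Rn n (shift_abs n i s x)"
        using that by (intro member_le_L2_set) auto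
      moreover have "\<bar>x j\<bar> \<le> shift_abs n i s x j" using that by (simp add: shift_abs_def)
      ultimately show False using that by linarith
    qed
    then show ?thesis by simp
  qed
  have le1: "?q s x \<le> 1" for s x by (auto split: split_indicator)
  show ?thesis
    unfolding int
  proof (rule Prekopa_Leindler_unconditional[where M=1 and R=R])
    show "?q (2 * t) x * ?q 0 y \<le> ?q t z * ?q t z"
      if z: "\<And>j. j \<in> {..<n} \<Longrightarrow> \<bar>z j\<bar> \<le> (\<bar>x j\<bar> + \<bar>y j\<bar>) / 2" for x y z
    proof -
      have "shift_abs n i t z \<in> K" if x: "shift_abs n i (2 * t) x \<in> K" and y: "shift_abs n i 0 y \<in> K"
      proof (rule unconditional_solid[OF K(2,3)])
        show "(1 / 2) *\<^sub>R shift_abs n i (2 * t) x + (1 / 2) *\<^sub>R shift_abs n i 0 y \<in> K"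
          using K(2) x y unfolding convex_def by auto
        then show "(1 / 2) *\<^sub>R shift_abs n i (2 * t) x + (1 / 2) *\<^sub>R shift_abs n i 0 y \<in> Rn n"
          using K(4) by blast
        show "\<bar>shift_abs n i t z j\<bar> \<le> \<bar>((1 / 2) *\<^sub>R shift_abs n i (2 * t) x + (1 / 2) *\<^sub>R shift_abs n i 0 y) j\<bar>"
          if "j < n" for j
          using z[of j] that t by (auto simp: shift_abs_def field_simps)
      qed simp
      then show ?thesis by (auto split: split_indicator)
    qed
  qed (use t R(1) mono vanish in \<open>auto intro!: m' le1\<close>)
qed

text \<open>The half-lines u \<ge> 0 and u < 0 are moved to [t, \<infinity>) and (-\<infinity>, -t).
  Keeping only the endpoint t makes the identity exact, and for t = 0 the set is the whole
  line.\<close>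

lemma nn_integral_shift_even:
  fixes \<phi> :: "real \<Rightarrow> ennreal"
  assumes [measurable]: "\<phi> \<in> borel_measurable borel" and even: "\<And>u. \<phi> (- u) = \<phi> u" and t: "0 \<le> t"
  shows "(\<integral>\<^sup>+u. \<phi> (\<bar>u\<bar> + t) \<partial>lborel) = (\<integral>\<^sup>+u. \<phi> u * indicator {u. t \<le> u \<or> u < - t} u \<partial>lborel)"
proof -
  have m: "(\<lambda>u. \<phi> (c + 1 * u) * indicator A (c + 1 * u)) \<in> borel_measurable lborel" if "A \<in> sets borel" for c A
    using measurable_compose[of "\<lambda>u. c + 1 * u" lborel borel "\<lambda>v. \<phi> v * indicator A v"] that by simp
  have "(\<integral>\<^sup>+u. \<phi> (\<bar>u\<bar> + t) \<partial>lborel)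
      = (\<integral>\<^sup>+u. \<phi> (t + 1 * u) * indicator {t..} (t + 1 * u) + \<phi> (- t + 1 * u) * indicator {..<- t} (- t + 1 * u) \<partial>lborel)"
  proof (rule nn_integral_cong)
    fix u :: real
    show "\<phi> (\<bar>u\<bar> + t) = \<phi> (t + 1 * u) * indicator {t..} (t + 1 * u) + \<phi> (- t + 1 * u) * indicator {..<- t} (- t + 1 * u)"
      using even[of "u - t"] by (cases "0 \<le> u") (auto simp: add.commute)
  qed
  also have "\<dots> = (\<integral>\<^sup>+u. \<phi> (t + 1 * u) * indicator {t..} (t + 1 * u) \<partial>lborel)
      + (\<integral>\<^sup>+u. \<phi> (- t + 1 * u) * indicator {..<- t} (- t + 1 * u) \<partial>lborel)"
    by (intro nn_integral_add m) auto
  also have "(\<integral>\<^sup>+u. \<phi> (t + 1 * u) * indicator {t..} (t + 1 * u) \<partial>lborel) = (\<integral>\<^sup>+u. \<phi> u * indicator {t..} u \<partial>lborel)"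
    using nn_integral_real_affine[of "\<lambda>u. \<phi> u * indicator {t..} u" 1 t] by simp
  also have "(\<integral>\<^sup>+u. \<phi> (- t + 1 * u) * indicator {..<- t} (- t + 1 * u) \<partial>lborel) = (\<integral>\<^sup>+u. \<phi> u * indicator {..<- t} u \<partial>lborel)"
    using nn_integral_real_affine[of "\<lambda>u. \<phi> u * indicator {..<- t} u" 1 "- t"] by simp
  also have "(\<integral>\<^sup>+u. \<phi> u * indicator {t..} u \<partial>lborel) + (\<integral>\<^sup>+u. \<phi> u * indicator {..<- t} u \<partial>lborel)
      = (\<integral>\<^sup>+u. \<phi> u * indicator {t..} u + \<phi> u * indicator {..<- t} u \<partial>lborel)"
    using m[of "{t..}" 0] m[of "{..<- t}" 0] by (intro nn_integral_add[symmetric]) simp_all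
  also have "\<dots> = (\<integral>\<^sup>+u. \<phi> u * indicator {u. t \<le> u \<or> u < - t} u \<partial>lborel)"
    using t by (intro nn_integral_cong) (auto split: split_indicator)
  finally show ?thesis .
qed

lemma unconditional_mem_cong:
  assumes K: "convex K" "unconditional n K" and x: "x \<in> Rn n" and y: "y \<in> Rn n"
    and "\<And>i. i < n \<Longrightarrow> \<bar>y i\<bar> = \<bar>x i\<bar>"
  shows "x \<in> K \<longleftrightarrow> y \<in> K"
  using unconditional_solid[OF K _ x y] unconditional_solid[OF K _ y x] assms(5) by auto

lemma unconditional_shift_eq_tail:
  assumes K: "compact K" "convex K" "unconditional n K" and i: "i < n" and t: "0 \<le> t"
  shows "(\<integral>\<^sup>+x. indicator K (shift_abs n i t x) \<partial>lborel_Rn n) = emeasure (lborel_Rn n) (K \<inter> {x. t \<le> x i \<or> x i < - t})"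
proof -
  have Kb [measurable]: "K \<in> sets borel" using compact_imp_closed[OF K(1)] by simp
  have [measurable]: "{x :: nat \<Rightarrow> real. t \<le> x i \<or> x i < - t} \<in> sets borel" by measurable
  have inner: "(\<integral>\<^sup>+u. indicator K (shift_abs n i t (y(i := u))) \<partial>lborel)
      = (\<integral>\<^sup>+u. indicator (K \<inter> {x. t \<le> x i \<or> x i < - t}) (y(i := u)) \<partial>lborel)" if y: "y \<in> Rn n" for y
  proof -
    note measurable_fun_upd_value [measurable]
    have yi: "y(i := u) \<in> Rn n" for u using y i by (simp add: mem_Rn)
    have "(\<integral>\<^sup>+u. indicator K (shift_abs n i t (y(i := u))) \<partial>lborel) = (\<integral>\<^sup>+u. indicator K (y(i := \<bar>u\<bar> + t)) \<partial>lborel)"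
    proof (rule nn_integral_cong)
      fix u :: real
      have "shift_abs n i t (y(i := u)) \<in> K \<longleftrightarrow> y(i := \<bar>u\<bar> + t) \<in> K"
        using t by (intro unconditional_mem_cong[OF K(2,3) shift_abs_mem yi]) (auto simp: shift_abs_def)
      then show "(indicator K (shift_abs n i t (y(i := u))) :: ennreal) = indicator K (y(i := \<bar>u\<bar> + t))"
        by (simp add: indicator_def)
    qed
    also have "\<dots> = (\<integral>\<^sup>+u. indicator K (y(i := u)) * indicator {u. t \<le> u \<or> u < - t} u \<partial>lborel)"
    proof (rule nn_integral_shift_even[OF _ _ t])
      fix u :: real
      have "y(i := - u) \<in> K \<longleftrightarrow> y(i := u) \<in> K"
        by (intro unconditional_mem_cong[OF K(2,3)] yi) auto
      then show "(indicator K (y(i := - u)) :: ennreal) = indicator K (y(i := u))"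
        by (simp add: indicator_def)
    qed measurable
    also have "\<dots> = (\<integral>\<^sup>+u. indicator (K \<inter> {x. t \<le> x i \<or> x i < - t}) (y(i := u)) \<partial>lborel)"
      by (intro nn_integral_cong) (auto split: split_indicator)
    finally show ?thesis .
  qed
  have "(\<integral>\<^sup>+x. indicator K (shift_abs n i t x) \<partial>lborel_Rn n)
      = (\<integral>\<^sup>+x. indicator (K \<inter> {x. t \<le> x i \<or> x i < - t}) x \<partial>lborel_Rn n)"
    by (subst (1 2) nn_integral_lborel_Rn_coord[OF _ i]) (simp_all add: inner)
  then show ?thesis by simp
qed

section \<open>Comparison of the first two moments of a coordinate\<close>

lemma geometric_tail_weight: "4 ^ (k + 1) * (1 / 2) ^ (2 ^ k) \<le> 64 * (1 / 2 :: real) ^ k"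
proof -
  have "3 * k \<le> 4 + 2 ^ k"
  proof (induction k)
    case (Suc k)
    consider "k = 0" | "k = 1" | "2 \<le> k" by linarith
    then show ?case
    proof cases
      case 3
      then have "(2::nat) ^ 2 \<le> 2 ^ k" by (intro power_increasing) auto
      then show ?thesis using Suc by simp
    qed auto
  qed simp
  then have "(2::real) ^ (3 * k) \<le> 2 ^ (4 + 2 ^ k)" by (intro power_increasing) auto
  then have "(8::real) ^ k \<le> 16 * 2 ^ (2 ^ k)" by (simp add: power_mult power_add)
  moreover have "(8::real) ^ k = 4 ^ k * 2 ^ k" by (simp add: power_mult_distrib[symmetric])
  ultimately show ?thesis by (simp add: field_simps power_divide)
qed

text \<open>
  Borell's argument: by Markov \<open>q (2 E|X|) \<le> 1/2\<close>, and the hypothesis makes the tail decay doubly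
  exponentially along the scales \<open>2\<^sup>k \<cdot> 2 E|X|\<close>.
\<close>

lemma (in prob_space) second_moment_le_first_moment:
  fixes X :: "'a \<Rightarrow> real"
  defines "q \<equiv> \<lambda>t. prob {\<omega> \<in> space M. t \<le> X \<omega> \<or> X \<omega> < - t}"
  assumes [measurable]: "X \<in> borel_measurable M" and R: "AE \<omega> in M. \<bar>X \<omega>\<bar> \<le> R"
    and q: "\<And>t. 0 \<le> t \<Longrightarrow> q (2 * t) \<le> (q t)\<^sup>2"
    and pos: "0 < expectation (\<lambda>\<omega>. \<bar>X \<omega>\<bar>)"
  shows "expectation (\<lambda>\<omega>. (X \<omega>)\<^sup>2) \<le> 516 * (expectation (\<lambda>\<omega>. \<bar>X \<omega>\<bar>))\<^sup>2"
proof -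
  let ?a = "expectation (\<lambda>\<omega>. \<bar>X \<omega>\<bar>)"
  define s where "s = 2 * ?a"
  have s: "0 < s" using pos by (simp add: s_def)
  have intX: "integrable M (\<lambda>\<omega>. \<bar>X \<omega>\<bar>)"
    by (rule integrable_const_bound[of _ R]) (use R in auto)
  have intX2: "integrable M (\<lambda>\<omega>. (X \<omega>)\<^sup>2)"
  proof (rule integrable_const_bound[of _ "R\<^sup>2"])
    show "AE \<omega> in M. norm ((X \<omega>)\<^sup>2) \<le> R\<^sup>2"
      using R
    proof eventually_elim
      case (elim \<omega>)
      then have "\<bar>X \<omega>\<bar>\<^sup>2 \<le> R\<^sup>2" by (intro power_mono) auto
      then show ?case by simp
    qed
  qed simp
  have q0: "q s \<le> 1 / 2"
  proof -
    have "q s \<le> prob {\<omega> \<in> space M. s \<le> \<bar>X \<omega>\<bar>}"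
      unfolding q_def using s by (intro finite_measure_mono) auto
    also have "\<dots> \<le> ?a / s"
      by (rule integral_Markov_inequality_measure[OF intX]) (use s in auto)
    also have "\<dots> = 1 / 2" using pos by (simp add: s_def)
    finally show ?thesis .
  qed
  have qk: "q (2 ^ k * s) \<le> (1 / 2) ^ (2 ^ k)" for k
  proof (induction k)
    case 0
    then show ?case using q0 by simp
  next
    case (Suc k)
    have "q (2 ^ Suc k * s) \<le> (q (2 ^ k * s))\<^sup>2"
      using q[of "2 ^ k * s"] s by (simp add: mult.assoc)
    also have "\<dots> \<le> ((1 / 2) ^ (2 ^ k))\<^sup>2"
      using Suc by (intro power_mono) (auto simp: q_def)
    also have "\<dots> = (1 / 2) ^ (2 ^ Suc k)" by (simp add: power_mult[symmetric] mult.commute)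
    finally show ?case .
  qed
  obtain m where m: "R < 2 ^ m * s"
  proof -
    obtain m where "R / s < 2 ^ m" using real_arch_pow[of 2 "R / s"] by auto
    then show ?thesis using that[of m] s by (simp add: field_simps)
  qed
  let ?A = "\<lambda>k. {\<omega> \<in> space M. 2 ^ k * s \<le> X \<omega> \<or> X \<omega> < - (2 ^ k * s)}"
  have "expectation (\<lambda>\<omega>. (X \<omega>)\<^sup>2)
      \<le> expectation (\<lambda>\<omega>. s\<^sup>2 + (\<Sum>k<m. 4 ^ (k + 1) * s\<^sup>2 * indicator (?A k) \<omega>))"
  proof (rule integral_mono_AE[OF intX2])
    show "integrable M (\<lambda>\<omega>. s\<^sup>2 + (\<Sum>k<m. 4 ^ (k + 1) * s\<^sup>2 * indicator (?A k) \<omega>))"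
      by (intro Bochner_Integration.integrable_add Bochner_Integration.integrable_sum integrable_mult_right
          integrable_real_indicator) (auto simp: emeasure_eq_measure)
    show "AE \<omega> in M. (X \<omega>)\<^sup>2 \<le> s\<^sup>2 + (\<Sum>k<m. 4 ^ (k + 1) * s\<^sup>2 * indicator (?A k) \<omega>)"
      using R AE_space
    proof eventually_elim
      case (elim \<omega>)
      have sum0: "0 \<le> (\<Sum>k\<in>J. 4 ^ (k + 1) * s\<^sup>2 * indicator (?A k) \<omega>)" for J
        by (intro sum_nonneg) auto
      show ?case
      proof (cases "\<bar>X \<omega>\<bar> \<le> s")
        case True
        then have "\<bar>X \<omega>\<bar>\<^sup>2 \<le> s\<^sup>2" by (intro power_mono) auto
        then show ?thesis using sum0[of "{..<m}"] by simp
      next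
        case False
        \<comment> \<open>\<open>j\<close> is the least scale covering |X|, so the event at scale j
          - 1 occurs and its single summand already dominates X^2.\<close>
        define j where "j = (LEAST k. \<bar>X \<omega>\<bar> \<le> 2 ^ k * s)"
        have ex: "\<bar>X \<omega>\<bar> \<le> 2 ^ m * s" using elim(1) m by linarith
        have j: "\<bar>X \<omega>\<bar> \<le> 2 ^ j * s" unfolding j_def by (rule LeastI[of _ m]) (rule ex)
        have jm: "j \<le> m" unfolding j_def by (rule Least_le) (rule ex)
        have "j \<noteq> 0" using False j by (intro notI) simp
        then obtain k where k: "j = Suc k" by (cases j) auto
        have "\<not> \<bar>X \<omega>\<bar> \<le> 2 ^ k * s" using not_less_Least[of k "\<lambda>k. \<bar>X \<omega>\<bar> \<le> 2 ^ k * s"] k j_def by auto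
        then have "\<omega> \<in> ?A k" using elim(2) by auto
        have "\<bar>X \<omega>\<bar>\<^sup>2 \<le> (2 ^ Suc k * s)\<^sup>2" using j k by (intro power_mono) auto
        also have "\<dots> = 4 ^ (k + 1) * s\<^sup>2"
        proof -
          have "(2 ^ k)\<^sup>2 = (4::real) ^ k" by (simp add: power2_eq_square power_mult_distrib[symmetric])
          then show ?thesis by (simp add: power_mult_distrib)
        qed
        also have "\<dots> = 4 ^ (k + 1) * s\<^sup>2 * indicator (?A k) \<omega>" using \<open>\<omega> \<in> ?A k\<close> by simp
        also have "\<dots> \<le> (\<Sum>k<m. 4 ^ (k + 1) * s\<^sup>2 * indicator (?A k) \<omega>)"
          using jm k by (intro member_le_sum[of k "{..<m}"]) auto
        finally have "(X \<omega>)\<^sup>2 \<le> (\<Sum>k<m. 4 ^ (k + 1) * s\<^sup>2 * indicator (?A k) \<omega>)" by (simp only: power2_abs)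
        moreover have "0 \<le> s\<^sup>2" by simp
        ultimately show ?thesis by linarith
      qed
    qed
  qed
  also have "\<dots> = s\<^sup>2 + (\<Sum>k<m. 4 ^ (k + 1) * s\<^sup>2 * q (2 ^ k * s))"
  proof -
    have iI: "integrable M (\<lambda>\<omega>. 4 ^ (k + 1) * s\<^sup>2 * indicator (?A k) \<omega>)" for k
      by (intro integrable_mult_right integrable_real_indicator) (auto simp: emeasure_eq_measure)
    have "expectation (\<lambda>\<omega>. 4 ^ (k + 1) * s\<^sup>2 * indicator (?A k) \<omega>) = 4 ^ (k + 1) * s\<^sup>2 * q (2 ^ k * s)" for k
    proof -
      have "?A k \<inter> space M = ?A k" by auto
      then show ?thesis
        unfolding q_def by (simp only: integral_mult_right_zero Bochner_Integration.integral_indicator)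
    qed
    moreover have "expectation (\<lambda>\<omega>. s\<^sup>2 + (\<Sum>k<m. 4 ^ (k + 1) * s\<^sup>2 * indicator (?A k) \<omega>))
        = expectation (\<lambda>\<omega>. s\<^sup>2) + expectation (\<lambda>\<omega>. \<Sum>k<m. 4 ^ (k + 1) * s\<^sup>2 * indicator (?A k) \<omega>)"
      by (rule Bochner_Integration.integral_add) (intro integrable_const Bochner_Integration.integrable_sum iI)+
    moreover have "expectation (\<lambda>\<omega>. \<Sum>k<m. 4 ^ (k + 1) * s\<^sup>2 * indicator (?A k) \<omega>)
        = (\<Sum>k<m. expectation (\<lambda>\<omega>. 4 ^ (k + 1) * s\<^sup>2 * indicator (?A k) \<omega>))"
      by (rule Bochner_Integration.integral_sum) (rule iI)
    ultimately show ?thesis by (simp only: prob_space lebesgue_integral_const real_scaleR_def mult_1)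
  qed
  also have "\<dots> \<le> s\<^sup>2 + (\<Sum>k<m. s\<^sup>2 * (64 * (1 / 2) ^ k))"
  proof (intro add_left_mono sum_mono)
    fix k
    have "4 ^ (k + 1) * s\<^sup>2 * q (2 ^ k * s) \<le> 4 ^ (k + 1) * s\<^sup>2 * (1 / 2) ^ (2 ^ k)"
      using qk[of k] by (intro mult_left_mono) auto
    also have "\<dots> = s\<^sup>2 * (4 ^ (k + 1) * (1 / 2) ^ (2 ^ k))" by simp
    also have "\<dots> \<le> s\<^sup>2 * (64 * (1 / 2) ^ k)" by (intro mult_left_mono geometric_tail_weight) auto
    finally show "4 ^ (k + 1) * s\<^sup>2 * q (2 ^ k * s) \<le> s\<^sup>2 * (64 * (1 / 2) ^ k)" .
  qed
  also have "(\<Sum>k<m. s\<^sup>2 * (64 * (1 / 2) ^ k)) = s\<^sup>2 * 64 * (\<Sum>k<m. (1 / 2) ^ k)"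
    by (simp add: sum_distrib_left mult.assoc)
  also have "(\<Sum>k<m. (1 / 2 :: real) ^ k) \<le> 2"
  proof -
    have "(\<Sum>k<m. (1 / 2 :: real) ^ k) = 2 - 2 * (1 / 2) ^ m"
      by (induction m) auto
    then show ?thesis by simp
  qed
  \<comment> \<open>The total is 129 s^2 with s = 2 E|X|, whence 516 = 4 * 129.\<close>
  finally have "expectation (\<lambda>\<omega>. (X \<omega>)\<^sup>2) \<le> s\<^sup>2 + s\<^sup>2 * 64 * 2"
    using s by (simp add: mult_left_mono)
  then show ?thesis by (simp add: s_def power_mult_distrib)
qed

text \<open>Comparison with the centred Gaussian density of variance \<delta>, which has mass 1. The
  value of \<delta> makes 1 / sqrt(2 pi \<delta>) equal to 2 exp(1/2), so on the ball the density is
  at least (2 exp(1/2))^n exp(-n/2) = 2^n.\<close>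

lemma emeasure_ball_le:
  defines "\<delta> \<equiv> 1 / (8 * pi * exp 1)"
  shows "emeasure (lborel_Rn n) {x. inner_Rn n x x \<le> \<delta> * real n} \<le> ennreal (1 / 2 ^ n)"
proof -
  have \<delta>: "0 < \<delta>" by (simp add: \<delta>_def)
  define \<sigma> where "\<sigma> = sqrt \<delta>"
  have \<sigma>: "0 < \<sigma>" "\<sigma>\<^sup>2 = \<delta>" using \<delta> by (simp_all add: \<sigma>_def)
  let ?B = "{x. inner_Rn n x x \<le> \<delta> * real n}"
  have B [measurable]: "?B \<in> sets (lborel_Rn n)"
    by simp
  have sq: "1 / sqrt (2 * pi * \<sigma>\<^sup>2) = 2 * exp (1 / 2)"
  proof -
    have "2 * pi * \<sigma>\<^sup>2 = 1 / (4 * exp 1)" by (simp add: \<sigma>(2) \<delta>_def)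
    also have "\<dots> = (1 / (2 * exp (1 / 2)))\<^sup>2"
      by (simp add: power_divide power_mult_distrib power2_eq_square[of "exp _"] mult_exp_exp)
    finally have "sqrt (2 * pi * \<sigma>\<^sup>2) = 1 / (2 * exp (1 / 2))" by (simp only:) (simp add: real_sqrt_unique)
    then show ?thesis by simp
  qed
  have dens: "2 ^ n \<le> (\<Prod>i<n. normal_density 0 \<sigma> (x i))" if "x \<in> ?B" for x
  proof -
    have "(\<Prod>i<n. normal_density 0 \<sigma> (x i)) = (2 * exp (1 / 2)) ^ n * exp (\<Sum>i<n. - (x i)\<^sup>2 / (2 * \<sigma>\<^sup>2))"
      unfolding normal_density_def prod.distrib exp_sum[OF finite_lessThan] sq by simp
    also have "(\<Sum>i<n. - (x i)\<^sup>2 / (2 * \<sigma>\<^sup>2)) = - inner_Rn n x x / (2 * \<delta>)"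
      unfolding \<sigma>(2) by (simp add: inner_Rn_def sum_negf sum_divide_distrib power2_eq_square)
    also have "(2 * exp (1 / 2)) ^ n * exp (- inner_Rn n x x / (2 * \<delta>)) \<ge> (2 * exp (1 / 2)) ^ n * exp (- (real n / 2))"
      using that \<delta> by (intro mult_left_mono) (auto simp: field_simps)
    also have "(2 * exp (1 / 2)) ^ n * exp (- (real n / 2)) = (2::real) ^ n"
      by (simp add: power_mult_distrib exp_of_nat_mult[symmetric] mult.assoc mult_exp_exp)
    finally show ?thesis .
  qed
  have "ennreal (2 ^ n) * emeasure (lborel_Rn n) ?B = (\<integral>\<^sup>+x. ennreal (2 ^ n) * indicator ?B x \<partial>lborel_Rn n)"
    by (simp add: nn_integral_cmult_indicator)
  also have "\<dots> \<le> (\<integral>\<^sup>+x. (\<Prod>i<n. ennreal (normal_density 0 \<sigma> (x i))) \<partial>lborel_Rn n)"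
  proof (rule nn_integral_mono)
    fix x
    show "ennreal (2 ^ n) * indicator ?B x \<le> (\<Prod>i<n. ennreal (normal_density 0 \<sigma> (x i)))"
      using dens[of x] by (cases "x \<in> ?B") (auto simp: prod_ennreal intro!: ennreal_leI)
  qed
  also have "\<dots> = 1"
    using nn_integral_lborel_Rn_prod[of n "\<lambda>_ t. ennreal (normal_density 0 \<sigma> t)"] \<sigma>
    by (simp add: nn_integral_normal_density)
  finally have le: "ennreal (2 ^ n) * emeasure (lborel_Rn n) ?B \<le> 1" .
  have "emeasure (lborel_Rn n) ?B = ennreal (1 / 2 ^ n) * (ennreal (2 ^ n) * emeasure (lborel_Rn n) ?B)"
    by (simp add: mult.assoc[symmetric] ennreal_mult[symmetric])
  also have "\<dots> \<le> ennreal (1 / 2 ^ n) * 1" using le by (intro mult_left_mono) auto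
  finally show ?thesis by simp
qed

section \<open>Support functions of unconditional isotropic bodies\<close>

definition unif_Rn :: "nat \<Rightarrow> (nat \<Rightarrow> real) set \<Rightarrow> (nat \<Rightarrow> real) measure"
  where "unif_Rn n K = density (lborel_Rn n) (\<lambda>x. ennreal (indicator K x))"

lemma sets_unif_Rn [simp, measurable_cong]: "sets (unif_Rn n K) = sets borel"
  by (simp add: unif_Rn_def)

lemma space_unif_Rn [simp]: "space (unif_Rn n K) = UNIV"
  by (simp add: unif_Rn_def)

lemma emeasure_unif_Rn:
  assumes [measurable]: "K \<in> sets borel" "A \<in> sets borel"
  shows "emeasure (unif_Rn n K) A = emeasure (lborel_Rn n) (K \<inter> A)"
proof -
  have "(\<integral>\<^sup>+x. ennreal (indicator K x) * indicator A x \<partial>lborel_Rn n) = (\<integral>\<^sup>+x. indicator (K \<inter> A) x \<partial>lborel_Rn n)"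
    by (intro nn_integral_cong) (auto split: split_indicator)
  then show ?thesis by (simp add: unif_Rn_def emeasure_density)
qed

lemma prob_space_unif_Rn: "K \<in> sets borel \<Longrightarrow> emeasure (lborel_Rn n) K = 1 \<Longrightarrow> prob_space (unif_Rn n K)"
  by (rule prob_spaceI) (simp add: emeasure_unif_Rn)

lemma AE_unif_Rn: "K \<in> sets borel \<Longrightarrow> AE x in unif_Rn n K. x \<in> K"
  unfolding unif_Rn_def by (subst AE_density) (auto split: split_indicator)

lemma integral_unif_Rn:
  fixes f :: "(nat \<Rightarrow> real) \<Rightarrow> real"
  assumes "K \<in> sets borel" "f \<in> borel_measurable borel"
  shows "(\<integral>x. f x \<partial>unif_Rn n K) = (LINT x:K|lborel_Rn n. f x)"
  using assms unfolding unif_Rn_def set_lebesgue_integral_def by (subst integral_density) auto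

lemma norm_unit_Rn: "i < n \<Longrightarrow> norm_Rn n (unit_Rn i) = 1"
  using inner_Rn_unit_left[of i n "unit_Rn i"]
  by (simp add: norm_Rn_eq_sqrt) (simp add: unit_Rn_def)

text \<open>The signs of x may be chosen to match those of \<theta> without leaving K.\<close>

lemma unconditional_l1_le_supp:
  assumes K: "compact K" "convex K" "unconditional n K" "K \<subseteq> Rn n" and x: "x \<in> K"
  shows "(\<Sum>i<n. \<bar>\<theta> i\<bar> * \<bar>x i\<bar>) \<le> supp_Rn n K \<theta>"
proof -
  let ?y = "\<lambda>i. if i < n then (if 0 \<le> \<theta> i then \<bar>x i\<bar> else - \<bar>x i\<bar>) else 0"
  have "?y \<in> K"
    by (rule unconditional_solid[OF K(2,3) x]) (use x K(4) in \<open>auto simp: mem_Rn\<close>)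
  then have "inner_Rn n ?y \<theta> \<le> supp_Rn n K \<theta>" by (rule inner_le_supp[OF K(1)])
  also have "inner_Rn n ?y \<theta> = (\<Sum>i<n. \<bar>\<theta> i\<bar> * \<bar>x i\<bar>)"
    unfolding inner_Rn_def by (intro sum.cong) auto
  finally show ?thesis .
qed

lemma unc_isotropic_supp_ge:
  assumes n: "0 < n" and K: "K \<in> unc_isotropic n"
  shows "sqrt (1 / (8 * pi * exp 1) / 1032) * l1_Rn n \<theta> \<le> supp_Rn n K \<theta>"
proof -
  define \<delta> where "\<delta> = (1 / (8 * pi * exp 1) :: real)"
  have \<delta>: "0 < \<delta>" by (simp add: \<delta>_def)
  have iso: "isotropic n K" and unc: "unconditional n K" using K by (auto simp: unc_isotropic_def)
  then have cb: "convex_body n K" and vol: "emeasure (lborel_Rn n) K = 1" by (auto simp: isotropic_def)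
  note Kc = convex_body_facts[OF cb]
  have Kb [measurable]: "K \<in> sets borel" using compact_imp_closed[OF Kc(1)] by simp
  let ?P = "unif_Rn n K"
  interpret P: prob_space ?P by (rule prob_space_unif_Rn[OF Kb vol])
  obtain R where R: "R \<ge> 0" "\<forall>x\<in>K. norm_Rn n x \<le> R" using compact_norm_Rn_bounded[OF Kc(1)] by blast
  have bnd: "AE x in ?P. \<bar>x i\<bar> \<le> R" if "i < n" for i
    using AE_unif_Rn[OF Kb]
  proof eventually_elim
    case (elim x)
    have "\<bar>inner_Rn n (unit_Rn i) x\<bar> \<le> norm_Rn n (unit_Rn i) * norm_Rn n x" by (rule Cauchy_Schwarz_Rn)
    then show ?case using R elim that by (fastforce simp: norm_unit_Rn)
  qed
  have intabs: "integrable ?P (\<lambda>x. \<bar>x i\<bar>)" if "i < n" for i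
    by (rule P.integrable_const_bound[of _ R]) (use bnd[OF that] in auto)
  have intsq: "integrable ?P (\<lambda>x. (x i)\<^sup>2)" if "i < n" for i
  proof (rule P.integrable_const_bound[of _ "R\<^sup>2"])
    show "AE x in ?P. norm ((x i)\<^sup>2) \<le> R\<^sup>2"
      using bnd[OF that]
    proof eventually_elim
      case (elim x)
      then have "\<bar>x i\<bar>\<^sup>2 \<le> R\<^sup>2" by (intro power_mono) auto
      then show ?case by simp
    qed
  qed measurable
  obtain L where L: "0 < L" "\<And>\<theta>. \<theta> \<in> Rn n \<Longrightarrow> norm_Rn n \<theta> = 1 \<Longrightarrow> (LINT x:K|lborel_Rn n. (inner_Rn n x \<theta>)\<^sup>2) = L\<^sup>2"
    using iso by (auto simp: isotropic_def)
  have second: "P.expectation (\<lambda>x. (x i)\<^sup>2) = L\<^sup>2" if "i < n" for i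
  proof -
    have "P.expectation (\<lambda>x. (x i)\<^sup>2) = (LINT x:K|lborel_Rn n. (inner_Rn n x (unit_Rn i))\<^sup>2)"
      using that by (subst integral_unif_Rn[OF Kb]) auto
    then show ?thesis using L(2)[of "unit_Rn i"] that norm_unit_Rn by simp
  qed
  \<comment> \<open>The ball of squared radius \<delta> n carries at most half of the mass, so
    Markov for |x|^2, whose expectation is n L^2, bounds L^2 from below.\<close>
  have L2: "\<delta> / 2 \<le> L\<^sup>2"
  proof -
    have e: "P.expectation (\<lambda>x. inner_Rn n x x) = real n * L\<^sup>2"
      unfolding inner_Rn_def using intsq second
      by (subst Bochner_Integration.integral_sum) (auto simp: power2_eq_square)
    have ii: "integrable ?P (\<lambda>x. inner_Rn n x x)"
      unfolding inner_Rn_def using intsq by (intro Bochner_Integration.integrable_sum) (auto simp: power2_eq_square)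
    let ?B = "{x. inner_Rn n x x \<le> \<delta> * real n}"
    have Bm: "?B \<in> sets borel" by measurable
    have "emeasure ?P ?B \<le> emeasure (lborel_Rn n) ?B"
      unfolding emeasure_unif_Rn[OF Kb Bm] using Bm by (intro emeasure_mono) auto
    also have "\<dots> \<le> ennreal (1 / 2 ^ n)" unfolding \<delta>_def by (rule emeasure_ball_le)
    also have "\<dots> \<le> ennreal (1 / 2)"
    proof (rule ennreal_leI)
      have "(2::real) ^ 1 \<le> 2 ^ n" using n by (intro power_increasing) auto
      then show "1 / 2 ^ n \<le> (1 / 2 :: real)" by (simp add: field_simps)
    qed
    finally have "ennreal (P.prob ?B) \<le> ennreal (1 / 2)" by (simp only: P.emeasure_eq_measure)
    then have "P.prob ?B \<le> 1 / 2" by (subst (asm) ennreal_le_iff) auto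
    moreover have "P.prob {x. \<not> inner_Rn n x x \<le> \<delta> * real n} = 1 - P.prob ?B"
      using P.prob_compl[of ?B] Bm by (simp add: Compl_eq_Diff_UNIV[symmetric] Collect_neg_eq)
    moreover have "P.prob {x. \<not> inner_Rn n x x \<le> \<delta> * real n} \<le> P.prob {x \<in> space ?P. \<delta> * real n \<le> inner_Rn n x x}"
      by (intro P.finite_measure_mono) auto
    moreover have "P.prob {x \<in> space ?P. \<delta> * real n \<le> inner_Rn n x x} \<le> P.expectation (\<lambda>x. inner_Rn n x x) / (\<delta> * real n)"
      using \<delta> n by (intro integral_Markov_inequality_measure[OF ii, where A="{}"]) (auto simp: inner_Rn_self_nonneg)
    ultimately have "1 / 2 \<le> real n * L\<^sup>2 / (\<delta> * real n)" unfolding e by linarith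
    then show ?thesis using \<delta> n by (simp add: field_simps)
  qed
  \<comment> \<open>1032 = 2 * 516: the 2 comes from L^2 \<ge> \<delta> / 2 and 516 from the
    comparison of moments.\<close>
  have first: "sqrt (\<delta> / 1032) \<le> P.expectation (\<lambda>x. \<bar>x i\<bar>)" if i: "i < n" for i
  proof -
    let ?a = "P.expectation (\<lambda>x. \<bar>x i\<bar>)"
    have a0: "0 \<le> ?a" by (intro Bochner_Integration.integral_nonneg) auto
    have "?a \<noteq> 0"
    proof
      assume "?a = 0"
      then have "AE x in ?P. \<bar>x i\<bar> = 0"
        using integral_nonneg_eq_0_iff_AE[OF intabs[OF i]] by simp
      then have "AE x in ?P. (x i)\<^sup>2 = 0" by eventually_elim simp
      then have "P.expectation (\<lambda>x. (x i)\<^sup>2) = P.expectation (\<lambda>_. 0)" by (intro integral_cong_AE) auto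
      then show False using second[OF i] L(1) by simp
    qed
    then have pos: "0 < ?a" using a0 by linarith
    have Am: "{x :: nat \<Rightarrow> real. t \<le> x i \<or> x i < - t} \<in> sets borel" for t by measurable
    have q: "P.prob {x \<in> space ?P. 2 * t \<le> x i \<or> x i < - (2 * t)} \<le> (P.prob {x \<in> space ?P. t \<le> x i \<or> x i < - t})\<^sup>2"
      if t: "0 \<le> t" for t
    proof -
      have N: "(\<integral>\<^sup>+x. indicator K (shift_abs n i s x) \<partial>lborel_Rn n) = ennreal (P.prob {x. s \<le> x i \<or> x i < - s})" if "0 \<le> s" for s
        using unconditional_shift_eq_tail[OF Kc(1,2) unc i that] emeasure_unif_Rn[OF Kb Am, of n s]
        by (simp add: P.emeasure_eq_measure)
      have "{x :: nat \<Rightarrow> real. 0 \<le> x i \<or> x i < - 0} = UNIV" by auto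
      then have N0: "(\<integral>\<^sup>+x. indicator K (shift_abs n i 0 x) \<partial>lborel_Rn n) = 1"
        using N[of 0] P.prob_space by simp
      have "ennreal (P.prob {x. 2 * t \<le> x i \<or> x i < - (2 * t)})
          \<le> ennreal (P.prob {x. t \<le> x i \<or> x i < - t}) * ennreal (P.prob {x. t \<le> x i \<or> x i < - t})"
        using unconditional_shift_log_concave[OF Kc(1,2) unc Kc(4) t, of i] t by (simp add: N N0)
      then show ?thesis by (simp add: ennreal_mult[symmetric] power2_eq_square)
    qed
    have "L\<^sup>2 \<le> 516 * ?a\<^sup>2"
      using P.second_moment_le_first_moment[of "\<lambda>x. x i" R, OF _ bnd[OF i] q pos] second[OF i] by simp
    then have "\<delta> / 1032 \<le> ?a\<^sup>2" using L2 by simp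
    then show ?thesis using a0 by (simp add: real_le_lsqrt)
  qed
  have "sqrt (\<delta> / 1032) * l1_Rn n \<theta> = (\<Sum>i<n. \<bar>\<theta> i\<bar> * sqrt (\<delta> / 1032))"
    by (subst mult.commute) (simp add: l1_Rn_def sum_distrib_right)
  also have "\<dots> \<le> (\<Sum>i<n. \<bar>\<theta> i\<bar> * P.expectation (\<lambda>x. \<bar>x i\<bar>))"
    using first by (intro sum_mono mult_left_mono) auto
  also have "\<dots> = P.expectation (\<lambda>x. \<Sum>i<n. \<bar>\<theta> i\<bar> * \<bar>x i\<bar>)"
    using intabs by (subst Bochner_Integration.integral_sum) auto
  also have "\<dots> \<le> P.expectation (\<lambda>_. supp_Rn n K \<theta>)"
  proof (rule integral_mono_AE)
    show "AE x in ?P. (\<Sum>i<n. \<bar>\<theta> i\<bar> * \<bar>x i\<bar>) \<le> supp_Rn n K \<theta>"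
      using AE_unif_Rn[OF Kb] by eventually_elim (rule unconditional_l1_le_supp[OF Kc(1,2) unc Kc(4)])
  qed (use intabs in auto)
  also have "\<dots> = supp_Rn n K \<theta>" using P.prob_space by simp
  finally show ?thesis by (simp add: \<delta>_def)
qed

section \<open>The cube as a member of the class\<close>

lemma convex_body_unit_cube: "convex_body n (unit_cube n)"
  unfolding convex_body_def
proof (intro conjI)
  define S :: "nat \<Rightarrow> real set" where "S i = (if i < n then {-1/2..1/2} else {0})" for i
  have "x \<in> unit_cube n \<longleftrightarrow> (\<forall>i. x i \<in> S i)" for x
  proof
    assume "\<forall>i. x i \<in> S i"
    then have xi: "x i \<in> S i" for i by blast
    have "-1/2 \<le> x i \<and> x i \<le> 1/2" if "i < n" for i using xi[of i] that by (simp add: S_def)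
    moreover have "x i = 0" if "n \<le> i" for i using xi[of i] that by (simp add: S_def)
    ultimately show "x \<in> unit_cube n" unfolding unit_cube_def mem_Rn by blast
  next
    assume x: "x \<in> unit_cube n"
    show "\<forall>i. x i \<in> S i"
    proof
      fix i show "x i \<in> S i" using x by (cases "i < n") (auto simp: unit_cube_def mem_Rn S_def)
    qed
  qed
  then have "unit_cube n = Pi\<^sub>E UNIV S" by (simp add: set_eq_iff PiE_UNIV_domain Pi_iff)
  moreover have "compactin (powertop_real UNIV) (Pi\<^sub>E UNIV S)"
    by (simp add: compactin_PiE compactin_euclidean_iff S_def)
  ultimately have "compactin (powertop_real UNIV) (unit_cube n)" by simp
  moreover have "unit_cube n \<subseteq> {x. \<forall>i\<ge>n. x i = 0}" by (auto simp: unit_cube_def mem_Rn)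
  ultimately show "compactin (Euclidean_space n) (unit_cube n)"
    unfolding Euclidean_space_def compactin_subtopology by blast
  show "convex (unit_cube n)"
    unfolding convex_def
  proof (intro ballI allI impI)
    fix x y :: "nat \<Rightarrow> real" and u v :: real
    assume xy: "x \<in> unit_cube n" "y \<in> unit_cube n" and uv: "0 \<le> u" "0 \<le> v" "u + v = 1"
    have "u * x i + v * y i \<le> 1 / 2 \<and> - 1 / 2 \<le> u * x i + v * y i" if "i < n" for i
    proof -
      have b: "- 1 / 2 \<le> x i" "x i \<le> 1 / 2" "- 1 / 2 \<le> y i" "y i \<le> 1 / 2" using xy that by (auto simp: unit_cube_def)
      have "u * x i + v * y i \<le> u * (1 / 2) + v * (1 / 2)" using b uv by (intro add_mono mult_left_mono) auto
      moreover have "u * (- 1 / 2) + v * (- 1 / 2) \<le> u * x i + v * y i" using b uv by (intro add_mono mult_left_mono) auto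
      ultimately show ?thesis using uv by (simp add: field_simps)
    qed
    then show "u *\<^sub>R x + v *\<^sub>R y \<in> unit_cube n"
      using xy by (auto simp: unit_cube_def mem_Rn)
  qed
  let ?U = "\<Inter>i\<in>{..<n}. {x :: nat \<Rightarrow> real. - 1 / 2 < x i \<and> x i < 1 / 2}"
  have "open ?U"
    by (intro open_INT ballI open_Collect_conj open_Collect_less continuous_intros) auto
  then have "openin (Euclidean_space n) (?U \<inter> Rn n)"
    unfolding Euclidean_space_def topspace_subtopology
    by (auto simp: openin_subtopology euclidean_product_topology open_openin[symmetric])
  moreover have "?U \<inter> Rn n \<subseteq> unit_cube n" by (auto simp: unit_cube_def less_imp_le)
  ultimately have "?U \<inter> Rn n \<subseteq> Euclidean_space n interior_of unit_cube n" by (rule interior_of_maximal[rotated])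
  moreover have "0 \<in> ?U \<inter> Rn n" by (auto simp: mem_Rn)
  ultimately show "Euclidean_space n interior_of unit_cube n \<noteq> {}" by blast
qed

lemma unconditional_unit_cube: "unconditional n (unit_cube n)"
  unfolding unconditional_def
proof (intro ballI)
  fix x \<epsilon> assume x: "x \<in> unit_cube n" and \<epsilon>: "\<epsilon> \<in> {..<n} \<rightarrow> {-1, 1 :: real}"
  have "- 1 / 2 \<le> \<epsilon> i * x i \<and> \<epsilon> i * x i \<le> 1 / 2" if "i < n" for i
  proof -
    have "\<epsilon> i = -1 \<or> \<epsilon> i = 1" using \<epsilon> that by auto
    moreover have "- 1 / 2 \<le> x i" "x i \<le> 1 / 2" using x that by (auto simp: unit_cube_def)
    ultimately show ?thesis by auto
  qed
  then show "(\<lambda>i. \<epsilon> i * x i) \<in> unit_cube n" using x by (auto simp: unit_cube_def mem_Rn)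
qed

lemma nn_integral_unit_cube_prod:
  assumes "\<And>i. i < n \<Longrightarrow> f i \<in> borel_measurable borel"
  shows "(\<integral>\<^sup>+x. indicator (unit_cube n) x * (\<Prod>i<n. f i (x i)) \<partial>lborel_Rn n)
    = (\<Prod>i<n. \<integral>\<^sup>+t. indicator {-1/2..1/2} t * f i t \<partial>lborel)"
proof -
  have ind: "indicator (unit_cube n) x = (\<Prod>i<n. indicator {-1/2..1/2} (x i) :: ennreal)" if x: "x \<in> Rn n" for x
  proof (cases "x \<in> unit_cube n")
    case False
    then obtain i where "i < n" "x i \<notin> {-1/2..1/2}" using x by (auto simp: unit_cube_def)
    then have "(\<Prod>i<n. indicator {-1/2..1/2} (x i) :: ennreal) = 0"
      by (intro prod_zero bexI[of _ i]) (auto simp: indicator_def)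
    then show ?thesis using False by simp
  qed (auto simp: unit_cube_def)
  have "(\<integral>\<^sup>+x. indicator (unit_cube n) x * (\<Prod>i<n. f i (x i)) \<partial>lborel_Rn n)
      = (\<integral>\<^sup>+x. (\<Prod>i<n. indicator {-1/2..1/2} (x i) * f i (x i)) \<partial>lborel_Rn n)"
    by (intro nn_integral_lborel_Rn_cong) (simp add: ind prod.distrib)
  also have "\<dots> = (\<Prod>i<n. \<integral>\<^sup>+t. indicator {-1/2..1/2} t * f i t \<partial>lborel)"
    using assms by (intro nn_integral_lborel_Rn_prod) auto
  finally show ?thesis .
qed

lemma distr_lborel_Rn_flip:
  assumes p: "p < n"
  shows "distr (lborel_Rn n) (lborel_Rn n) (\<lambda>x. x(p := - x p)) = lborel_Rn n"
proof (rule measure_eqI)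
  have m: "(\<lambda>x. x(p := - x p)) \<in> lborel_Rn n \<rightarrow>\<^sub>M lborel_Rn n"
    using measurable_fun_upd_coord[of "\<lambda>x. - x p" p] by (simp cong: measurable_cong_sets)
  fix A assume "A \<in> sets (distr (lborel_Rn n) (lborel_Rn n) (\<lambda>x. x(p := - x p)))"
  then have A: "A \<in> sets borel" by simp
  have "emeasure (distr (lborel_Rn n) (lborel_Rn n) (\<lambda>x. x(p := - x p))) A
      = (\<integral>\<^sup>+x. indicator A x \<partial>distr (lborel_Rn n) (lborel_Rn n) (\<lambda>x. x(p := - x p)))"
    using A by simp
  also have "\<dots> = (\<integral>\<^sup>+x. indicator A (x(p := - x p)) \<partial>lborel_Rn n)"
    using A by (intro nn_integral_distr m) simp
  also have "\<dots> = (\<integral>\<^sup>+x. indicator A x \<partial>lborel_Rn n)"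
    using nn_integral_lborel_Rn_shear[of "indicator A" "\<lambda>_. 0" p n "-1"] A p by simp
  finally show "emeasure (distr (lborel_Rn n) (lborel_Rn n) (\<lambda>x. x(p := - x p))) A = emeasure (lborel_Rn n) A"
    using A by simp
qed simp

lemma integral_lborel_Rn_odd:
  fixes g :: "(nat \<Rightarrow> real) \<Rightarrow> real"
  assumes g: "g \<in> borel_measurable borel" and p: "p < n" and odd: "\<And>x. g (x(p := - x p)) = - g x"
  shows "(\<integral>x. g x \<partial>lborel_Rn n) = 0"
proof -
  have m: "(\<lambda>x. x(p := - x p)) \<in> lborel_Rn n \<rightarrow>\<^sub>M lborel_Rn n"
    using measurable_fun_upd_coord[of "\<lambda>x. - x p" p] by (simp cong: measurable_cong_sets)
  have "(\<integral>x. g x \<partial>lborel_Rn n) = (\<integral>x. g x \<partial>distr (lborel_Rn n) (lborel_Rn n) (\<lambda>x. x(p := - x p)))"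
    by (simp only: distr_lborel_Rn_flip[OF p])
  also have "\<dots> = (\<integral>x. g (x(p := - x p)) \<partial>lborel_Rn n)"
    using g by (intro integral_distr m) (simp cong: measurable_cong_sets)
  also have "\<dots> = - (\<integral>x. g x \<partial>lborel_Rn n)" by (simp add: odd)
  finally show ?thesis by simp
qed

lemma unit_cube_flip: "x(p := - x p) \<in> unit_cube n \<longleftrightarrow> x \<in> unit_cube n"
proof -
  have "x(p := - x p) \<in> unit_cube n" if "x \<in> unit_cube n" for x
  proof -
    have "(\<lambda>i. (if i = p then -1 else 1) * x i) \<in> unit_cube n"
      using unconditional_unit_cube[of n] that
      unfolding unconditional_def by (elim ballE[of _ _ x] ballE) auto
    also have "(\<lambda>i. (if i = p then -1 else 1) * x i) = x(p := - x p)" by auto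
    finally show ?thesis .
  qed
  from this[of x] this[of "x(p := - x p)"] show ?thesis by auto
qed

text \<open>Flipping one coordinate kills the barycenter and the mixed moments; the remaining
  moments are 1/12, so the covariance is a multiple of the identity. Membership in the class makes
  the infimum over all bodies at most the value of the cube.\<close>

lemma unit_cube_unc_isotropic: "unit_cube n \<in> unc_isotropic n"
proof -
  let ?Q = "unit_cube n"
  note cb = convex_body_unit_cube[of n]
  note Kc = convex_body_facts[OF cb]
  have Kb [measurable]: "?Q \<in> sets borel" using compact_imp_closed[OF Kc(1)] by simp
  have vol: "emeasure (lborel_Rn n) ?Q = 1"
    using nn_integral_unit_cube_prod[of n "\<lambda>_ _. 1"] by simp
  interpret P: prob_space "unif_Rn n ?Q" by (rule prob_space_unif_Rn[OF Kb vol])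
  have bnd: "AE x in unif_Rn n ?Q. \<bar>x i\<bar> \<le> 1" if "i < n" for i
    using AE_unif_Rn[OF Kb] by eventually_elim (use that in \<open>force simp: unit_cube_def abs_le_iff\<close>)
  have intij: "integrable (unif_Rn n ?Q) (\<lambda>x. x i * x j)" if "i < n" "j < n" for i j
  proof (rule P.integrable_const_bound[of _ 1])
    show "AE x in unif_Rn n ?Q. norm (x i * x j) \<le> 1"
      using bnd[OF that(1)] bnd[OF that(2)]
    proof eventually_elim
      case (elim x)
      then show ?case by (simp add: abs_mult mult_le_one)
    qed
  qed measurable
  have bary: "(LINT x:?Q|lborel_Rn n. x i) = 0" if "i < n" for i
    unfolding set_lebesgue_integral_def
    using that unit_cube_flip[of _ i n] by (intro integral_lborel_Rn_odd[OF _ that]) (auto simp: indicator_def)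
  have off: "P.expectation (\<lambda>x. x i * x j) = 0" if "i < n" "j < n" "i \<noteq> j" for i j
    unfolding integral_unif_Rn[OF Kb borel_measurable_times[OF measurable_fun_coord measurable_fun_coord]] set_lebesgue_integral_def
    using that unit_cube_flip[of _ i n] by (intro integral_lborel_Rn_odd[OF _ that(1)]) (auto simp: indicator_def)
  have diag: "P.expectation (\<lambda>x. x i * x i) = 1 / 12" if i: "i < n" for i
  proof -
    have w: "(\<integral>\<^sup>+t. indicator {-1/2..1/2} t * ennreal (t\<^sup>2) \<partial>lborel) = ennreal (1 / 12)"
    proof -
      have "(\<integral>\<^sup>+t. ennreal (t\<^sup>2) * indicator {-1/2..1/2} t \<partial>lborel) = ennreal ((1/2)^3 / 3 - (-1/2)^3 / 3)"
        by (rule nn_integral_FTC_Icc) (auto intro!: derivative_eq_intros)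
      also have "(1/2)^3 / 3 - (-1/2)^3 / 3 = (1 / 12 :: real)" by (simp add: power3_eq_cube)
      finally show ?thesis by (simp add: mult.commute)
    qed
    have "(\<integral>\<^sup>+x. ennreal (x i * x i) \<partial>unif_Rn n ?Q)
        = (\<integral>\<^sup>+x. indicator ?Q x * (\<Prod>j<n. if j = i then ennreal ((x j)\<^sup>2) else 1) \<partial>lborel_Rn n)"
      unfolding unif_Rn_def using i
      by (subst nn_integral_density) (auto intro!: nn_integral_cong simp: prod.delta power2_eq_square split: split_indicator)
    also have "\<dots> = (\<Prod>j<n. \<integral>\<^sup>+t. indicator {-1/2..1/2} t * (if j = i then ennreal (t\<^sup>2) else 1) \<partial>lborel)"
      by (rule nn_integral_unit_cube_prod) measurable
    also have "\<dots> = (\<Prod>j<n. if j = i then ennreal (1 / 12) else 1)"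
      using w by (intro prod.cong) auto
    also have "\<dots> = ennreal (1 / 12)" using i by (simp add: prod.delta)
    finally have e: "(\<integral>\<^sup>+x. ennreal (x i * x i) \<partial>unif_Rn n ?Q) = ennreal (1 / 12)" .
    show ?thesis by (subst integral_eq_nn_integral) (auto simp: e)
  qed
  have second: "(LINT x:?Q|lborel_Rn n. (inner_Rn n x \<theta>)\<^sup>2) = (sqrt (1 / 12))\<^sup>2"
    if "\<theta> \<in> Rn n" "norm_Rn n \<theta> = 1" for \<theta>
  proof -
    have "(LINT x:?Q|lborel_Rn n. (inner_Rn n x \<theta>)\<^sup>2) = P.expectation (\<lambda>x. (inner_Rn n x \<theta>)\<^sup>2)"
      by (rule integral_unif_Rn[symmetric, OF Kb]) measurable
    also have "\<dots> = P.expectation (\<lambda>x. \<Sum>i<n. \<Sum>j<n. \<theta> i * \<theta> j * (x i * x j))"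
      by (simp add: inner_Rn_def power2_eq_square sum_product mult_ac)
    also have "\<dots> = (\<Sum>i<n. P.expectation (\<lambda>x. \<Sum>j<n. \<theta> i * \<theta> j * (x i * x j)))"
      by (rule Bochner_Integration.integral_sum)
        (intro Bochner_Integration.integrable_sum integrable_mult_right intij; simp)
    also have "\<dots> = (\<Sum>i<n. \<Sum>j<n. P.expectation (\<lambda>x. \<theta> i * \<theta> j * (x i * x j)))"
      by (rule sum.cong[OF refl], rule Bochner_Integration.integral_sum)
        (intro integrable_mult_right intij; simp)
    also have "\<dots> = (\<Sum>i<n. \<Sum>j<n. \<theta> i * \<theta> j * P.expectation (\<lambda>x. x i * x j))"
      by (simp only: integral_mult_right_zero)
    also have "\<dots> = (\<Sum>i<n. \<Sum>j<n. if i = j then \<theta> i * \<theta> i / 12 else 0)"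
      using off diag by (intro sum.cong) auto
    also have "\<dots> = inner_Rn n \<theta> \<theta> / 12" by (simp add: inner_Rn_def sum_divide_distrib)
    finally show ?thesis using that(2) by (simp add: inner_Rn_self)
  qed
  have "isotropic n ?Q"
    unfolding isotropic_def using cb vol bary second by (auto intro!: exI[of _ "sqrt (1 / 12)"])
  then show ?thesis using unconditional_unit_cube by (simp add: unc_isotropic_def)
qed

lemma supp_unit_cube_le: "supp_Rn n (unit_cube n) \<theta> \<le> l1_Rn n \<theta> / 2"
proof (rule supp_le)
  show "unit_cube n \<noteq> {}" using convex_body_facts(3)[OF convex_body_unit_cube] .
  fix z assume z: "z \<in> unit_cube n"
  have "inner_Rn n z \<theta> \<le> (\<Sum>i<n. \<bar>z i\<bar> * \<bar>\<theta> i\<bar>)"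
    unfolding inner_Rn_def by (intro sum_mono) (metis abs_ge_self abs_mult)
  also have "\<dots> \<le> (\<Sum>i<n. 1 / 2 * \<bar>\<theta> i\<bar>)"
    using z by (intro sum_mono mult_right_mono) (auto simp: unit_cube_def abs_le_iff)
  finally show "inner_Rn n z \<theta> \<le> l1_Rn n \<theta> / 2" by (simp add: l1_Rn_def sum_divide_distrib)
qed

section \<open>Vectors of small \<open>\<ell>\<^sub>1\<close>-norm in every subspace\<close>

lemma nn_integral_lborel_Rn_affine:
  assumes [measurable]: "f \<in> borel_measurable borel" and c: "0 < c" and J: "finite J" "J \<subseteq> {..<n}"
  shows "(\<integral>\<^sup>+x. f x \<partial>lborel_Rn n) = ennreal (c ^ card J) * (\<integral>\<^sup>+x. f (\<lambda>j. if j \<in> J then p j + c * x j else x j) \<partial>lborel_Rn n)"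
  using J
proof (induction J rule: finite_induct)
  case (insert i J)
  let ?T = "\<lambda>x l. if l \<in> J then p l + c * x l else x l :: real"
  have [measurable]: "?T \<in> borel_measurable borel"
  proof (rule measurable_coordinatewise_then_product)
    fix i show "(\<lambda>x. ?T x i) \<in> borel_measurable borel" by (cases "i \<in> J") simp_all
  qed
  have i: "i < n" using insert.prems by simp
  have eq: "(\<lambda>l. if l \<in> insert i J then p l + c * x l else x l) = ?T (x(i := p i + c * x i))" for x
    using insert.hyps by (auto simp: fun_eq_iff)
  have one: "(\<integral>\<^sup>+x. g x \<partial>lborel_Rn n) = ennreal c * (\<integral>\<^sup>+x. g (x(i := p i + c * x i)) \<partial>lborel_Rn n)"
    if [measurable]: "g \<in> borel_measurable borel" for g
  proof -
    have "(\<integral>\<^sup>+t. g (y(i := t)) \<partial>lborel) = ennreal c * (\<integral>\<^sup>+t. g (y(i := p i + c * t)) \<partial>lborel)" for y :: "nat \<Rightarrow> real"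
    proof -
      note measurable_fun_upd_value [measurable]
      show ?thesis using nn_integral_real_affine[of "\<lambda>t. g (y(i := t))" c "p i"] c by simp
    qed
    note inner = this
    have m: "(\<lambda>x. \<integral>\<^sup>+t. g ((extend_Rn n x)(i := p i + c * t)) \<partial>lborel) \<in> borel_measurable (Pi\<^sub>M ({..<n} - {i}) (\<lambda>_. lborel))"
    proof -
      have "(\<lambda>(x, t). (extend_Rn n x)(i := p i + c * t)) \<in> borel_measurable (Pi\<^sub>M ({..<n} - {i}) (\<lambda>_. lborel) \<Otimes>\<^sub>M lborel)"
      proof (rule measurable_coordinatewise_then_product)
        fix j
        show "(\<lambda>x. (case x of (x, t) \<Rightarrow> (extend_Rn n x)(i := p i + c * t)) j)
            \<in> borel_measurable (Pi\<^sub>M ({..<n} - {i}) (\<lambda>_. lborel) \<Otimes>\<^sub>M lborel)"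
        proof (cases "j = i \<or> \<not> j < n")
          case True
          then show ?thesis by (cases "j = i") (auto simp: case_prod_beta' extend_Rn_def)
        next
          case False
          then have "(\<lambda>y. y j) \<in> borel_measurable (Pi\<^sub>M ({..<n} - {i}) (\<lambda>_. lborel :: real measure))"
            using measurable_component_singleton[of j "{..<n} - {i}" "\<lambda>_. lborel :: real measure"] by simp
          from measurable_compose[OF measurable_fst this] show ?thesis
            using False by (simp add: case_prod_beta' extend_Rn_def)
        qed
      qed
      from measurable_compose[OF this that]
      show ?thesis by (intro lborel.borel_measurable_nn_integral) (simp add: case_prod_beta')
    qed
    show ?thesis
      by (subst (1 2) nn_integral_lborel_Rn_coord[OF _ i]) (simp_all add: inner[of "extend_Rn n _"] nn_integral_cmult[OF m])
  qed
  have "(\<integral>\<^sup>+x. f x \<partial>lborel_Rn n) = ennreal (c ^ card J) * (\<integral>\<^sup>+x. f (?T x) \<partial>lborel_Rn n)"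
    using insert by simp
  also have "(\<integral>\<^sup>+x. f (?T x) \<partial>lborel_Rn n) = ennreal c * (\<integral>\<^sup>+x. f (?T (x(i := p i + c * x i))) \<partial>lborel_Rn n)"
    by (rule one[where g="\<lambda>x. f (?T x)"]) simp
  finally show ?case
    unfolding eq using insert.hyps c by (simp add: ennreal_mult mult_ac)
qed simp

lemma emeasure_lborel_Rn_affine:
  assumes D: "compact D" "D \<subseteq> Rn n" and p: "p \<in> Rn n" and c: "0 < c"
  shows "(\<lambda>y. p + c *\<^sub>R y) ` D \<in> sets borel"
    and "emeasure (lborel_Rn n) ((\<lambda>y. p + c *\<^sub>R y) ` D) = ennreal (c ^ n) * emeasure (lborel_Rn n) D"
proof -
  let ?A = "(\<lambda>y. p + c *\<^sub>R y) ` D"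
  have cont: "continuous_on UNIV (\<lambda>y. p + c *\<^sub>R y)"
  proof (rule continuous_on_coordinatewise_then_product)
    fix i
    show "continuous_on UNIV (\<lambda>y. (p + c *\<^sub>R y) i)" by (simp, intro continuous_intros) auto
  qed
  have "compact ?A" by (intro compact_continuous_image continuous_on_subset[OF cont] D(1)) auto
  then show A [measurable]: "?A \<in> sets borel" by (intro borel_closed compact_imp_closed)
  have Db [measurable]: "D \<in> sets borel" using compact_imp_closed[OF D(1)] by simp
  have "emeasure (lborel_Rn n) ?A = (\<integral>\<^sup>+x. indicator ?A x \<partial>lborel_Rn n)" by simp
  also have "\<dots> = ennreal (c ^ card {..<n}) * (\<integral>\<^sup>+x. indicator ?A (\<lambda>j. if j \<in> {..<n} then p j + c * x j else x j) \<partial>lborel_Rn n)"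
    by (rule nn_integral_lborel_Rn_affine[OF _ c]) auto
  also have "(\<integral>\<^sup>+x. indicator ?A (\<lambda>j. if j \<in> {..<n} then p j + c * x j else x j) \<partial>lborel_Rn n)
      = (\<integral>\<^sup>+x. indicator D x \<partial>lborel_Rn n)"
  proof (rule nn_integral_lborel_Rn_cong)
    fix x assume x: "x \<in> Rn n"
    have eq: "(\<lambda>j. if j \<in> {..<n} then p j + c * x j else x j) = p + c *\<^sub>R x"
      using x p by (auto simp: mem_Rn fun_eq_iff)
    have "p + c *\<^sub>R x \<in> ?A \<longleftrightarrow> x \<in> D"
    proof
      assume "p + c *\<^sub>R x \<in> ?A"
      then obtain y where y: "y \<in> D" "p + c *\<^sub>R x = p + c *\<^sub>R y" by auto
      then have "c *\<^sub>R x = c *\<^sub>R y" by simp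
      then have "x = y" using c by (simp add: fun_eq_iff)
      then show "x \<in> D" using y by simp
    qed auto
    then show "indicator ?A (\<lambda>j. if j \<in> {..<n} then p j + c * x j else x j) = (indicator D x :: ennreal)"
      unfolding eq by (simp add: indicator_def)
  qed
  finally show "emeasure (lborel_Rn n) ?A = ennreal (c ^ n) * emeasure (lborel_Rn n) D"
    using Db by (simp only: card_lessThan nn_integral_indicator sets_lborel_Rn)
qed

lemma l1_Rn_triangle: "l1_Rn n (x + y) \<le> l1_Rn n x + l1_Rn n y"
  by (simp add: l1_Rn_def sum.distrib[symmetric] sum_mono)

lemma l1_Rn_scaleR: "l1_Rn n (c *\<^sub>R x) = \<bar>c\<bar> * l1_Rn n x"
  by (simp add: l1_Rn_def abs_mult sum_distrib_left)

lemma l1_Rn_diff_le: "l1_Rn n (x - y) \<le> l1_Rn n x + l1_Rn n y"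
  using l1_Rn_triangle[of n x "- y"] by (simp add: l1_Rn_def)

lemma l1_Rn_nonneg: "0 \<le> l1_Rn n x"
  by (simp add: l1_Rn_def sum_nonneg)

lemma l1_Rn_sum_le: "l1_Rn n (\<Sum>i\<in>I. f i) \<le> (\<Sum>i\<in>I. l1_Rn n (f i))"
proof (induction I rule: infinite_finite_induct)
  case (insert i I)
  have "l1_Rn n (f i + sum f I) \<le> l1_Rn n (f i) + (\<Sum>i\<in>I. l1_Rn n (f i))"
    using insert.IH l1_Rn_triangle[of n "f i" "sum f I"] by linarith
  then show ?case unfolding sum.insert[OF insert.hyps] .
qed (simp_all add: l1_Rn_def)

lemma norm_le_l1_Rn: "norm_Rn n x \<le> l1_Rn n x"
  unfolding l1_Rn_def by (rule L2_set_le_sum_abs)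

lemma sum_abs_le_sqrt_card:
  assumes "S \<subseteq> {..<n}"
  shows "(\<Sum>i\<in>S. \<bar>v i\<bar>) \<le> sqrt (real (card S)) * norm_Rn n v"
proof -
  have fin: "finite S" using assms finite_subset by blast
  have "(\<Sum>i\<in>S. \<bar>v i\<bar>) = (\<Sum>i\<in>S. \<bar>1\<bar> * \<bar>v i\<bar>)" by simp
  also have "\<dots> \<le> L2_set (\<lambda>_. 1) S * L2_set v S" by (rule L2_set_mult_ineq)
  also have "L2_set (\<lambda>_. 1) S = sqrt (real (card S))" by (simp add: L2_set_def)
  also have "L2_set v S \<le> norm_Rn n v"
    using assms by (simp add: L2_set_def sum_mono2)
  finally show ?thesis by (simp add: mult_left_mono)
qed

lemma l1_le_sqrt_norm: "l1_Rn n v \<le> sqrt (real n) * norm_Rn n v"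
  using sum_abs_le_sqrt_card[of "{..<n}" n v] by (simp add: l1_Rn_def)

lemma compact_l1_ball: "compact {x \<in> Rn n. l1_Rn n x \<le> 1}"
proof -
  have c2: "compact (unit_cube n)" using convex_body_facts(1)[OF convex_body_unit_cube] .
  have cont: "continuous_on UNIV (\<lambda>y. (2::real) *\<^sub>R (y :: nat \<Rightarrow> real))"
    by (rule continuous_on_coordinatewise_then_product) (simp, intro continuous_intros, auto)
  have "compact ((\<lambda>y. (2::real) *\<^sub>R y) ` unit_cube n)"
    by (intro compact_continuous_image continuous_on_subset[OF cont] c2) auto
  moreover have "closed {x. l1_Rn n x \<le> 1}"
    unfolding l1_Rn_def by (intro closed_Collect_le continuous_intros) auto
  ultimately have "compact ((\<lambda>y. (2::real) *\<^sub>R y) ` unit_cube n \<inter> {x. l1_Rn n x \<le> 1})"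
    by (rule compact_Int_closed)
  also have "(\<lambda>y. (2::real) *\<^sub>R y) ` unit_cube n \<inter> {x. l1_Rn n x \<le> 1} = {x \<in> Rn n. l1_Rn n x \<le> 1}"
  proof (intro set_eqI iffI)
    fix x assume "x \<in> (\<lambda>y. (2::real) *\<^sub>R y) ` unit_cube n \<inter> {x. l1_Rn n x \<le> 1}"
    then show "x \<in> {x \<in> Rn n. l1_Rn n x \<le> 1}" by (auto simp: unit_cube_def mem_Rn)
  next
    fix x assume x: "x \<in> {x \<in> Rn n. l1_Rn n x \<le> 1}"
    have "\<bar>x i\<bar> \<le> 1" if "i < n" for i
    proof -
      have "\<bar>x i\<bar> \<le> l1_Rn n x" unfolding l1_Rn_def using that by (intro member_le_sum) auto
      then show ?thesis using x by simp
    qed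
    then have "(1 / 2) *\<^sub>R x \<in> unit_cube n" using x by (auto simp: unit_cube_def mem_Rn abs_le_iff)
    moreover have "x = 2 *\<^sub>R (1 / 2) *\<^sub>R x" by (simp add: fun_eq_iff)
    ultimately show "x \<in> (\<lambda>y. (2::real) *\<^sub>R y) ` unit_cube n \<inter> {x. l1_Rn n x \<le> 1}" using x by blast
  qed
  finally show ?thesis .
qed

text \<open>The quotient of R^n by F = \<open>orth_comp_Rn n d u\<close>, in the coordinates given
  by the first d frame vectors; on \<open>Rn n\<close> its kernel is F.\<close>

definition trunc_map :: "nat \<Rightarrow> nat \<Rightarrow> (nat \<Rightarrow> nat \<Rightarrow> real) \<Rightarrow> (nat \<Rightarrow> real) \<Rightarrow> nat \<Rightarrow> real"
  where "trunc_map n d u x = (\<lambda>i. if i < d then inner_Rn n (u i) x else 0)"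

lemma trunc_map_mem [simp]: "trunc_map n d u x \<in> Rn d"
  by (simp add: trunc_map_def mem_Rn)

lemma trunc_map_add: "trunc_map n d u (x + y) = trunc_map n d u x + trunc_map n d u y"
  by (auto simp: trunc_map_def inner_Rn_simps fun_eq_iff)

lemma trunc_map_scaleR: "trunc_map n d u (c *\<^sub>R x) = c *\<^sub>R trunc_map n d u x"
  by (auto simp: trunc_map_def inner_Rn_simps fun_eq_iff)

lemma trunc_map_diff: "trunc_map n d u (x - y) = trunc_map n d u x - trunc_map n d u y"
  by (auto simp: trunc_map_def inner_Rn_simps fun_eq_iff)

lemma trunc_map_eq_0: "x \<in> Rn n \<Longrightarrow> trunc_map n d u x = 0 \<Longrightarrow> x \<in> orth_comp_Rn n d u"
  by (auto simp: trunc_map_def orth_comp_Rn_def fun_eq_iff split: if_splits)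

lemma compact_trunc_image:
  assumes "compact S" shows "compact (trunc_map n d u ` S)"
proof -
  have "continuous_on UNIV (trunc_map n d u)"
  proof (rule continuous_on_coordinatewise_then_product)
    fix i
    have "continuous_on UNIV (\<lambda>x. inner_Rn n (u i) x)"
      using continuous_on_inner_Rn[of n "u i"] by (simp add: inner_Rn_commute)
    then show "continuous_on UNIV (\<lambda>x. trunc_map n d u x i)"
      by (cases "i < d") (simp_all add: trunc_map_def)
  qed
  then show ?thesis by (intro compact_continuous_image assms) (auto intro: continuous_on_subset)
qed

text \<open>The packing argument cancels this volume, so it must be neither 0 nor infinite. The
  image is caught between two cubes: \<tau> = 1 / (d n) is small enough because d frame vectors,
  each of l1-norm at most n, are combined, and the outer cube has side 2.\<close>

lemma emeasure_trunc_l1_ball: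
  assumes u: "orthonormal_Rn n n u" and d: "d \<le> n" "0 < d"
  defines "D \<equiv> trunc_map n d u ` {x \<in> Rn n. l1_Rn n x \<le> 1}"
  shows "0 < emeasure (lborel_Rn d) D" "emeasure (lborel_Rn d) D < top"
proof -
  have Dc: "compact D" unfolding D_def by (rule compact_trunc_image[OF compact_l1_ball])
  then have Db: "D \<in> sets borel" by (intro borel_closed compact_imp_closed)
  note Q = convex_body_facts[OF convex_body_unit_cube[of d]]
  have vol: "emeasure (lborel_Rn d) (unit_cube d) = 1"
    using unit_cube_unc_isotropic[of d] by (auto simp: unc_isotropic_def isotropic_def)
  have z: "0 \<in> Rn d" by (simp add: mem_Rn)
  have nu: "norm_Rn n (u i) = 1" if "i < n" for i
    using u that by (simp add: norm_Rn_eq_sqrt orthonormal_Rn_def)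
  define \<tau> where "\<tau> = 1 / (real d * real n)"
  have \<tau>: "0 < \<tau>" using d by (simp add: \<tau>_def)
  have sub1: "(\<lambda>y. 0 + \<tau> *\<^sub>R y) ` unit_cube d \<subseteq> D"
  proof
    fix w assume "w \<in> (\<lambda>y. 0 + \<tau> *\<^sub>R y) ` unit_cube d"
    then obtain y where y: "y \<in> unit_cube d" "w = \<tau> *\<^sub>R y" by auto
    define x where "x = (\<Sum>i<d. (\<tau> * y i) *\<^sub>R u i)"
    have xR: "x \<in> Rn n" unfolding x_def using u d by (intro sum_scaleR_mem_Rn) (auto simp: orthonormal_Rn_def)
    have "l1_Rn n x \<le> (\<Sum>i<d. l1_Rn n ((\<tau> * y i) *\<^sub>R u i))" unfolding x_def by (rule l1_Rn_sum_le)
    also have "\<dots> \<le> (\<Sum>i<d. \<tau> * real n)"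
    proof (rule sum_mono)
      fix i assume i: "i \<in> {..<d}"
      have y1: "\<bar>y i\<bar> \<le> 1" using y(1) i by (auto simp: unit_cube_def abs_le_iff)
      have "l1_Rn n (u i) \<le> sqrt (real n)" using l1_le_sqrt_norm[of n "u i"] nu[of i] i d by simp
      also have "\<dots> \<le> real n" using d by (intro real_le_lsqrt) (auto simp: power2_eq_square)
      finally have l: "l1_Rn n (u i) \<le> real n" .
      have "l1_Rn n ((\<tau> * y i) *\<^sub>R u i) = \<tau> * (\<bar>y i\<bar> * l1_Rn n (u i))"
        using \<tau> by (simp add: l1_Rn_scaleR abs_mult)
      also have "\<dots> \<le> \<tau> * (1 * real n)" using \<tau> y1 l l1_Rn_nonneg by (intro mult_left_mono mult_mono) auto
      finally show "l1_Rn n ((\<tau> * y i) *\<^sub>R u i) \<le> \<tau> * real n" by simp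
    qed
    also have "\<dots> = 1" using d by (simp add: \<tau>_def)
    finally have l1: "l1_Rn n x \<le> 1" .
    have "trunc_map n d u x = w"
    proof (rule Rn_eqI)
      fix j assume j: "j < d"
      have "inner_Rn n (u j) x = (\<Sum>i<d. (\<tau> * y i) * inner_Rn n (u j) (u i))"
        by (simp add: x_def inner_Rn_simps)
      also have "\<dots> = (\<Sum>i<d. if j = i then \<tau> * y i else 0)"
        using u d j by (intro sum.cong) (auto simp: orthonormal_Rn_def)
      also have "\<dots> = \<tau> * y j" using j by simp
      finally show "trunc_map n d u x j = w j" using j by (simp add: trunc_map_def y(2))
    qed (use y in \<open>auto simp: unit_cube_def intro!: subspace_scale[OF subspace_Rn]\<close>)
    then show "w \<in> D" unfolding D_def using xR l1 by blast
  qed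
  have "ennreal (\<tau> ^ d) \<le> emeasure (lborel_Rn d) D"
    using emeasure_mono[OF sub1, of "lborel_Rn d"] Db emeasure_lborel_Rn_affine(2)[OF Q(1,4) z \<tau>] vol by simp
  then show "0 < emeasure (lborel_Rn d) D" using \<tau> by (auto intro: less_le_trans[rotated])
  have sub2: "D \<subseteq> (\<lambda>y. 0 + 2 *\<^sub>R y) ` unit_cube d"
  proof
    fix w assume "w \<in> D"
    then obtain x where x: "x \<in> Rn n" "l1_Rn n x \<le> 1" "w = trunc_map n d u x" by (auto simp: D_def)
    have b: "\<bar>w i\<bar> \<le> 1" if "i < d" for i
    proof -
      have "\<bar>inner_Rn n (u i) x\<bar> \<le> norm_Rn n (u i) * norm_Rn n x" by (rule Cauchy_Schwarz_Rn)
      then show ?thesis using nu[of i] d that norm_le_l1_Rn[of x n] x by (simp add: trunc_map_def)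
    qed
    have "(1 / 2) *\<^sub>R w \<in> unit_cube d"
      using b x(3) by (force simp: unit_cube_def abs_le_iff intro!: subspace_scale[OF subspace_Rn])
    moreover have "w = 0 + 2 *\<^sub>R (1 / 2) *\<^sub>R w" by (simp add: fun_eq_iff)
    ultimately show "w \<in> (\<lambda>y. 0 + 2 *\<^sub>R y) ` unit_cube d" by (intro image_eqI[of _ _ "(1 / 2) *\<^sub>R w"])
  qed
  have "emeasure (lborel_Rn d) D \<le> ennreal (2 ^ d)"
    using emeasure_mono[OF sub2, of "lborel_Rn d"] emeasure_lborel_Rn_affine[OF Q(1,4) z, of 2] vol by simp
  then show "emeasure (lborel_Rn d) D < top" by (rule le_less_trans) simp
qed

section \<open>Packing of sparse vectors in the quotient\<close>

definition flat_vec :: "nat set \<Rightarrow> nat \<Rightarrow> real"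
  where "flat_vec S = (\<lambda>i. if i \<in> S then 1 / real (card S) else 0)"

lemma flat_vec_mem: "S \<subseteq> {..<n} \<Longrightarrow> flat_vec S \<in> Rn n"
  by (auto simp: flat_vec_def mem_Rn)

lemma l1_flat_vec: "S \<subseteq> {..<n} \<Longrightarrow> l1_Rn n (flat_vec S) \<le> 1"
proof -
  assume S: "S \<subseteq> {..<n}"
  have "l1_Rn n (flat_vec S) = (\<Sum>i\<in>S. 1 / real (card S))"
    unfolding l1_Rn_def using S by (intro sum.mono_neutral_cong_right) (auto simp: flat_vec_def)
  then show ?thesis by simp
qed

text \<open>On the symmetric difference, which has more than s elements, every entry of the
  difference is 1 / s in absolute value.\<close>

lemma l1_flat_vec_diff:
  assumes S: "S \<subseteq> {..<n}" "card S = s" and T: "T \<subseteq> {..<n}" "card T = s" and lt: "2 * card (S \<inter> T) < s"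
  shows "1 < l1_Rn n (flat_vec S - flat_vec T)"
proof -
  have fin: "finite S" "finite T" using S T finite_subset by blast+
  have s: "0 < s" using lt by simp
  have "l1_Rn n (flat_vec S - flat_vec T) \<ge> (\<Sum>i\<in>(S - T) \<union> (T - S). \<bar>(flat_vec S - flat_vec T) i\<bar>)"
    unfolding l1_Rn_def using S T by (intro sum_mono2) auto
  also have "(\<Sum>i\<in>(S - T) \<union> (T - S). \<bar>(flat_vec S - flat_vec T) i\<bar>) = (\<Sum>i\<in>(S - T) \<union> (T - S). 1 / real s)"
    using S T by (intro sum.cong) (auto simp: flat_vec_def)
  also have "\<dots> = (real (card (S - T)) + real (card (T - S))) / real s"
    using fin by (simp add: card_Un_disjoint Diff_disjoint Int_Diff disjoint_iff)
  also have "real (card (S - T)) = real s - real (card (S \<inter> T))"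
    using fin S card_mono[of S "S \<inter> T"] by (simp add: card_Diff_subset_Int of_nat_diff)
  also have "real (card (T - S)) = real s - real (card (S \<inter> T))"
    using fin T card_mono[of T "S \<inter> T"] by (simp add: card_Diff_subset_Int Int_commute of_nat_diff)
  finally have "((real s - real (card (S \<inter> T))) + (real s - real (card (S \<inter> T)))) / real s
    \<le> l1_Rn n (flat_vec S - flat_vec T)" .
  moreover have "1 < ((real s - real (card (S \<inter> T))) + (real s - real (card (S \<inter> T)))) / real s"
    using lt s by (simp add: field_simps)
  ultimately show ?thesis by linarith
qed

text \<open>
  If every nonzero vector of the kernel \<open>F\<close> has large \<open>\<ell>\<^sub>1\<close>-norm, then \<open>F\<close> has the null space property
  of order \<open>2s\<close>, so the images of \<open>\<ell>\<^sub>1\<close>-balls of radius \<open>1/2\<close> around well separated \<open>s\<close>-sparse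
  vectors are disjoint, and comparing volumes in the \<open>d\<close>-dimensional quotient bounds their number.
\<close>

lemma null_space_packing:
  assumes u: "orthonormal_Rn n n u" and d: "0 < d" "d \<le> n"
    and nsp: "\<And>v. v \<in> orth_comp_Rn n d u \<Longrightarrow> v \<noteq> 0 \<Longrightarrow> 2 * sqrt (2 * real s) * norm_Rn n v < l1_Rn n v"
    and A: "finite A" "\<And>a. a \<in> A \<Longrightarrow> S a \<subseteq> {..<n} \<and> card (S a) = s"
    and sep: "\<And>a b. a \<in> A \<Longrightarrow> b \<in> A \<Longrightarrow> a \<noteq> b \<Longrightarrow> 2 * card (S a \<inter> S b) < s"
  shows "card A \<le> 3 ^ d"
proof -
  let ?T = "trunc_map n d u"
  define B where "B = {x \<in> Rn n. l1_Rn n x \<le> 1}"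
  define D where "D = ?T ` B"
  have Dc: "compact D" unfolding D_def B_def by (rule compact_trunc_image[OF compact_l1_ball])
  have DR: "D \<subseteq> Rn d" by (auto simp: D_def)
  have V: "0 < emeasure (lborel_Rn d) D" "emeasure (lborel_Rn d) D < top"
    unfolding D_def B_def by (rule emeasure_trunc_l1_ball[OF u d(2,1)])+
  define E where "E a = (\<lambda>y. ?T (flat_vec (S a)) + (1 / 2) *\<^sub>R y) ` D" for a
  have Em: "E a \<in> sets (lborel_Rn d)" "emeasure (lborel_Rn d) (E a) = ennreal ((1 / 2) ^ d) * emeasure (lborel_Rn d) D" for a
    unfolding E_def using emeasure_lborel_Rn_affine[OF Dc DR, of "?T (flat_vec (S a))" "1 / 2"] by auto
  have disj: "disjoint_family_on E A"
    unfolding disjoint_family_on_def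
  proof (intro ballI impI)
    fix a b assume ab: "a \<in> A" "b \<in> A" "a \<noteq> b"
    show "E a \<inter> E b = {}"
    proof (rule ccontr)
      assume "E a \<inter> E b \<noteq> {}"
      then obtain z z' where z: "z \<in> B" "z' \<in> B"
        and eq: "?T (flat_vec (S a)) + (1 / 2) *\<^sub>R ?T z = ?T (flat_vec (S b)) + (1 / 2) *\<^sub>R ?T z'"
        by (auto simp: E_def D_def)
      \<comment> \<open>A common point of the two translated bodies yields a kernel vector v = w +
        y, where w is supported on at most 2s coordinates and y has l1-norm at most 1.\<close>
      define w where "w = flat_vec (S a) - flat_vec (S b)"
      define y where "y = (1 / 2) *\<^sub>R (z - z')"
      define v where "v = w + y"
      have Sa: "S a \<subseteq> {..<n}" "card (S a) = s" and Sb: "S b \<subseteq> {..<n}" "card (S b) = s" using A(2) ab by auto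
      have vR: "v \<in> Rn n"
        unfolding v_def w_def y_def using z flat_vec_mem[OF Sa(1)] flat_vec_mem[OF Sb(1)]
        by (auto simp: B_def intro!: subspace_add[OF subspace_Rn] subspace_diff[OF subspace_Rn] subspace_scale[OF subspace_Rn])
      have "?T v = (?T (flat_vec (S a)) + (1 / 2) *\<^sub>R ?T z) - (?T (flat_vec (S b)) + (1 / 2) *\<^sub>R ?T z')"
        by (simp add: v_def w_def y_def trunc_map_add trunc_map_diff trunc_map_scaleR algebra_simps fun_eq_iff)
      then have "?T v = 0" using eq by simp
      then have vF: "v \<in> orth_comp_Rn n d u" by (rule trunc_map_eq_0[OF vR])
      have w1: "1 < l1_Rn n w" unfolding w_def by (rule l1_flat_vec_diff[OF Sa Sb sep[OF ab]])
      have y1: "l1_Rn n y \<le> 1"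
        using z l1_Rn_diff_le[of n z z'] by (simp add: y_def l1_Rn_scaleR B_def)
      have "v \<noteq> 0"
      proof
        assume "v = 0"
        then have "w = - y" unfolding v_def by (simp add: eq_neg_iff_add_eq_0)
        then have "l1_Rn n w = l1_Rn n y" by (simp add: l1_Rn_def)
        then show False using w1 y1 by simp
      qed
      from nsp[OF vF this] have big: "2 * sqrt (2 * real s) * norm_Rn n v < l1_Rn n v" .
      \<comment> \<open>The hypothesis makes v lighter on J than off J, and off J it equals y. Since
        w = v - y lives on J, its l1-norm is less than that of y, whereas separation made it exceed
        1.\<close>
      define J where "J = S a \<union> S b"
      have J: "J \<subseteq> {..<n}" using Sa Sb by (auto simp: J_def)
      have "card J \<le> 2 * s" using card_Un_le[of "S a" "S b"] Sa Sb by (simp add: J_def)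
      then have "real (card J) \<le> real (2 * s)" by (rule of_nat_mono)
      then have "sqrt (real (card J)) \<le> sqrt (2 * real s)" by simp
      from mult_right_mono[OF this, of "norm_Rn n v"]
      have "(\<Sum>i\<in>J. \<bar>v i\<bar>) \<le> sqrt (2 * real s) * norm_Rn n v"
        using sum_abs_le_sqrt_card[OF J, of v] by (intro order_trans[OF sum_abs_le_sqrt_card[OF J]]) simp
      then have "2 * (\<Sum>i\<in>J. \<bar>v i\<bar>) < l1_Rn n v" using big by linarith
      moreover have split: "l1_Rn n x = (\<Sum>i\<in>J. \<bar>x i\<bar>) + (\<Sum>i\<in>{..<n} - J. \<bar>x i\<bar>)" for x
        unfolding l1_Rn_def using J by (subst sum.subset_diff[OF J]) auto
      ultimately have "(\<Sum>i\<in>J. \<bar>v i\<bar>) < (\<Sum>i\<in>{..<n} - J. \<bar>v i\<bar>)" by (simp add: split[of v])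
      moreover have "(\<Sum>i\<in>{..<n} - J. \<bar>v i\<bar>) = (\<Sum>i\<in>{..<n} - J. \<bar>y i\<bar>)"
        by (intro sum.cong) (auto simp: v_def w_def flat_vec_def J_def)
      moreover have "(\<Sum>i\<in>J. \<bar>w i\<bar>) \<le> (\<Sum>i\<in>J. \<bar>v i\<bar> + \<bar>y i\<bar>)"
        by (intro sum_mono) (simp add: v_def)
      moreover have "(\<Sum>i\<in>{..<n} - J. \<bar>w i\<bar>) = 0"
        by (intro sum.neutral) (auto simp: w_def flat_vec_def J_def)
      ultimately have "l1_Rn n w < l1_Rn n y"
        by (simp add: split[of w] split[of y] sum.distrib)
      then show False using w1 y1 by simp
    qed
  qed
  \<comment> \<open>Centres of l1-norm at most 1 and radius 1/2 stay within radius 3/2; the ratio of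
    the radii is the base 3 of the bound.\<close>
  have sub: "(\<Union>a\<in>A. E a) \<subseteq> (\<lambda>y. 0 + (3 / 2) *\<^sub>R y) ` D"
  proof
    fix w assume "w \<in> (\<Union>a\<in>A. E a)"
    then obtain a z where a: "a \<in> A" and z: "z \<in> B" and w: "w = ?T (flat_vec (S a)) + (1 / 2) *\<^sub>R ?T z"
      by (auto simp: E_def D_def)
    have Sa: "S a \<subseteq> {..<n}" using A(2)[OF a] by simp
    define x where "x = (2 / 3) *\<^sub>R (flat_vec (S a) + (1 / 2) *\<^sub>R z)"
    have "x \<in> Rn n" unfolding x_def using z flat_vec_mem[OF Sa]
      by (auto simp: B_def intro!: subspace_add[OF subspace_Rn] subspace_scale[OF subspace_Rn])
    moreover have "l1_Rn n x \<le> 1"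
      using l1_Rn_triangle[of n "flat_vec (S a)" "(1 / 2) *\<^sub>R z"] l1_flat_vec[OF Sa] z
      by (simp add: x_def l1_Rn_scaleR B_def)
    ultimately have "?T x \<in> D" by (auto simp: D_def B_def)
    moreover have "w = 0 + (3 / 2) *\<^sub>R ?T x"
      by (simp add: w x_def trunc_map_add trunc_map_scaleR fun_eq_iff)
    ultimately show "w \<in> (\<lambda>y. 0 + (3 / 2) *\<^sub>R y) ` D" by blast
  qed
  have z: "0 \<in> Rn d" by (simp add: mem_Rn)
  note big = emeasure_lborel_Rn_affine[OF Dc DR z, of "3 / 2"]
  obtain \<nu> where \<nu>: "emeasure (lborel_Rn d) D = ennreal \<nu>" "0 < \<nu>"
    using V by (cases "emeasure (lborel_Rn d) D") auto
  have "ennreal (real (card A) * ((1 / 2) ^ d * \<nu>)) = (\<Sum>a\<in>A. emeasure (lborel_Rn d) (E a))"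
    using \<nu> by (simp add: Em(2) ennreal_mult ennreal_of_nat_eq_real_of_nat)
  also have "\<dots> = emeasure (lborel_Rn d) (\<Union>a\<in>A. E a)"
    using Em(1) disj A(1) by (intro sum_emeasure) auto
  also have "\<dots> \<le> emeasure (lborel_Rn d) ((\<lambda>y. 0 + (3 / 2) *\<^sub>R y) ` D)"
    using big(1) by (intro emeasure_mono[OF sub]) simp
  also have "\<dots> = ennreal ((3 / 2) ^ d * \<nu>)"
    using big(2) \<nu> by (simp add: ennreal_mult)
  finally have "real (card A) * ((1 / 2) ^ d * \<nu>) \<le> (3 / 2) ^ d * \<nu>"
    using \<nu> by (subst (asm) ennreal_le_iff) auto
  then have "real (card A) \<le> 3 ^ d" using \<nu> by (simp add: power_divide field_simps)
  then show ?thesis by (simp flip: of_nat_le_iff)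
qed

section \<open>Codes with few agreements\<close>

lemma card_PiE_agree_le:
  fixes q s :: nat
  assumes J: "J \<subseteq> {..<s}"
  shows "card {g \<in> {..<s} \<rightarrow>\<^sub>E {..<q}. \<forall>j\<in>J. g j = f j} \<le> q ^ (s - card J)"
proof -
  let ?X = "{g \<in> {..<s} \<rightarrow>\<^sub>E {..<q}. \<forall>j\<in>J. g j = f j}"
  let ?r = "\<lambda>g. restrict g ({..<s} - J)"
  have "inj_on ?r ?X"
  proof (rule inj_onI)
    fix g h assume g: "g \<in> ?X" and h: "h \<in> ?X" and eq: "?r g = ?r h"
    show "g = h"
    proof
      fix j
      consider "j \<in> J" | "j \<in> {..<s} - J" | "j \<notin> {..<s}" using J by blast
      then show "g j = h j"
      proof cases
        case 2
        then show ?thesis using fun_cong[OF eq, of j] by simp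
      qed (use g h J in \<open>auto simp: PiE_def extensional_def\<close>)
    qed
  qed
  moreover have "?r ` ?X \<subseteq> ({..<s} - J) \<rightarrow>\<^sub>E {..<q}" by auto
  ultimately have "card ?X \<le> card (({..<s} - J) \<rightarrow>\<^sub>E {..<q})"
    by (intro card_inj_on_le finite_PiE) auto
  also have "\<dots> = q ^ (s - card J)"
    using J finite_subset[OF J] by (simp add: card_PiE card_Diff_subset)
  finally show ?thesis .
qed

text \<open>Union bound over the set J of agreement: at most 2^s choices, and outside J at most s
  div 2 positions remain free.\<close>

lemma card_close_codewords_le:
  fixes q s :: nat
  assumes q: "1 \<le> q"
  shows "card {g \<in> {..<s} \<rightarrow>\<^sub>E {..<q}. s \<le> 2 * card {j \<in> {..<s}. f j = g j}} \<le> 2 ^ s * q ^ (s div 2)"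
proof -
  let ?\<Omega> = "{..<s} \<rightarrow>\<^sub>E {..<q}"
  let ?JJ = "{J. J \<subseteq> {..<s} \<and> s \<le> 2 * card J}"
  have fin: "finite ?JJ" "finite ?\<Omega>" by (auto intro: finite_PiE)
  have "{g \<in> ?\<Omega>. s \<le> 2 * card {j \<in> {..<s}. f j = g j}} \<subseteq> (\<Union>J\<in>?JJ. {g \<in> ?\<Omega>. \<forall>j\<in>J. g j = f j})"
  proof
    fix g assume g: "g \<in> {g \<in> ?\<Omega>. s \<le> 2 * card {j \<in> {..<s}. f j = g j}}"
    show "g \<in> (\<Union>J\<in>?JJ. {g \<in> ?\<Omega>. \<forall>j\<in>J. g j = f j})"
      by (rule UN_I[of "{j \<in> {..<s}. f j = g j}"]) (use g in auto)
  qed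
  then have "card {g \<in> ?\<Omega>. s \<le> 2 * card {j \<in> {..<s}. f j = g j}} \<le> card (\<Union>J\<in>?JJ. {g \<in> ?\<Omega>. \<forall>j\<in>J. g j = f j})"
    using fin by (intro card_mono) auto
  also have "\<dots> \<le> (\<Sum>J\<in>?JJ. card {g \<in> ?\<Omega>. \<forall>j\<in>J. g j = f j})"
    by (rule card_UN_le[OF fin(1)])
  also have "\<dots> \<le> (\<Sum>J\<in>?JJ. q ^ (s div 2))"
  proof (rule sum_mono)
    fix J assume J: "J \<in> ?JJ"
    then have "card {g \<in> ?\<Omega>. \<forall>j\<in>J. g j = f j} \<le> q ^ (s - card J)" by (intro card_PiE_agree_le) auto
    also have "\<dots> \<le> q ^ (s div 2)" using J q by (intro power_increasing) auto
    finally show "card {g \<in> ?\<Omega>. \<forall>j\<in>J. g j = f j} \<le> q ^ (s div 2)" .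
  qed
  also have "\<dots> = card ?JJ * q ^ (s div 2)" by simp
  also have "card ?JJ \<le> card (Pow {..<s})" by (intro card_mono) auto
  also have "card (Pow {..<s}) = 2 ^ s" by (simp add: card_Pow)
  finally show ?thesis by (simp add: mult_right_mono)
qed

text \<open>Gilbert--Varshamov: a maximal code is covering.\<close>

lemma exists_code:
  fixes q s :: nat
  assumes q: "1 \<le> q" and s: "1 \<le> s"
  shows "\<exists>A \<subseteq> {..<s} \<rightarrow>\<^sub>E {..<q}.
    (\<forall>f\<in>A. \<forall>g\<in>A. f \<noteq> g \<longrightarrow> 2 * card {j \<in> {..<s}. f j = g j} < s) \<and>
    q ^ s \<le> card A * (2 ^ s * q ^ (s div 2))"
proof -
  let ?\<Omega> = "{..<s} \<rightarrow>\<^sub>E {..<q}"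
  have fin: "finite ?\<Omega>" by (auto intro: finite_PiE)
  define P where "P A \<longleftrightarrow> A \<subseteq> ?\<Omega> \<and> (\<forall>f\<in>A. \<forall>g\<in>A. f \<noteq> g \<longrightarrow> 2 * card {j \<in> {..<s}. f j = g j} < s)" for A
  have "P {}" by (simp add: P_def)
  moreover have "\<forall>A. P A \<longrightarrow> card A < Suc (card ?\<Omega>)"
    using card_mono[OF fin] by (auto simp: P_def less_Suc_eq_le)
  ultimately obtain A where A: "P A" and max: "\<forall>B. P B \<longrightarrow> card B \<le> card A"
    using ex_has_greatest_nat[of P "{}" card] by blast
  have A\<Omega>: "A \<subseteq> ?\<Omega>" and finA: "finite A" using A fin finite_subset by (auto simp: P_def)
  let ?N = "\<lambda>f. {g \<in> ?\<Omega>. s \<le> 2 * card {j \<in> {..<s}. f j = g j}}"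
  have cover: "?\<Omega> \<subseteq> (\<Union>f\<in>A. ?N f)"
  proof
    fix g assume g: "g \<in> ?\<Omega>"
    show "g \<in> (\<Union>f\<in>A. ?N f)"
    proof (cases "g \<in> A")
      case True
      then show ?thesis using g by (intro UN_I[of g]) auto
    next
      case False
      show ?thesis
      proof (rule ccontr)
        assume "g \<notin> (\<Union>f\<in>A. ?N f)"
        then have n: "2 * card {j \<in> {..<s}. f j = g j} < s" if "f \<in> A" for f
          using that g by (auto simp: not_le)
        have "{j \<in> {..<s}. g j = f j} = {j \<in> {..<s}. f j = g j}" for f by auto
        then have "P (insert g A)" using A g n unfolding P_def by auto
        then have "card (insert g A) \<le> card A" using max by blast
        then show False using False finA by simp
      qed
    qed
  qed
  have "q ^ s = card ?\<Omega>" by (simp add: card_PiE)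
  also have "\<dots> \<le> card (\<Union>f\<in>A. ?N f)" using cover finA fin by (intro card_mono) auto
  also have "\<dots> \<le> (\<Sum>f\<in>A. card (?N f))" by (rule card_UN_le[OF finA])
  also have "\<dots> \<le> (\<Sum>f\<in>A. 2 ^ s * q ^ (s div 2))"
    by (intro sum_mono card_close_codewords_le[OF q])
  finally have "q ^ s \<le> card A * (2 ^ s * q ^ (s div 2))" by simp
  then show ?thesis using A by (auto simp: P_def)
qed

text \<open>Cut out s consecutive blocks of length q = n div s. A codeword selects one point in each
  block, so two of the resulting sets meet exactly where the codewords agree, and a code with few
  agreements gives well separated sparse vectors.\<close>

lemma null_space_packing_bound:
  assumes u: "orthonormal_Rn n n u" and d: "0 < d" "d \<le> n"
    and s: "1 \<le> s" "s \<le> n"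
    and nsp: "\<And>v. v \<in> orth_comp_Rn n d u \<Longrightarrow> v \<noteq> 0 \<Longrightarrow> 2 * sqrt (2 * real s) * norm_Rn n v < l1_Rn n v"
  shows "(n div s) ^ (s - s div 2) \<le> 3 ^ d * 2 ^ s"
proof -
  define q where "q = n div s"
  have q: "1 \<le> q" using s by (simp add: q_def div_greater_zero_iff Suc_le_eq)
  obtain A where A: "A \<subseteq> {..<s} \<rightarrow>\<^sub>E {..<q}"
    and sep: "\<forall>f\<in>A. \<forall>g\<in>A. f \<noteq> g \<longrightarrow> 2 * card {j \<in> {..<s}. f j = g j} < s"
    and big: "q ^ s \<le> card A * (2 ^ s * q ^ (s div 2))"
    using exists_code[OF q s(1)] by blast
  define S where "S f = (\<lambda>j. j * q + f j) ` {..<s}" for f :: "nat \<Rightarrow> nat"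
  have finA: "finite A" using A finite_subset by (blast intro: finite_PiE)
  have bnd: "f j < q" if "f \<in> A" "j < s" for f j using A that by (auto simp: PiE_def Pi_def)
  have dm: "j = k \<and> f j = g k" if "f \<in> A" "g \<in> A" "j < s" "k < s" "j * q + f j = k * q + g k" for f g j k
  proof -
    have "(j * q + f j) div q = j" "(k * q + g k) div q = k"
      using bnd[OF that(1,3)] bnd[OF that(2,4)] by simp_all
    then have "j = k" using that(5) by simp
    then show ?thesis using that(5) by simp
  qed
  have "card A \<le> 3 ^ d"
  proof (rule null_space_packing[OF u d nsp finA, where S=S])
    fix f assume f: "f \<in> A"
    have "inj_on (\<lambda>j. j * q + f j) {..<s}" using dm[OF f f] by (auto intro!: inj_onI)
    then have "card (S f) = s" unfolding S_def by (simp add: card_image)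
    moreover have "S f \<subseteq> {..<n}"
    proof
      fix i assume "i \<in> S f"
      then obtain j where j: "j < s" "i = j * q + f j" by (auto simp: S_def)
      have "i < j * q + q" using bnd[OF f j(1)] j by simp
      also have "\<dots> = (j + 1) * q" by simp
      also have "\<dots> \<le> s * q" using j by (intro mult_right_mono) auto
      also have "\<dots> \<le> n" by (simp add: q_def)
      finally show "i \<in> {..<n}" by simp
    qed
    ultimately show "S f \<subseteq> {..<n} \<and> card (S f) = s" by simp
  next
    fix f g assume fg: "f \<in> A" "g \<in> A" "f \<noteq> g"
    have "S f \<inter> S g \<subseteq> (\<lambda>j. j * q + f j) ` {j \<in> {..<s}. f j = g j}"
      using dm[OF fg(1,2)] by (auto simp: S_def)
    then have "card (S f \<inter> S g) \<le> card ((\<lambda>j. j * q + f j) ` {j \<in> {..<s}. f j = g j})" by (intro card_mono) auto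
    also have "\<dots> \<le> card {j \<in> {..<s}. f j = g j}" by (intro card_image_le) auto
    finally show "2 * card (S f \<inter> S g) < s" using sep fg by fastforce
  qed
  have "q ^ (s - s div 2) * q ^ (s div 2) = q ^ s" by (simp flip: power_add)
  also have "\<dots> \<le> 3 ^ d * (2 ^ s * q ^ (s div 2))"
    using big \<open>card A \<le> 3 ^ d\<close> by (meson mult_le_mono1 order_trans)
  finally have "q ^ (s - s div 2) * q ^ (s div 2) \<le> (3 ^ d * 2 ^ s) * q ^ (s div 2)" by (simp add: mult.assoc)
  then show ?thesis using q by (simp add: q_def)
qed

section \<open>The rate, and its bound on every subspace\<close>

definition rate :: "nat \<Rightarrow> nat \<Rightarrow> real"
  where "rate n d = max 1 (sqrt (real d / ln (exp 1 * real n / real d)))"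

lemma ln_ratio_bounds:
  assumes d: "1 \<le> d" "d < n"
  defines "L \<equiv> ln (exp 1 * real n / real d)"
  shows "1 \<le> L" "L \<le> exp 1 * real n / real d"
proof -
  have "exp 1 \<le> exp 1 * real n / real d" using d by (simp add: field_simps)
  then have "ln (exp 1) \<le> L" unfolding L_def by (intro ln_mono) (use d in auto)
  then show "1 \<le> L" by simp
  have "L \<le> exp 1 * real n / real d - 1" unfolding L_def using d by (intro ln_le_minus_one) simp
  then show "L \<le> exp 1 * real n / real d" by simp
qed

text \<open>For n \<le> 40000 d the logarithm L is bounded, the rate is comparable to sqrt n, and
  any vector will do. Otherwise, if no such v existed, packing with s close to 10 d / L would give
  (s/2) ln(q/4) \<le> d ln 3 \<le> 2 d, while the left side is at least (5/2) d.\<close>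

lemma Gelfand_lower_bound:
  assumes d: "1 \<le> d" "d < n" and F: "F \<in> grassmannian n (n - d)"
  shows "\<exists>v\<in>F. v \<noteq> 0 \<and> l1_Rn n v \<le> 80000 * rate n d * norm_Rn n v"
proof -
  define L where "L = ln (exp 1 * real n / real d)"
  have L: "1 \<le> L" "L \<le> exp 1 * real n / real d" unfolding L_def using ln_ratio_bounds[OF d] by auto
  have dl: "sqrt (real d / L) \<le> rate n d" "1 \<le> rate n d" unfolding rate_def L_def by auto
  have e4: "exp 1 < (4::real)" using e_less_272 by simp
  have d': "d \<le> n" using d by simp
  obtain u where u: "orthonormal_Rn n n u" and Fu: "F = orth_comp_Rn n d u"
    using F by (auto simp: grassmannian_eq[OF d'])
  show ?thesis
  proof (cases "real n \<le> 40000 * real d")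
    case True
    obtain v where v: "v \<in> F" "norm_Rn n v = 1" using unit_vector_grassmannian[OF d(2) F] by blast
    have "real n / real d \<le> 40000" using True d by (simp add: field_simps)
    then have "exp 1 * (real n / real d) \<le> 4 * 40000" using e4 by (intro mult_mono) auto
    then have "L \<le> 160000" using L(2) by simp
    \<comment> \<open>40000 * 160000 = 80000^2, the origin of the constant in the statement.\<close>
    then have "real n * L \<le> (40000 * real d) * 160000" using True L(1) by (intro mult_mono) auto
    then have "real n \<le> 80000\<^sup>2 * (real d / L)" using L(1) by (simp add: field_simps)
    then have "sqrt (real n) \<le> sqrt (80000\<^sup>2 * (real d / L))" by (rule real_sqrt_le_mono)
    also have "\<dots> = 80000 * sqrt (real d / L)" by (simp only: real_sqrt_mult real_sqrt_power[symmetric]) simp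
    also have "\<dots> \<le> 80000 * rate n d" using dl by simp
    finally have "l1_Rn n v \<le> 80000 * rate n d * norm_Rn n v" using l1_le_sqrt_norm[of n v] v by simp
    moreover have "v \<noteq> 0" using v by auto
    ultimately show ?thesis using v by blast
  next
    case False
    then have nd: "40000 * real d < real n" by simp
    \<comment> \<open>The factor 10 leaves room: together with ln(q/4) \<ge> L/2 it gives 5/2
      against ln 3 in the final comparison.\<close>
    define s where "s = nat \<lceil>10 * real d / L\<rceil>"
    have s1: "10 * real d / L \<le> real s" unfolding s_def by (rule real_nat_ceiling_ge)
    have "0 < 10 * real d / L" using d L by simp
    then have s0: "1 \<le> s" using s1 by linarith
    have s2: "real s \<le> 10 * (real d / L) + 1"
    proof -
      have "0 \<le> \<lceil>10 * real d / L\<rceil>" using \<open>0 < 10 * real d / L\<close> by linarith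
      then have "real s = real_of_int \<lceil>10 * real d / L\<rceil>" by (simp add: s_def)
      then show ?thesis using ceiling_correct[of "10 * real d / L"] by simp
    qed
    have "real d / L \<le> real d" using divide_left_mono[OF L(1), of "real d"] L(1) by simp
    then have s3: "real s \<le> 11 * real d" using s2 d by simp
    then have sn: "s \<le> n" using nd by simp
    show ?thesis
    proof (rule ccontr)
      assume "\<not> ?thesis"
      then have c: "80000 * rate n d * norm_Rn n v < l1_Rn n v" if "v \<in> F" "v \<noteq> 0" for v
        using that by (auto simp: not_le)
      have "2 * sqrt (2 * real s) \<le> 80000 * rate n d"
      proof -
        have "real d / L \<le> (rate n d)\<^sup>2" using dl L by (simp add: sqrt_le_D)
        moreover have "1 \<le> (rate n d)\<^sup>2" using dl(2) by (simp add: one_le_power)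
        ultimately have "2 * real s \<le> 22 * (rate n d)\<^sup>2" using s2 by simp
        also have "\<dots> \<le> (40000 * rate n d)\<^sup>2" by (simp add: power_mult_distrib)
        finally have "sqrt (2 * real s) \<le> 40000 * rate n d" using dl(2) by (intro real_le_lsqrt) auto
        then show ?thesis by simp
      qed
      then have nsp: "2 * sqrt (2 * real s) * norm_Rn n v < l1_Rn n v" if "v \<in> orth_comp_Rn n d u" "v \<noteq> 0" for v
      proof -
        have "2 * sqrt (2 * real s) * norm_Rn n v \<le> 80000 * rate n d * norm_Rn n v"
          using \<open>2 * sqrt (2 * real s) \<le> 80000 * rate n d\<close> by (intro mult_right_mono) auto
        also have "\<dots> < l1_Rn n v" using c[of v] that Fu by simp
        finally show ?thesis .
      qed
      define q where "q = n div s"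
      have pk: "q ^ (s - s div 2) \<le> 3 ^ d * 2 ^ s"
        unfolding q_def using d by (intro null_space_packing_bound[OF u _ d' s0 sn nsp]) auto
      have q1: "real n / (22 * real d) \<le> real q"
      proof -
        have "real n / real s - 1 \<le> real q"
        proof -
          have "n mod s < s" using s0 by simp
          moreover have "n = q * s + n mod s" unfolding q_def by simp
          ultimately have "n \<le> q * s + s" by linarith
          then have "real n \<le> real (q * s + s)" by (rule of_nat_mono)
          then show ?thesis using s0 by (simp add: field_simps)
        qed
        moreover have "real n / (11 * real d) \<le> real n / real s" using s3 s0 d by (intro divide_left_mono) auto
        moreover have "real n / (22 * real d) + 1 \<le> real n / (11 * real d)" using nd d by (simp add: field_simps)
        ultimately show ?thesis by linarith
      qed
      \<comment> \<open>Here n > 40000 d is spent: e * 88^2 < 40000, so q/4 \<ge> n / (88 d) implies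
        (q/4)^2 \<ge> e n / d = exp L.\<close>
      have q4: "L / 2 \<le> ln (real q / 4)"
      proof -
        have "exp 1 * real n / real d \<le> (real q / 4)\<^sup>2"
        proof -
          have "real n / (88 * real d) \<le> real q / 4" using q1 by (simp add: field_simps)
          then have "(real n / (88 * real d))\<^sup>2 \<le> (real q / 4)\<^sup>2" by (intro power_mono) auto
          moreover have "exp 1 * real n / real d \<le> (real n / (88 * real d))\<^sup>2"
          proof -
            have "exp 1 * 7744 * real d \<le> real n" 
            proof -
              have "exp 1 * (7744 * real d) \<le> 4 * (7744 * real d)" using e4 by (intro mult_right_mono) auto
              also have "\<dots> \<le> real n" using nd by simp
              finally show ?thesis by (simp only: mult.assoc)
            qed
            then have "exp 1 * 7744 * real d * real n \<le> real n * real n" by (intro mult_right_mono) auto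
            then have "exp 1 * real n * (88 * real d)\<^sup>2 \<le> (real n)\<^sup>2 * real d"
              using d by (simp add: power2_eq_square mult_ac)
            then show ?thesis using d by (simp add: power_divide divide_le_eq le_divide_eq)
          qed
          ultimately show ?thesis by linarith
        qed
        then have "L \<le> ln ((real q / 4)\<^sup>2)" unfolding L_def using d by (intro ln_mono) auto
        also have "\<dots> = 2 * ln (real q / 4)"
        proof -
          have "0 < real n / (22 * real d)" using d by simp
          then have "0 < real q" using q1 by linarith
          then show ?thesis by (simp add: ln_realpow)
        qed
        finally show ?thesis by simp
      qed
      have "0 < real n / (22 * real d)" using d by simp
      then have qpos: "0 < real q" using q1 by linarith
      have "real (q ^ (s - s div 2)) \<le> real (3 ^ d * 2 ^ s)" using pk by (rule of_nat_mono)
      then have "ln (real q ^ (s - s div 2)) \<le> ln (3 ^ d * 2 ^ s)" using qpos by (intro ln_mono) auto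
      then have "real (s - s div 2) * ln (real q) \<le> real d * ln 3 + real s * ln 2"
        using qpos by (simp add: ln_realpow ln_mult)
      moreover have "real s / 2 * ln (real q) \<le> real (s - s div 2) * ln (real q)"
      proof (rule mult_right_mono)
        show "real s / 2 \<le> real (s - s div 2)" by linarith
        have "0 \<le> ln (real q / 4)" using q4 L by linarith
        then have "1 \<le> real q / 4" using qpos by simp
        then show "0 \<le> ln (real q)" by simp
      qed
      moreover have "real s / 2 * ln (real q / 4) = real s / 2 * ln (real q) - real s * ln 2"
      proof -
        have "ln (4::real) = 2 * ln 2" using ln_realpow[of 2 2] by simp
        then have "ln (real q / 4) = ln (real q) - 2 * ln 2" using qpos by (simp add: ln_div)
        then show ?thesis by (simp add: right_diff_distrib)
      qed
      ultimately have "real s / 2 * ln (real q / 4) \<le> real d * ln 3" by linarith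
      moreover have "(5 * real d / L) * (L / 2) \<le> real s / 2 * ln (real q / 4)"
        using s1 q4 L by (intro mult_mono) auto
      moreover have "(5 * real d / L) * (L / 2) = 5 / 2 * real d" using L(1) by simp
      moreover have "real d * ln 3 \<le> real d * 2" using ln_le_minus_one[of "3::real"] by (intro mult_left_mono) auto
      ultimately show False using d by simp
    qed
  qed
qed

section \<open>The \<open>\<ell>\<^sub>1\<close>-norm on random subspaces\<close>

definition row_norm :: "nat \<Rightarrow> nat \<Rightarrow> (nat \<Rightarrow> nat \<Rightarrow> real) \<Rightarrow> (nat \<Rightarrow> real) \<Rightarrow> real"
  where "row_norm n d G x = L2_set (\<lambda>i. inner_Rn n (G i) x) {..<d}"

lemma row_norm_nonneg: "0 \<le> row_norm n d G x"
  by (simp add: row_norm_def)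

lemma row_norm_triangle: "row_norm n d G (x + y) \<le> row_norm n d G x + row_norm n d G y"
  unfolding row_norm_def inner_Rn_add_right by (rule L2_set_triangle_ineq)

lemma row_norm_scaleR: "row_norm n d G (c *\<^sub>R x) = \<bar>c\<bar> * row_norm n d G x"
  by (simp add: row_norm_def inner_Rn_scaleR_right L2_set_def power_mult_distrib sum_distrib_left[symmetric] real_sqrt_mult)

lemma row_norm_diff: "row_norm n d G (x - y) \<le> row_norm n d G x + row_norm n d G y"
proof -
  have "row_norm n d G (x + (- 1) *\<^sub>R y) \<le> row_norm n d G x + \<bar>- 1\<bar> * row_norm n d G y"
    using row_norm_triangle[of n d G x "(- 1) *\<^sub>R y"] by (simp only: row_norm_scaleR)
  moreover have "x + (- 1) *\<^sub>R y = x - y" by (simp add: fun_eq_iff)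
  ultimately show ?thesis by simp
qed

lemma row_norm_power2: "(row_norm n d G x)\<^sup>2 = (\<Sum>i<d. (inner_Rn n (G i) x)\<^sup>2)"
  by (simp add: row_norm_def L2_set_def sum_nonneg)

lemma row_norm_le: "row_norm n d G x \<le> (\<Sum>i<d. norm_Rn n (G i)) * norm_Rn n x"
proof -
  have "row_norm n d G x \<le> (\<Sum>i<d. \<bar>inner_Rn n (G i) x\<bar>)"
    unfolding row_norm_def by (rule L2_set_le_sum_abs)
  also have "\<dots> \<le> (\<Sum>i<d. norm_Rn n (G i) * norm_Rn n x)"
    by (intro sum_mono Cauchy_Schwarz_Rn)
  finally show ?thesis by (simp add: sum_distrib_right)
qed

lemma measurable_row_norm:
  assumes "d \<le> n"
  shows "(\<lambda>G. row_norm n d G x) \<in> borel_measurable (gauss_mat n)"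
proof -
  have [measurable]: "(\<lambda>G. inner_Rn n (G i) x) \<in> borel_measurable (gauss_mat n)" if "i \<in> {..<d}" for i
    using measurable_gauss_mat_row[of i n] that assms by (intro measurable_inner_Rn) auto
  show ?thesis
    unfolding row_norm_def L2_set_def by measurable
qed

lemma nn_integral_row_norm_exp:
  assumes d: "d \<le> n" and n: "0 < n" and a: "a \<in> Rn n" and c: "2 * c * inner_Rn n a a < 1"
  shows "(\<integral>\<^sup>+G. ennreal (exp (c * (row_norm n d G a)\<^sup>2)) \<partial>gauss_mat n)
    = ennreal ((1 / sqrt (1 - 2 * c * inner_Rn n a a)) ^ d)"
proof -
  interpret product_sigma_finite "\<lambda>_::nat. gauss_Rn n" by (rule product_sigma_finite_gauss)
  interpret g: prob_space "gauss_Rn n" by (rule prob_space_gauss_Rn)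
  let ?h = "\<lambda>i y. if i < d then ennreal (exp (c * (inner_Rn n a y)\<^sup>2)) else 1"
  have "ennreal (exp (c * (row_norm n d G a)\<^sup>2)) = (\<Prod>i<n. ?h i (G i))" for G
  proof -
    have "(\<Prod>i<n. ?h i (G i)) = (\<Prod>i<d. ennreal (exp (c * (inner_Rn n a (G i))\<^sup>2)))"
      using d by (intro prod.mono_neutral_cong_right) auto
    also have "\<dots> = ennreal (exp (\<Sum>i<d. c * (inner_Rn n (G i) a)\<^sup>2))"
      by (simp add: prod_ennreal exp_sum inner_Rn_commute)
    also have "\<dots> = ennreal (exp (c * (row_norm n d G a)\<^sup>2))"
      by (simp add: row_norm_power2 sum_distrib_left)
    finally show ?thesis by simp
  qed
  then have "(\<integral>\<^sup>+G. ennreal (exp (c * (row_norm n d G a)\<^sup>2)) \<partial>gauss_mat n)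
      = (\<integral>\<^sup>+G. (\<Prod>i<n. ?h i (G i)) \<partial>Pi\<^sub>M {..<n} (\<lambda>_. gauss_Rn n))"
    by (simp add: gauss_mat_def)
  also have "\<dots> = (\<Prod>i<n. \<integral>\<^sup>+y. ?h i y \<partial>gauss_Rn n)"
    by (rule product_nn_integral_prod) auto
  also have "\<dots> = (\<Prod>i<n. if i < d then ennreal (1 / sqrt (1 - 2 * c * inner_Rn n a a)) else 1)"
    using nn_integral_gauss_Rn_exp_square[OF n a c] g.emeasure_space_1
    by (intro prod.cong) auto
  also have "\<dots> = (\<Prod>i<d. ennreal (1 / sqrt (1 - 2 * c * inner_Rn n a a)))"
    using d by (intro prod.mono_neutral_cong_right) auto
  also have "\<dots> = ennreal ((1 / sqrt (1 - 2 * c * inner_Rn n a a)) ^ d)"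
    using c by (simp add: ennreal_power)
  finally show ?thesis .
qed

text \<open>Keeping the factor c on both sides of the event lets one statement serve both tails: c >
  0 gives the upper one, c < 0 the lower one.\<close>

lemma row_norm_Chernoff:
  assumes d: "d \<le> n" and n: "0 < n" and a: "a \<in> Rn n" and c: "2 * c * inner_Rn n a a < 1"
  shows "measure (gauss_mat n) {G \<in> space (gauss_mat n). c * t \<le> c * (row_norm n d G a)\<^sup>2}
    \<le> exp (- (c * t)) * (1 / sqrt (1 - 2 * c * inner_Rn n a a)) ^ d"
proof -
  interpret P: prob_space "gauss_mat n" by (rule prob_space_gauss_mat)
  note [measurable] = measurable_row_norm[OF d, of a]
  let ?E = "{G \<in> space (gauss_mat n). c * t \<le> c * (row_norm n d G a)\<^sup>2}"
  have E: "?E \<in> sets (gauss_mat n)" by measurable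
  have "emeasure (gauss_mat n) ?E = (\<integral>\<^sup>+G. indicator ?E G \<partial>gauss_mat n)" using E by simp
  also have "\<dots> \<le> (\<integral>\<^sup>+G. ennreal (exp (- (c * t))) * ennreal (exp (c * (row_norm n d G a)\<^sup>2)) \<partial>gauss_mat n)"
  proof (rule nn_integral_mono)
    fix G
    have "(1::ennreal) \<le> ennreal (exp (- (c * t))) * ennreal (exp (c * (row_norm n d G a)\<^sup>2))" if "G \<in> ?E"
      using that by (simp add: ennreal_mult[symmetric] mult_exp_exp)
    then show "indicator ?E G \<le> ennreal (exp (- (c * t))) * ennreal (exp (c * (row_norm n d G a)\<^sup>2))"
      by (cases "G \<in> ?E") auto
  qed
  also have "\<dots> = ennreal (exp (- (c * t))) * ennreal ((1 / sqrt (1 - 2 * c * inner_Rn n a a)) ^ d)"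
    by (subst nn_integral_cmult) (simp_all add: nn_integral_row_norm_exp[OF d n a c])
  also have "\<dots> = ennreal (exp (- (c * t)) * (1 / sqrt (1 - 2 * c * inner_Rn n a a)) ^ d)"
    using c by (simp add: ennreal_mult)
  finally show ?thesis
    using c by (simp add: P.emeasure_eq_measure ennreal_le_iff)
qed

text \<open>With c = 1/4 each row contributes a factor at most 2 \<le> e, against exp(-4d) from the
  threshold. The exponent 3d is meant to beat a net of exp(d) points.\<close>

lemma row_norm_upper_tail:
  assumes d: "d \<le> n" and n: "0 < n" and a: "a \<in> Rn n" "norm_Rn n a \<le> 1"
  shows "measure (gauss_mat n) {G \<in> space (gauss_mat n). 16 * real d \<le> (row_norm n d G a)\<^sup>2} \<le> exp (- 3 * real d)"
proof -
  have aa: "inner_Rn n a a \<le> 1" using a(2) by (simp add: inner_Rn_self power_le_one)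
  let ?r = "1 / sqrt (1 - 2 * (1 / 4) * inner_Rn n a a)"
  have "1 / 2 \<le> 1 - 2 * (1 / 4) * inner_Rn n a a" using aa by simp
  then have "sqrt ((1 / 2)\<^sup>2) \<le> sqrt (1 - 2 * (1 / 4) * inner_Rn n a a)"
    by (intro real_sqrt_le_mono) (simp add: power2_eq_square)
  then have s: "1 / 2 \<le> sqrt (1 - 2 * (1 / 4) * inner_Rn n a a)" by simp
  then have "0 < sqrt (1 - 2 * (1 / 4) * inner_Rn n a a)" by linarith
  then have "?r \<le> 1 / (1 / 2)" using divide_left_mono[OF s, of 1] by simp
  also have "1 / (1 / 2) = (2::real)" by simp
  also have "(2::real) \<le> exp 1" using exp_ge_add_one_self[of 1] by simp
  finally have r: "?r \<le> exp 1" .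
  have r0: "0 \<le> ?r" using aa by simp
  have "measure (gauss_mat n) {G \<in> space (gauss_mat n). (1 / 4) * (16 * real d) \<le> (1 / 4) * (row_norm n d G a)\<^sup>2}
      \<le> exp (- ((1 / 4) * (16 * real d))) * ?r ^ d"
    using aa by (intro row_norm_Chernoff[OF d n a(1)]) simp
  also have "\<dots> \<le> exp (- ((1 / 4) * (16 * real d))) * exp 1 ^ d"
    using r r0 by (intro mult_left_mono power_mono) auto
  also have "\<dots> = exp (- 3 * real d)"
    by (simp add: exp_of_nat_mult[symmetric] mult_exp_exp)
  finally show ?thesis by simp
qed

text \<open>With c = -5000 each row contributes at most 1/50 \<le> exp(-7/2), since 1 + 10000 |a|^2
  \<ge> 50^2, while the threshold d / 10000 costs exp(d/2).\<close>

lemma row_norm_lower_tail: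
  assumes d: "d \<le> n" and n: "0 < n" and a: "a \<in> Rn n" "1 / 2 \<le> norm_Rn n a"
  shows "measure (gauss_mat n) {G \<in> space (gauss_mat n). (row_norm n d G a)\<^sup>2 \<le> real d / 10000} \<le> exp (- 3 * real d)"
proof -
  have "(1 / 2)\<^sup>2 \<le> (norm_Rn n a)\<^sup>2" using a(2) by (intro power_mono) auto
  then have aa: "1 / 4 \<le> inner_Rn n a a" by (simp add: inner_Rn_self power2_eq_square)
  let ?r = "1 / sqrt (1 - 2 * (- 5000) * inner_Rn n a a)"
  have e7: "exp (7 / 2) \<le> (50 :: real)"
  proof -
    have "exp (7::real) = exp 1 ^ 7" by (simp flip: exp_of_nat_mult)
    also have "\<dots> \<le> (272 / 100) ^ 7" using e_less_272 by (intro power_mono) auto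
    also have "\<dots> \<le> 50\<^sup>2" by (simp add: power2_eq_square power_divide)
    finally have "exp (7::real) \<le> 50\<^sup>2" .
    moreover have "exp (7::real) = (exp (7 / 2))\<^sup>2" by (simp flip: exp_of_nat_mult)
    ultimately have "(exp (7 / 2))\<^sup>2 \<le> (50::real)\<^sup>2" by (simp only:)
    then show ?thesis by (rule power2_le_imp_le) simp
  qed
  have "50\<^sup>2 \<le> 1 - 2 * (- 5000) * inner_Rn n a a" using aa by simp
  then have "sqrt (50\<^sup>2) \<le> sqrt (1 - 2 * (- 5000) * inner_Rn n a a)" by (rule real_sqrt_le_mono)
  then have s: "exp (7 / 2) \<le> sqrt (1 - 2 * (- 5000) * inner_Rn n a a)" using e7 by simp
  have "0 < sqrt (1 - 2 * (- 5000) * inner_Rn n a a)" using s exp_gt_zero[of "7 / 2"] by linarith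
  then have r: "?r \<le> 1 / exp (7 / 2)" "0 \<le> ?r" using s by (auto intro: divide_left_mono)
  have "measure (gauss_mat n) {G \<in> space (gauss_mat n). (- 5000) * (real d / 10000) \<le> (- 5000) * (row_norm n d G a)\<^sup>2}
      \<le> exp (- ((- 5000) * (real d / 10000))) * ?r ^ d"
    using aa by (intro row_norm_Chernoff[OF d n a(1)]) simp
  also have "\<dots> \<le> exp (- ((- 5000) * (real d / 10000))) * (1 / exp (7 / 2)) ^ d"
    using r by (intro mult_left_mono power_mono) auto
  also have "(1 / exp (7 / 2)) ^ d = exp (- (7 / 2) * real d)"
    by (simp add: power_divide exp_of_nat_mult[symmetric] exp_minus field_simps)
  also have "exp (- ((- 5000) * (real d / 10000))) * exp (- (7 / 2) * real d) = exp (- 3 * real d)"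
    by (simp add: mult_exp_exp)
  also have "{G \<in> space (gauss_mat n). (- 5000) * (real d / 10000) \<le> (- 5000) * (row_norm n d G a)\<^sup>2}
      = {G \<in> space (gauss_mat n). (row_norm n d G a)\<^sup>2 \<le> real d / 10000}"
    by auto
  finally show ?thesis .
qed

section \<open>Nets for sparse vectors\<close>

definition int_net :: "nat \<Rightarrow> nat \<Rightarrow> (nat \<Rightarrow> int) set"
  where "int_net n m = {z \<in> {..<n} \<rightarrow>\<^sub>E {- int m..int m}. (\<Sum>i<n. \<bar>z i\<bar>) \<le> int m}"

lemma finite_int_net: "finite (int_net n m)"
  unfolding int_net_def by (rule finite_subset[of _ "{..<n} \<rightarrow>\<^sub>E {- int m..int m}"]) (auto intro: finite_PiE)

text \<open>The subtracted term lets the induction close; only the bound 1 + 4x is used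
  afterwards.\<close>

lemma two_sided_geometric_le:
  fixes x :: real
  assumes x: "0 < x" "x \<le> 1 / 2"
  shows "(\<Sum>k\<in>{- int m..int m}. x ^ nat \<bar>k\<bar>) \<le> 1 + 4 * x - 4 * x ^ (m + 1)"
proof (induction m)
  case (Suc m)
  have eq: "{- int (Suc m)..int (Suc m)} = insert (int (Suc m)) (insert (- int (Suc m)) {- int m..int m})"
    by auto
  have "(\<Sum>k\<in>{- int (Suc m)..int (Suc m)}. x ^ nat \<bar>k\<bar>) = 2 * x ^ Suc m + (\<Sum>k\<in>{- int m..int m}. x ^ nat \<bar>k\<bar>)"
    unfolding eq by (simp add: nat_add_distrib)
  also have "\<dots> \<le> 2 * x ^ Suc m + (1 + 4 * x - 4 * x ^ (m + 1))" using Suc by simp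
  also have "\<dots> = 1 + 4 * x - 2 * x ^ Suc m" by simp
  also have "\<dots> \<le> 1 + 4 * x - 4 * x ^ (Suc m + 1)"
  proof -
    have "x * (2 * x ^ Suc m) \<le> 1 / 2 * (2 * x ^ Suc m)" using x by (intro mult_right_mono) auto
    then show ?thesis by simp
  qed
  finally show ?case .
qed simp

text \<open>Generating function: each point has weight x^|z|_1 \<ge> x^m, and over the full box the
  weights factor into one geometric sum per coordinate.\<close>

lemma card_int_net_le:
  fixes x :: real
  assumes x: "0 < x" "x \<le> 1 / 2"
  shows "real (card (int_net n m)) \<le> (1 / x) ^ m * exp (4 * x * real n)"
proof -
  let ?Z = "{..<n} \<rightarrow>\<^sub>E {- int m..int m}"
  have "real (card (int_net n m)) * x ^ m = (\<Sum>z\<in>int_net n m. x ^ m)" by simp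
  also have "\<dots> \<le> (\<Sum>z\<in>int_net n m. \<Prod>i<n. x ^ nat \<bar>z i\<bar>)"
  proof (rule sum_mono)
    fix z assume "z \<in> int_net n m"
    then have "(\<Sum>i<n. \<bar>z i\<bar>) \<le> int m" by (simp add: int_net_def)
    moreover have "int (\<Sum>i<n. nat \<bar>z i\<bar>) = (\<Sum>i<n. \<bar>z i\<bar>)" by simp
    ultimately have "(\<Sum>i<n. nat \<bar>z i\<bar>) \<le> m" by linarith
    then have "x ^ m \<le> x ^ (\<Sum>i<n. nat \<bar>z i\<bar>)" using x by (intro power_decreasing) auto
    then show "x ^ m \<le> (\<Prod>i<n. x ^ nat \<bar>z i\<bar>)" by (simp add: power_sum)
  qed
  also have "\<dots> \<le> (\<Sum>z\<in>?Z. \<Prod>i<n. x ^ nat \<bar>z i\<bar>)"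
  proof (rule sum_mono2)
    show "finite ?Z" by (simp add: finite_PiE)
    show "int_net n m \<subseteq> ?Z" unfolding int_net_def by blast
    show "0 \<le> (\<Prod>i<n. x ^ nat \<bar>z i\<bar>)" for z
      by (intro prod_nonneg ballI zero_le_power less_imp_le[OF x(1)])
  qed
  also have "\<dots> = (\<Prod>i<n. \<Sum>k\<in>{- int m..int m}. x ^ nat \<bar>k\<bar>)"
    by (rule prod_sum_PiE[symmetric]) simp_all
  also have "\<dots> \<le> (\<Prod>i<n. exp (4 * x))"
  proof (rule prod_mono, intro conjI)
    have "(\<Sum>k\<in>{- int m..int m}. x ^ nat \<bar>k\<bar>) \<le> 1 + 4 * x - 4 * x ^ (m + 1)" by (rule two_sided_geometric_le[OF x])
    also have "\<dots> \<le> 1 + 4 * x" using x by simp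
    also have "\<dots> \<le> exp (4 * x)" by (rule exp_ge_add_one_self)
    finally show "(\<Sum>k\<in>{- int m..int m}. x ^ nat \<bar>k\<bar>) \<le> exp (4 * x)" .
    show "0 \<le> (\<Sum>k\<in>{- int m..int m}. x ^ nat \<bar>k\<bar>)"
      by (intro sum_nonneg zero_le_power less_imp_le[OF x(1)])
  qed
  also have "\<dots> = exp (4 * x * real n)" by (simp add: exp_of_nat_mult[symmetric] mult.commute)
  finally have "real (card (int_net n m)) * x ^ m \<le> exp (4 * x * real n)" .
  then show ?thesis using x by (simp add: power_divide field_simps)
qed

definition net_vec :: "nat \<Rightarrow> real \<Rightarrow> (nat \<Rightarrow> int) \<Rightarrow> nat \<Rightarrow> real"
  where "net_vec n \<delta> z = (\<lambda>i. if i < n then \<delta> * of_int (z i) else 0)"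

lemma net_vec_mem [simp]: "net_vec n \<delta> z \<in> Rn n"
  by (simp add: net_vec_def mem_Rn)

definition sparse_Rn :: "nat \<Rightarrow> nat \<Rightarrow> (nat \<Rightarrow> real) set"
  where "sparse_Rn n s = {x \<in> Rn n. card {i \<in> {..<n}. x i \<noteq> 0} \<le> s}"

lemma sparse_mono:
  assumes "x \<in> sparse_Rn n s" "y \<in> Rn n" "\<And>i. x i = 0 \<Longrightarrow> y i = 0"
  shows "y \<in> sparse_Rn n s"
proof -
  have "card {i \<in> {..<n}. y i \<noteq> 0} \<le> card {i \<in> {..<n}. x i \<noteq> 0}"
    using assms(3) by (intro card_mono) auto
  then show ?thesis using assms(1,2) by (auto simp: sparse_Rn_def)
qed

lemma norm_Rn_le_sparse:
  assumes x: "x \<in> sparse_Rn n s" and M: "\<And>i. i < n \<Longrightarrow> \<bar>x i\<bar> \<le> M" "0 \<le> M"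
  shows "norm_Rn n x \<le> sqrt (real s) * M"
proof -
  let ?S = "{i \<in> {..<n}. x i \<noteq> 0}"
  have "(\<Sum>i<n. (x i)\<^sup>2) = (\<Sum>i\<in>?S. (x i)\<^sup>2)" by (intro sum.mono_neutral_right) auto
  also have "\<dots> \<le> (\<Sum>i\<in>?S. M\<^sup>2)"
    using M by (intro sum_mono) (simp add: abs_le_square_iff[symmetric])
  also have "\<dots> = real (card ?S) * M\<^sup>2" by simp
  also have "\<dots> \<le> real s * M\<^sup>2" using x by (intro mult_right_mono) (auto simp: sparse_Rn_def)
  finally have "norm_Rn n x \<le> sqrt (real s * M\<^sup>2)" unfolding L2_set_def by (rule real_sqrt_le_mono)
  then show ?thesis using M(2) by (simp add: real_sqrt_mult)
qed

lemma l1_le_sparse: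
  assumes x: "x \<in> sparse_Rn n s"
  shows "l1_Rn n x \<le> sqrt (real s) * norm_Rn n x"
proof -
  let ?S = "{i \<in> {..<n}. x i \<noteq> 0}"
  have "l1_Rn n x = (\<Sum>i\<in>?S. \<bar>x i\<bar>)" unfolding l1_Rn_def by (intro sum.mono_neutral_right) auto
  also have "\<dots> \<le> sqrt (real (card ?S)) * norm_Rn n x" by (rule sum_abs_le_sqrt_card) auto
  also have "\<dots> \<le> sqrt (real s) * norm_Rn n x"
    using x by (intro mult_right_mono) (auto simp: sparse_Rn_def)
  finally show ?thesis .
qed

text \<open>Coordinates are rounded towards 0 to multiples of \<delta>. This does not increase the
  norm and keeps zeros, so the error remains s-sparse and has norm at most sqrt s * \<delta> =
  \<eta>. As |x|_1 \<le> sqrt s, the integer vector has l1-norm at most s / \<eta>; thus one net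
  serves all supports.\<close>

lemma sparse_net_approx:
  assumes x: "x \<in> sparse_Rn n s" "norm_Rn n x \<le> 1" and \<eta>: "0 < \<eta>" and s: "1 \<le> s"
    and m: "real s / \<eta> \<le> real m"
  defines "\<delta> \<equiv> \<eta> / sqrt (real s)"
  shows "\<exists>z\<in>int_net n m. norm_Rn n (net_vec n \<delta> z) \<le> 1 \<and>
    x - net_vec n \<delta> z \<in> sparse_Rn n s \<and> norm_Rn n (x - net_vec n \<delta> z) \<le> \<eta>"
proof -
  have \<delta>: "0 < \<delta>" using \<eta> s by (simp add: \<delta>_def)
  have xR: "x \<in> Rn n" using x by (simp add: sparse_Rn_def)
  define z where "z = (\<lambda>i\<in>{..<n}. if 0 \<le> x i then \<lfloor>x i / \<delta>\<rfloor> else - \<lfloor>- x i / \<delta>\<rfloor>)"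
  have zb: "\<delta> * \<bar>of_int (z i)\<bar> \<le> \<bar>x i\<bar>" "\<bar>x i - \<delta> * of_int (z i)\<bar> \<le> \<delta>" if "i < n" for i
  proof -
    have f: "0 \<le> real_of_int \<lfloor>t / \<delta>\<rfloor> \<and> \<delta> * of_int \<lfloor>t / \<delta>\<rfloor> \<le> t \<and> t \<le> \<delta> * of_int \<lfloor>t / \<delta>\<rfloor> + \<delta>" if "0 \<le> t" for t :: real
    proof -
      have a: "real_of_int \<lfloor>t / \<delta>\<rfloor> \<le> t / \<delta>" "t / \<delta> \<le> real_of_int \<lfloor>t / \<delta>\<rfloor> + 1" by linarith+
      have "real_of_int \<lfloor>t / \<delta>\<rfloor> * \<delta> \<le> t" using a(1) \<delta> by (simp only: pos_le_divide_eq)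
      moreover have "t \<le> (real_of_int \<lfloor>t / \<delta>\<rfloor> + 1) * \<delta>" using a(2) \<delta> by (simp only: pos_divide_le_eq)
      moreover have "0 \<le> \<lfloor>t / \<delta>\<rfloor>" using \<delta> that by simp
      ultimately show ?thesis by (simp add: distrib_left mult.commute)
    qed
    show "\<delta> * \<bar>of_int (z i)\<bar> \<le> \<bar>x i\<bar>" "\<bar>x i - \<delta> * of_int (z i)\<bar> \<le> \<delta>"
      using f[of "x i"] f[of "- x i"] that by (auto simp: z_def abs_le_iff algebra_simps)
  qed
  have zz: "z i = 0" if "i < n" "x i = 0" for i using that by (simp add: z_def)
  let ?w = "net_vec n \<delta> z"
  have "real_of_int (\<Sum>i<n. \<bar>z i\<bar>) * \<delta> = (\<Sum>i<n. \<delta> * \<bar>of_int (z i)\<bar>)"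
    by (subst mult.commute) (simp add: sum_distrib_left)
  also have "\<dots> \<le> l1_Rn n x" unfolding l1_Rn_def using zb(1) by (intro sum_mono) auto
  also have "\<dots> \<le> sqrt (real s) * norm_Rn n x" by (rule l1_le_sparse[OF x(1)])
  also have "\<dots> \<le> sqrt (real s) * 1" using x(2) by (intro mult_left_mono) auto
  finally have "real_of_int (\<Sum>i<n. \<bar>z i\<bar>) \<le> sqrt (real s) / \<delta>" using \<delta> by (simp add: field_simps)
  also have "\<dots> = real s / \<eta>" using s \<eta> by (simp add: \<delta>_def)
  finally have "real_of_int (\<Sum>i<n. \<bar>z i\<bar>) \<le> real m" using m by linarith
  then have zs: "(\<Sum>i<n. \<bar>z i\<bar>) \<le> int m" by linarith
  have "z i \<in> {- int m..int m}" if "i < n" for i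
  proof -
    have "\<bar>z i\<bar> \<le> (\<Sum>i<n. \<bar>z i\<bar>)" using that by (intro member_le_sum) auto
    then show ?thesis using zs by auto
  qed
  then have zn: "z \<in> int_net n m" using zs by (auto simp: int_net_def z_def)
  have "norm_Rn n ?w \<le> norm_Rn n x"
    unfolding L2_set_def using zb(1) \<delta>
    by (intro real_sqrt_le_mono sum_mono) (simp add: net_vec_def abs_le_square_iff[symmetric] abs_mult)
  then have w1: "norm_Rn n ?w \<le> 1" using x(2) by linarith
  have ysp: "x - ?w \<in> sparse_Rn n s"
    using zz by (intro sparse_mono[OF x(1)] subspace_diff[OF subspace_Rn] xR net_vec_mem) (auto simp: net_vec_def)
  have "norm_Rn n (x - ?w) \<le> sqrt (real s) * \<delta>"
    using zb(2) \<delta> by (intro norm_Rn_le_sparse[OF ysp]) (auto simp: net_vec_def)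
  also have "\<dots> = \<eta>" using s by (simp add: \<delta>_def)
  finally show ?thesis using zn w1 ysp by blast
qed

text \<open>
  The net controls \<^const>\<open>row_norm\<close> on all sparse vectors: the approximation error of a sparse vector is again
  sparse, so the supremum over sparse unit vectors is bounded by the net values plus a fraction of itself.
\<close>

lemma sparse_row_norm_bounds:
  assumes s: "1 \<le> s"
    and up: "\<And>z. z \<in> int_net n (1600 * s) \<Longrightarrow> norm_Rn n (net_vec n (1 / 1600 / sqrt (real s)) z) \<le> 1 \<Longrightarrow>
      row_norm n d G (net_vec n (1 / 1600 / sqrt (real s)) z) \<le> 4 * r"
    and lo: "\<And>z. z \<in> int_net n (1600 * s) \<Longrightarrow> 1 / 2 \<le> norm_Rn n (net_vec n (1 / 1600 / sqrt (real s)) z) \<Longrightarrow>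
      r / 100 \<le> row_norm n d G (net_vec n (1 / 1600 / sqrt (real s)) z)"
    and r: "0 \<le> r" and x: "x \<in> sparse_Rn n s"
  shows "row_norm n d G x \<le> 8 * r * norm_Rn n x" and "r / 200 * norm_Rn n x \<le> row_norm n d G x"
proof -
  let ?N = "row_norm n d G"
  let ?w = "net_vec n (1 / 1600 / sqrt (real s))"
  have m: "real s / (1 / 1600) \<le> real (1600 * s)" by simp
  let ?X = "{x \<in> sparse_Rn n s. norm_Rn n x \<le> 1}"
  define B where "B = (SUP x\<in>?X. ?N x)"
  have ne: "0 \<in> ?X" by (simp add: sparse_Rn_def mem_Rn)
  \<comment> \<open>\<open>B\<close> is a supremum of reals and carries meaning only once bounded.
    The row norms give a crude bound depending on G, and absorbing the error term improves it to 8
    r.\<close>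
  have bdd: "bdd_above (?N ` ?X)"
  proof (rule bdd_aboveI2)
    fix x assume "x \<in> ?X"
    then have "(\<Sum>i<d. norm_Rn n (G i)) * norm_Rn n x \<le> (\<Sum>i<d. norm_Rn n (G i)) * 1"
      by (intro mult_left_mono sum_nonneg) auto
    then show "?N x \<le> (\<Sum>i<d. norm_Rn n (G i))" using row_norm_le[of n d G x] by simp
  qed
  have scale: "?N x \<le> B * norm_Rn n x" if x: "x \<in> sparse_Rn n s" for x
  proof (cases "x = 0")
    case True
    then show ?thesis using row_norm_scaleR[of n d G 0 0] by simp
  next
    case False
    have xR: "x \<in> Rn n" using x by (simp add: sparse_Rn_def)
    have nz: "0 < norm_Rn n x" using False norm_Rn_eq_0[OF xR] L2_set_nonneg[of x "{..<n}"] by linarith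
    have "(1 / norm_Rn n x) *\<^sub>R x \<in> ?X"
      using nz by (auto simp: norm_Rn_scaleR intro!: sparse_mono[OF x] subspace_scale[OF subspace_Rn] xR)
    then have "?N ((1 / norm_Rn n x) *\<^sub>R x) \<le> B" unfolding B_def by (intro cSUP_upper bdd)
    then show ?thesis using nz by (simp add: row_norm_scaleR field_simps)
  qed
  have "B \<le> 4 * r + B / 2"
    unfolding B_def
  proof (rule cSUP_least)
    show "?X \<noteq> {}" using ne by blast
    fix x assume x: "x \<in> ?X"
    then obtain z where z: "z \<in> int_net n (1600 * s)" "norm_Rn n (?w z) \<le> 1"
      "x - ?w z \<in> sparse_Rn n s" "norm_Rn n (x - ?w z) \<le> 1 / 1600"
      using sparse_net_approx[of x n s "1 / 1600" "1600 * s"] s by auto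
    have B0: "0 \<le> B" unfolding B_def using cSUP_upper[OF ne bdd] row_norm_nonneg[of n d G 0] by linarith
    have "?N x \<le> ?N (?w z) + ?N (x - ?w z)"
      using row_norm_triangle[of n d G "?w z" "x - ?w z"] by simp
    also have "\<dots> \<le> 4 * r + B * (1 / 1600)"
      using up[OF z(1,2)] scale[OF z(3)] mult_left_mono[OF z(4) B0] by linarith
    also have "\<dots> \<le> 4 * r + B / 2" using B0 by simp
    finally show "?N x \<le> 4 * r + (SUP x\<in>?X. ?N x) / 2" unfolding B_def .
  qed
  then have B8: "B \<le> 8 * r" by simp
  have upper: "?N x \<le> 8 * r * norm_Rn n x" if x: "x \<in> sparse_Rn n s" for x
    using scale[OF x] mult_right_mono[OF B8, of "norm_Rn n x"] by simp
  have unit: "r / 200 \<le> ?N x" if x: "x \<in> sparse_Rn n s" "norm_Rn n x = 1" for x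
  proof -
    obtain z where z: "z \<in> int_net n (1600 * s)" "norm_Rn n (?w z) \<le> 1"
      "x - ?w z \<in> sparse_Rn n s" "norm_Rn n (x - ?w z) \<le> 1 / 1600"
      using sparse_net_approx[of x n s "1 / 1600" "1600 * s"] s x by auto
    have "norm_Rn n x \<le> norm_Rn n (?w z) + norm_Rn n (x - ?w z)"
      using norm_Rn_triangle[of "?w z" "x - ?w z" n] by simp
    then have "1 / 2 \<le> norm_Rn n (?w z)" using z(4) x(2) by linarith
    from lo[OF z(1) this] have "r / 100 \<le> ?N (?w z)" .
    also have "\<dots> \<le> ?N x + ?N (x - ?w z)"
      using row_norm_diff[of n d G x "x - ?w z"] by simp
    \<comment> \<open>8 / 1600 = 1 / 200 is half of the 1 / 100 granted on the net, which explains
      the mesh 1 / 1600.\<close>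
    also have "?N (x - ?w z) \<le> 8 * r * (1 / 1600)"
      using upper[OF z(3)] mult_left_mono[OF z(4), of "8 * r"] r by linarith
    finally show ?thesis by simp
  qed
  show "?N x \<le> 8 * r * norm_Rn n x" by (rule upper[OF x])
  show "r / 200 * norm_Rn n x \<le> ?N x"
  proof (cases "x = 0")
    case True
    then show ?thesis by (simp add: row_norm_nonneg)
  next
    case False
    have xR: "x \<in> Rn n" using x by (simp add: sparse_Rn_def)
    have nz: "0 < norm_Rn n x" using False norm_Rn_eq_0[OF xR] L2_set_nonneg[of x "{..<n}"] by linarith
    have "r / 200 \<le> ?N ((1 / norm_Rn n x) *\<^sub>R x)"
      using nz by (intro unit) (auto simp: norm_Rn_scaleR intro!: sparse_mono[OF x] subspace_scale[OF subspace_Rn] xR)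
    then show ?thesis using nz by (simp add: row_norm_scaleR field_simps)
  qed
qed

section \<open>From sparse vectors to kernel vectors\<close>

lemma exists_largest_subset:
  fixes f :: "'a \<Rightarrow> real"
  assumes "finite A" "s \<le> card A"
  shows "\<exists>T\<subseteq>A. card T = s \<and> (\<forall>i\<in>T. \<forall>j\<in>A - T. f j \<le> f i)"
  using assms(2)
proof (induction s)
  case 0
  then show ?case by (intro exI[of _ "{}"]) auto
next
  case (Suc s)
  then obtain T where T: "T \<subseteq> A" "card T = s" "\<forall>i\<in>T. \<forall>j\<in>A - T. f j \<le> f i" by auto
  have fin: "finite T" "finite (A - T)" using T assms(1) finite_subset by auto
  have "A - T \<noteq> {}"
  proof
    assume "A - T = {}"
    then have "card A \<le> card T" using fin by (intro card_mono) auto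
    then show False using Suc.prems T by simp
  qed
  then have "Max (f ` (A - T)) \<in> f ` (A - T)" using fin by (intro Max_in) auto
  then obtain t where t: "t \<in> A - T" "f t = Max (f ` (A - T))" by auto
  then have "f j \<le> f t" if "j \<in> A - T" for j using fin that by simp
  then show ?case
    using T t fin by (intro exI[of _ "insert t T"]) auto
qed

definition restrict_Rn :: "nat set \<Rightarrow> (nat \<Rightarrow> real) \<Rightarrow> nat \<Rightarrow> real"
  where "restrict_Rn T v = (\<lambda>i. if i \<in> T then v i else 0)"

lemma restrict_Rn_mem: "v \<in> Rn n \<Longrightarrow> restrict_Rn T v \<in> Rn n"
  by (auto simp: restrict_Rn_def mem_Rn)

lemma restrict_Rn_split: "restrict_Rn T v + restrict_Rn (- T) v = v"
  by (auto simp: restrict_Rn_def fun_eq_iff)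

lemma restrict_Rn_sparse:
  assumes "v \<in> Rn n" "T \<subseteq> {..<n}" "card T \<le> s"
  shows "restrict_Rn T v \<in> sparse_Rn n s"
proof -
  have "card {i \<in> {..<n}. restrict_Rn T v i \<noteq> 0} \<le> card T"
    using assms(2) finite_subset[OF assms(2)] by (intro card_mono) (auto simp: restrict_Rn_def)
  then show ?thesis using assms restrict_Rn_mem by (auto simp: sparse_Rn_def)
qed

lemma l1_restrict: "T \<subseteq> {..<n} \<Longrightarrow> l1_Rn n (restrict_Rn T v) = (\<Sum>i\<in>T. \<bar>v i\<bar>)"
  unfolding l1_Rn_def by (intro sum.mono_neutral_cong_right) (auto simp: restrict_Rn_def)

lemma l1_restrict_split: "l1_Rn n v = l1_Rn n (restrict_Rn T v) + l1_Rn n (restrict_Rn (- T) v)"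
  unfolding l1_Rn_def sum.distrib[symmetric] by (intro sum.cong) (auto simp: restrict_Rn_def)

text \<open>Sorting the coordinates into blocks of size \<open>s\<close>, each entry of a block is at most the mean of the previous one.\<close>

lemma row_norm_le_block_sum:
  assumes B: "0 \<le> B" "\<And>u. u \<in> sparse_Rn n s \<Longrightarrow> row_norm n d G u \<le> B * norm_Rn n u" and s: "1 \<le> s"
    and v: "v \<in> Rn n" "\<And>i. i < n \<Longrightarrow> \<bar>v i\<bar> \<le> M" "0 \<le> M"
  shows "row_norm n d G v \<le> B * (sqrt (real s) * M + l1_Rn n v / sqrt (real s))"
  using v
proof (induction "card {i \<in> {..<n}. v i \<noteq> 0}" arbitrary: v M rule: less_induct)
  case less
  let ?A = "{i \<in> {..<n}. v i \<noteq> 0}"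
  have sp: "row_norm n d G u \<le> B * (sqrt (real s) * M)"
    if u: "u \<in> sparse_Rn n s" "\<And>i. i < n \<Longrightarrow> \<bar>u i\<bar> \<le> M" for u
  proof -
    have "row_norm n d G u \<le> B * norm_Rn n u" by (rule B(2)[OF u(1)])
    also have "\<dots> \<le> B * (sqrt (real s) * M)"
      using norm_Rn_le_sparse[OF u less.prems(3)] B(1) by (intro mult_left_mono)
    finally show ?thesis .
  qed
  show ?case
  proof (cases "card ?A \<le> s")
    case True
    then have "v \<in> sparse_Rn n s" using less.prems(1) by (simp add: sparse_Rn_def)
    from sp[OF this less.prems(2)] have "row_norm n d G v \<le> B * (sqrt (real s) * M)" .
    also have "\<dots> \<le> B * (sqrt (real s) * M + l1_Rn n v / sqrt (real s))"
      using B(1) l1_Rn_nonneg[of n v] by (intro mult_left_mono) auto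
    finally show ?thesis .
  next
    case False
    then obtain T where T: "T \<subseteq> ?A" "card T = s" "\<forall>i\<in>T. \<forall>j\<in>?A - T. \<bar>v j\<bar> \<le> \<bar>v i\<bar>"
      using exists_largest_subset[of ?A s "\<lambda>i. \<bar>v i\<bar>"] by auto
    have Tn: "T \<subseteq> {..<n}" using T(1) by auto
    have finT: "finite T" using Tn finite_subset by blast
    have Tne: "T \<noteq> {}" using T(2) s by auto
    define M' where "M' = Min ((\<lambda>i. \<bar>v i\<bar>) ` T)"
    have M': "M' \<le> \<bar>v i\<bar>" if "i \<in> T" for i using that finT by (simp add: M'_def)
    have "M' \<in> (\<lambda>i. \<bar>v i\<bar>) ` T" unfolding M'_def using finT Tne by (intro Min_in) auto
    then obtain t where t: "t \<in> T" "M' = \<bar>v t\<bar>" by auto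
    let ?x = "restrict_Rn T v" and ?y = "restrict_Rn (- T) v"
    have y: "\<bar>?y i\<bar> \<le> M'" if "i < n" for i
      using T(3) t that by (cases "v i = 0") (auto simp: restrict_Rn_def)
    have "{i \<in> {..<n}. ?y i \<noteq> 0} \<subset> ?A" using t T(1) by (auto simp: restrict_Rn_def)
    then have "card {i \<in> {..<n}. ?y i \<noteq> 0} < card ?A" by (intro psubset_card_mono) auto
    then have IH: "row_norm n d G ?y \<le> B * (sqrt (real s) * M' + l1_Rn n ?y / sqrt (real s))"
      using y t by (intro less.hyps restrict_Rn_mem less.prems(1)) auto
    have "sqrt (real s) * M' = real s * M' / sqrt (real s)"
      using s by (simp add: field_simps)
    also have "real s * M' = (\<Sum>i\<in>T. M')" by (simp add: T(2))
    also have "\<dots> \<le> l1_Rn n ?x" unfolding l1_restrict[OF Tn] by (intro sum_mono M')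
    finally have m: "sqrt (real s) * M' \<le> l1_Rn n ?x / sqrt (real s)" by (simp add: divide_right_mono)
    have "row_norm n d G v \<le> row_norm n d G ?x + row_norm n d G ?y"
      using row_norm_triangle[of n d G ?x ?y] unfolding restrict_Rn_split .
    also have "row_norm n d G ?x \<le> B * (sqrt (real s) * M)"
      using Tn T(2) less.prems by (intro sp restrict_Rn_sparse) (auto simp: restrict_Rn_def)
    also have "row_norm n d G ?y \<le> B * (l1_Rn n ?x / sqrt (real s) + l1_Rn n ?y / sqrt (real s))"
      using IH m B(1) by (elim order_trans) (intro mult_left_mono, auto)
    also have "l1_Rn n ?x / sqrt (real s) + l1_Rn n ?y / sqrt (real s) = l1_Rn n v / sqrt (real s)"
      unfolding l1_restrict_split[of n v T] by (simp add: add_divide_distrib)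
    finally show ?thesis by (simp add: distrib_left)
  qed
qed

text \<open>Split v at height a = |v|_1 / s into x, the at most s larger entries, and y, and put q =
  |v|_1 / sqrt s. As v is in the kernel, x and y have images of equal size, so (r/200) |x| \<le> 16
  r q by the block estimate for y, giving |x| \<le> 3200 q. Moreover |y|^2 \<le> a |v|_1 = q^2; the
  sum gives 3201.\<close>

lemma kernel_norm_le_l1:
  assumes r: "0 < r" and s: "1 \<le> s"
    and up: "\<And>u. u \<in> sparse_Rn n s \<Longrightarrow> row_norm n d G u \<le> 8 * r * norm_Rn n u"
    and lo: "\<And>u. u \<in> sparse_Rn n s \<Longrightarrow> r / 200 * norm_Rn n u \<le> row_norm n d G u"
    and v: "v \<in> Rn n" "row_norm n d G v = 0"
  shows "norm_Rn n v \<le> 3201 * (l1_Rn n v / sqrt (real s))"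
proof -
  define a where "a = l1_Rn n v / real s"
  define T where "T = {i \<in> {..<n}. a < \<bar>v i\<bar>}"
  have a0: "0 \<le> a" by (simp add: a_def l1_Rn_nonneg)
  have Tn: "T \<subseteq> {..<n}" by (auto simp: T_def)
  have finT: "finite T" using Tn finite_subset by blast
  have cT: "card T \<le> s"
  proof (cases "l1_Rn n v = 0")
    case True
    have "\<bar>v i\<bar> \<le> l1_Rn n v" if "i < n" for i unfolding l1_Rn_def using that by (intro member_le_sum) auto
    then have "T = {}" using True a0 by (force simp: T_def)
    then show ?thesis by simp
  next
    case False
    then have l: "0 < l1_Rn n v" using l1_Rn_nonneg[of n v] by linarith
    have "real (card T) * a = (\<Sum>i\<in>T. a)" by simp
    also have "\<dots> \<le> (\<Sum>i\<in>T. \<bar>v i\<bar>)" by (intro sum_mono) (auto simp: T_def)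
    also have "\<dots> \<le> l1_Rn n v" unfolding l1_Rn_def using Tn by (intro sum_mono2) auto
    finally have "real (card T) * (l1_Rn n v / real s) \<le> l1_Rn n v" by (simp add: a_def)
    then have "real (card T) \<le> real s" using l s by (simp add: field_simps)
    then show ?thesis by simp
  qed
  let ?x = "restrict_Rn T v" and ?y = "restrict_Rn (- T) v"
  let ?q = "l1_Rn n v / sqrt (real s)"
  have xs: "?x \<in> sparse_Rn n s" by (rule restrict_Rn_sparse[OF v(1) Tn cT])
  have yb: "\<bar>?y i\<bar> \<le> a" if "i < n" for i using that a0 by (auto simp: restrict_Rn_def T_def)
  have ly: "l1_Rn n ?y \<le> l1_Rn n v"
    using l1_restrict_split[of n v T] l1_Rn_nonneg[of n ?x] by simp
  have sa: "sqrt (real s) * a = ?q" using s by (simp add: a_def field_simps)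
  have "row_norm n d G ?y \<le> 8 * r * (sqrt (real s) * a + l1_Rn n ?y / sqrt (real s))"
    using r by (intro row_norm_le_block_sum[OF _ up s restrict_Rn_mem[OF v(1)] yb a0]) auto
  also have "\<dots> \<le> 8 * r * (?q + ?q)"
    unfolding sa using r ly by (intro mult_left_mono add_left_mono divide_right_mono) auto
  finally have Ny: "row_norm n d G ?y \<le> 16 * r * ?q" by simp
  have xeq: "?x = v - ?y" using restrict_Rn_split[of T v] by (metis add_diff_cancel_right')
  have "row_norm n d G ?x \<le> row_norm n d G v + row_norm n d G ?y"
    unfolding xeq by (rule row_norm_diff)
  then have "r / 200 * norm_Rn n ?x \<le> 16 * r * ?q" using lo[OF xs] Ny v(2) by linarith
  then have "r * norm_Rn n ?x \<le> r * (3200 * ?q)" by (simp add: mult_ac)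
  then have nx: "norm_Rn n ?x \<le> 3200 * ?q" by (rule mult_left_le_imp_le[OF _ r])
  have "(norm_Rn n ?y)\<^sup>2 \<le> a * l1_Rn n v"
  proof -
    have "(norm_Rn n ?y)\<^sup>2 = (\<Sum>i<n. \<bar>?y i\<bar> * \<bar>?y i\<bar>)"
      by (simp add: inner_Rn_self[symmetric] inner_Rn_def)
    also have "\<dots> \<le> (\<Sum>i<n. a * \<bar>?y i\<bar>)" using yb by (intro sum_mono mult_right_mono) auto
    also have "\<dots> = a * l1_Rn n ?y" by (simp add: l1_Rn_def sum_distrib_left)
    also have "\<dots> \<le> a * l1_Rn n v" using ly a0 by (intro mult_left_mono)
    finally show ?thesis .
  qed
  also have "a * l1_Rn n v = ?q\<^sup>2" using s by (simp add: a_def power_divide power2_eq_square)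
  finally have ny: "norm_Rn n ?y \<le> ?q"
    by (rule power2_le_imp_le) (simp add: l1_Rn_nonneg)
  have "norm_Rn n v \<le> norm_Rn n ?x + norm_Rn n ?y"
    using norm_Rn_triangle[of ?x ?y n] unfolding restrict_Rn_split .
  then show ?thesis using nx ny by simp
qed

section \<open>The estimate under the Haar measure\<close>

lemma supp_unit_cube: "supp_Rn n (unit_cube n) \<theta> = l1_Rn n \<theta> / 2"
proof (rule antisym[OF supp_unit_cube_le])
  note Q = convex_body_facts[OF convex_body_unit_cube[of n]]
  let ?x = "\<lambda>i. if i < n then 1 / 2 else 0 :: real"
  have "?x \<in> unit_cube n" by (auto simp: unit_cube_def mem_Rn)
  from unconditional_l1_le_supp[OF Q(1,2) unconditional_unit_cube Q(4) this, of \<theta>]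
  show "l1_Rn n \<theta> / 2 \<le> supp_Rn n (unit_cube n) \<theta>" by (simp add: l1_Rn_def sum_divide_distrib)
qed

lemma sets_l1_ge:
  assumes d: "d \<le> n"
  shows "{F \<in> grassmannian n (n - d). \<forall>\<theta>\<in>F. t * norm_Rn n \<theta> \<le> l1_Rn n \<theta>} \<in> sets (grassmannian_borel n (n - d))"
  using sets_supp_ge[OF d convex_body_facts(1,3)[OF convex_body_unit_cube], of "t / 2" n]
  by (simp add: supp_unit_cube)

text \<open>The weight x = d / (10 e n) balances both factors of the cardinality bound: ln(1/x) = ln
  10 + L \<le> 4 L gives m ln(1/x) \<le> 2d/5, and 4 x n \<le> 2d/5 as well.\<close>

lemma int_net_log_card:
  assumes d: "1 \<le> d" "d < n"
    and m: "real m \<le> real d / (10 * ln (exp 1 * real n / real d))"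
  shows "real (card (int_net n m)) \<le> exp (real d)"
proof -
  define L where "L = ln (exp 1 * real n / real d)"
  have L1: "1 \<le> L" unfolding L_def using ln_ratio_bounds[OF d] by simp
  define x where "x = real d / (10 * (exp 1 * real n))"
  have e1: "(1::real) \<le> exp 1" by simp
  have x0: "0 < x" using d by (simp add: x_def)
  have "real d * 1 \<le> real n * exp 1" using d by (intro mult_mono) auto
  then have xn: "10 * x \<le> 1" using d by (simp add: x_def field_simps)
  have "ln (1 / x) = ln (10 * (exp 1 * real n / real d))" by (simp add: x_def)
  also have "\<dots> = ln 10 + L" unfolding L_def using d by (subst ln_mult) auto
  also have "ln (10::real) \<le> 3"
  proof -
    have "(10::real) \<le> (1 + 1 + 1 / 2) ^ 3" by (simp add: power3_eq_cube)
    also have "\<dots> \<le> exp 1 ^ 3"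
      using exp_lower_Taylor_quadratic[of 1] by (intro power_mono) auto
    also have "\<dots> = exp (3::real)" by (simp flip: exp_of_nat_mult)
    finally have "ln (10::real) \<le> ln (exp 3)" by (intro ln_mono) auto
    then show ?thesis by simp
  qed
  finally have lx: "ln (1 / x) \<le> 4 * L" using L1 by simp
  have "real m * ln (1 / x) \<le> real d / (10 * L) * (4 * L)"
  proof (rule mult_mono)
    show "real m \<le> real d / (10 * L)" using m by (simp add: L_def)
    show "0 \<le> ln (1 / x)" using x0 xn by simp
  qed (use lx L1 in auto)
  also have "\<dots> = 2 / 5 * real d" using L1 by simp
  finally have a: "real m * ln (1 / x) \<le> 2 / 5 * real d" .
  have "4 * x * real n = 4 * real d / (10 * exp 1)" using d by (simp add: x_def)
  also have "\<dots> \<le> 4 * real d / (10 * 1)" using e1 by (intro divide_left_mono mult_left_mono) auto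
  finally have b: "4 * x * real n \<le> 2 / 5 * real d" by simp
  have "real (card (int_net n m)) \<le> (1 / x) ^ m * exp (4 * x * real n)"
    using x0 xn by (intro card_int_net_le) auto
  also have "(1 / x) ^ m = exp (real m * ln (1 / x))" using x0 by (simp add: exp_of_nat_mult)
  also have "exp (real m * ln (1 / x)) * exp (4 * x * real n) = exp (real m * ln (1 / x) + 4 * x * real n)"
    by (simp add: exp_add)
  also have "\<dots> \<le> exp (real d)" using a b by simp
  finally show ?thesis .
qed

text \<open>Union bound over at most exp(d) net points with two tails each: 2 exp(d) exp(-3d) \<le>
  2 exp(-2) \<le> 1/2.\<close>

lemma prob_sparse_bounds:
  assumes d: "1 \<le> d" "d < n" and s: "1 \<le> s"
    and m: "real (1600 * s) \<le> real d / (10 * ln (exp 1 * real n / real d))"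
  shows "\<exists>E\<in>sets (gauss_mat n). 1 / 2 \<le> measure (gauss_mat n) E \<and>
    (\<forall>G\<in>E. \<forall>v\<in>Rn n. row_norm n d G v = 0 \<longrightarrow> norm_Rn n v \<le> 3201 * (l1_Rn n v / sqrt (real s)))"
proof -
  interpret P: prob_space "gauss_mat n" by (rule prob_space_gauss_mat)
  have dn: "d \<le> n" and n: "0 < n" using d by auto
  note [measurable] = measurable_row_norm[OF dn]
  let ?Z = "int_net n (1600 * s)"
  let ?w = "net_vec n (1 / 1600 / sqrt (real s))"
  \<comment> \<open>The norm condition belongs to the event, so net points out of range give the
    empty set. The thresholds of \<open>U\<close> and \<open>W\<close> are the squares of 4 r and r
    / 100 for r = sqrt d.\<close>
  define U where "U z = {G \<in> space (gauss_mat n). norm_Rn n (?w z) \<le> 1 \<and> 16 * real d \<le> (row_norm n d G (?w z))\<^sup>2}" for z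
  define W where "W z = {G \<in> space (gauss_mat n). 1 / 2 \<le> norm_Rn n (?w z) \<and> (row_norm n d G (?w z))\<^sup>2 \<le> real d / 10000}" for z
  have ms: "U z \<in> sets (gauss_mat n)" "W z \<in> sets (gauss_mat n)" for z unfolding U_def W_def by measurable
  have mU: "P.prob (U z) \<le> exp (- 3 * real d)" for z
  proof (cases "norm_Rn n (?w z) \<le> 1")
    case True
    then show ?thesis using row_norm_upper_tail[OF dn n, of "?w z"] by (simp add: U_def)
  qed (simp add: U_def)
  have mW: "P.prob (W z) \<le> exp (- 3 * real d)" for z
  proof (cases "1 / 2 \<le> norm_Rn n (?w z)")
    case True
    then show ?thesis using row_norm_lower_tail[OF dn n, of "?w z"] by (simp add: W_def)
  qed (simp add: W_def)
  define Bad where "Bad = (\<Union>z\<in>?Z. U z \<union> W z)"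
  have mBad: "Bad \<in> sets (gauss_mat n)"
    unfolding Bad_def using finite_int_net ms by (intro sets.finite_UN sets.Un) auto
  have "P.prob Bad \<le> (\<Sum>z\<in>?Z. P.prob (U z \<union> W z))"
    unfolding Bad_def using finite_int_net ms by (intro P.finite_measure_subadditive_finite) auto
  also have "\<dots> \<le> (\<Sum>z\<in>?Z. 2 * exp (- 3 * real d))"
  proof (rule sum_mono)
    fix z
    have "P.prob (U z \<union> W z) \<le> P.prob (U z) + P.prob (W z)" by (intro measure_Un_le ms)
    then show "P.prob (U z \<union> W z) \<le> 2 * exp (- 3 * real d)" using mU[of z] mW[of z] by linarith
  qed
  also have "\<dots> = real (card ?Z) * (2 * exp (- 3 * real d))" by simp
  also have "\<dots> \<le> exp (real d) * (2 * exp (- 3 * real d))"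
    using int_net_log_card[OF d m] by (intro mult_right_mono) auto
  also have "\<dots> = 2 * exp (- 2 * real d)" by (simp add: mult_exp_exp)
  also have "\<dots> \<le> 2 * exp (- 2)" using d by simp
  also have "\<dots> \<le> 1 / 2"
  proof -
    have "(2::real) * 2 \<le> exp 1 * exp 1" using exp_ge_add_one_self[of 1] by (intro mult_mono) auto
    then have "4 \<le> exp (2::real)" by (simp add: mult_exp_exp)
    then show ?thesis by (simp add: exp_minus field_simps)
  qed
  finally have pB: "P.prob Bad \<le> 1 / 2" .
  define E where "E = space (gauss_mat n) - Bad"
  have "P.prob E = 1 - P.prob Bad" unfolding E_def by (rule P.prob_compl[OF mBad])
  then have pE: "1 / 2 \<le> P.prob E" using pB by simp
  have "norm_Rn n v \<le> 3201 * (l1_Rn n v / sqrt (real s))"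
    if G: "G \<in> E" and v: "v \<in> Rn n" "row_norm n d G v = 0" for G v
  proof -
    have sq: "sqrt (real d) > 0" using d by simp
    have up: "row_norm n d G (?w z) \<le> 4 * sqrt (real d)" if z: "z \<in> ?Z" "norm_Rn n (?w z) \<le> 1" for z
    proof -
      have "G \<notin> U z" using G z(1) by (auto simp: E_def Bad_def)
      then have "(row_norm n d G (?w z))\<^sup>2 \<le> 16 * real d" using G z(2) by (auto simp: E_def U_def)
      also have "\<dots> = (4 * sqrt (real d))\<^sup>2" by (simp add: power_mult_distrib)
      finally show ?thesis by (rule power2_le_imp_le) simp
    qed
    have lo: "sqrt (real d) / 100 \<le> row_norm n d G (?w z)" if z: "z \<in> ?Z" "1 / 2 \<le> norm_Rn n (?w z)" for z
    proof -
      have "G \<notin> W z" using G z(1) by (auto simp: E_def Bad_def)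
      then have "real d / 10000 \<le> (row_norm n d G (?w z))\<^sup>2" using G z(2) by (auto simp: E_def W_def)
      moreover have "(sqrt (real d) / 100)\<^sup>2 = real d / 10000" by (simp add: power_divide)
      ultimately have "(sqrt (real d) / 100)\<^sup>2 \<le> (row_norm n d G (?w z))\<^sup>2" by simp
      then show ?thesis by (rule power2_le_imp_le) (rule row_norm_nonneg)
    qed
    note b = sparse_row_norm_bounds[where G=G and d=d and n=n and r="sqrt (real d)", OF s up lo]
    show ?thesis
      using sq b by (intro kernel_norm_le_l1[OF sq s _ _ v]) auto
  qed
  then show ?thesis using pE mBad unfolding E_def by (intro bexI[of _ "space (gauss_mat n) - Bad"]) auto
qed

text \<open>If d < 16000 L, the rate is below 600000 and |\<theta>|_2 \<le> |\<theta>|_1 already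
  suffices. Otherwise there is room for a sparsity s \<ge> 1 on which the Gaussian rows are
  controlled, and their kernel inherits the bound.\<close>

theorem haar_l1_ge:
  assumes d: "1 \<le> d" "d < n"
  shows "1 / 2 \<le> measure (haar_grassmannian n (n - d))
    {F \<in> grassmannian n (n - d). \<forall>\<theta>\<in>F. rate n d / 600000 * norm_Rn n \<theta> \<le> l1_Rn n \<theta>}"
proof -
  interpret P: prob_space "gauss_mat n" by (rule prob_space_gauss_mat)
  have dn: "d \<le> n" using d by simp
  define L where "L = ln (exp 1 * real n / real d)"
  have L1: "1 \<le> L" unfolding L_def using ln_ratio_bounds[OF d] by simp
  let ?A = "{F \<in> grassmannian n (n - d). \<forall>\<theta>\<in>F. rate n d / 600000 * norm_Rn n \<theta> \<le> l1_Rn n \<theta>}"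
  let ?X = "\<lambda>G. orth_comp_Rn n d (frame_Rn n G)"
  note X = measurable_orth_comp_frame[OF dn]
  have A: "?A \<in> sets (grassmannian_borel n (n - d))" by (rule sets_l1_ge[OF dn])
  have Xg: "?X G \<in> grassmannian n (n - d)" for G
    using orthonormal_frame by (auto simp: grassmannian_eq[OF dn])
  have mA: "?X -` ?A \<inter> space (gauss_mat n) \<in> sets (gauss_mat n)" by (rule measurable_sets[OF X A])
  have eq: "measure (haar_grassmannian n (n - d)) ?A = P.prob (?X -` ?A \<inter> space (gauss_mat n))"
    unfolding haar_grassmannian_eq[OF dn] gauss_kernel_def by (rule measure_distr[OF X A])
  show ?thesis
  proof (cases "16000 * L \<le> real d")
    case False
    then have "real d / L \<le> 16000" using L1 by (simp add: field_simps)
    also have "\<dots> \<le> 600000\<^sup>2" by simp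
    finally have "sqrt (real d / L) \<le> 600000" by (rule real_le_lsqrt[rotated]) simp
    then have "rate n d / 600000 \<le> 1" by (simp add: rate_def L_def)
    then have "rate n d / 600000 * norm_Rn n \<theta> \<le> 1 * norm_Rn n \<theta>" for \<theta> :: "nat \<Rightarrow> real"
      by (intro mult_right_mono) auto
    then have "rate n d / 600000 * norm_Rn n \<theta> \<le> l1_Rn n \<theta>" for \<theta> :: "nat \<Rightarrow> real"
      using norm_le_l1_Rn[of \<theta> n] by (metis mult_1 order_trans)
    then have "?X -` ?A \<inter> space (gauss_mat n) = space (gauss_mat n)" using Xg by auto
    then show ?thesis unfolding eq using P.prob_space by simp
  next
    case True
    \<comment> \<open>The net has parameter 1600 s, and its size stays below exp(d) once 16000 s L
      \<le> d.\<close>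
    define s where "s = nat \<lfloor>real d / (16000 * L)\<rfloor>"
    have y1: "1 \<le> real d / (16000 * L)" using True L1 by (simp add: field_simps)
    then have fl: "1 \<le> \<lfloor>real d / (16000 * L)\<rfloor>" by linarith
    have s1: "1 \<le> s" using fl unfolding s_def by linarith
    have sr: "real s = real_of_int \<lfloor>real d / (16000 * L)\<rfloor>" using fl by (simp add: s_def)
    have s2: "real s \<le> real d / (16000 * L)" unfolding sr by linarith
    have s3: "real d / (32000 * L) \<le> real s"
    proof -
      have "real d / (16000 * L) < real s + 1" unfolding sr by linarith
      moreover have "1 \<le> real s" using s1 by simp
      ultimately have "real d / (16000 * L) \<le> 2 * real s" by linarith
      then show ?thesis by simp
    qed
    have m: "real (1600 * s) \<le> real d / (10 * ln (exp 1 * real n / real d))"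
      using s2 L1 unfolding L_def[symmetric] by (simp add: field_simps)
    obtain E where E: "E \<in> sets (gauss_mat n)" "1 / 2 \<le> P.prob E"
      and good: "\<And>G v. G \<in> E \<Longrightarrow> v \<in> Rn n \<Longrightarrow> row_norm n d G v = 0 \<Longrightarrow> norm_Rn n v \<le> 3201 * (l1_Rn n v / sqrt (real s))"
      using prob_sparse_bounds[OF d s1 m] by blast
    \<comment> \<open>Rounding loses at most a factor 2, so s \<ge> d / (32000 L) and rate \<le> 180
      sqrt s, as 180^2 \<ge> 32000. The constant 600000 exceeds 180 * 3201.\<close>
    have rs: "rate n d * 3201 \<le> 600000 * sqrt (real s)"
    proof -
      have "1 \<le> sqrt (real d / L)"
        using True L1 by (simp add: field_simps)
      then have "rate n d = sqrt (real d / L)" by (simp add: rate_def L_def)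
      also have "\<dots> \<le> sqrt (180\<^sup>2 * real s)"
        using s3 L1 by (intro real_sqrt_le_mono) (simp add: field_simps)
      also have "\<dots> = 180 * sqrt (real s)" by (simp add: real_sqrt_mult)
      finally have "rate n d \<le> 180 * sqrt (real s)" .
      moreover have "0 \<le> sqrt (real s)" by simp
      ultimately show ?thesis by linarith
    qed
    \<comment> \<open>Only almost surely, because \<open>frame_Rn\<close> is the Gram-Schmidt frame
      of the rows off a null set; there, vectors of the subspace are annihilated by the first d
      rows.\<close>
    have "AE G in gauss_mat n. G \<in> E \<longrightarrow> G \<in> ?X -` ?A \<inter> space (gauss_mat n)"
      using AE_orthonormal_gram_schmidt AE_space
    proof eventually_elim
      case (elim G)
      show ?case
      proof
        assume GE: "G \<in> E"
        have "rate n d / 600000 * norm_Rn n v \<le> l1_Rn n v" if v: "v \<in> ?X G" for v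
        proof -
          have vR: "v \<in> Rn n" using v by (simp add: orth_comp_Rn_def)
          have o: "inner_Rn n (gram_schmidt_Rn n G i) v = 0" if "i < d" for i
            using v that elim(1) by (simp add: orth_comp_Rn_def frame_Rn_def)
          have "inner_Rn n (G i) v = 0" if "i < d" for i
          proof -
            have "inner_Rn n (extend_Rn n (G i)) v = 0" using o that by (intro gram_schmidt_spans[OF vR]) auto
            then show ?thesis by (simp add: inner_Rn_def extend_Rn_def)
          qed
          then have "row_norm n d G v = 0" by (simp add: row_norm_def L2_set_def)
          from good[OF GE vR this] have nv: "norm_Rn n v \<le> 3201 * (l1_Rn n v / sqrt (real s))" .
          have r0: "0 \<le> rate n d" by (simp add: rate_def le_max_iff_disj)
          have "rate n d / 600000 * norm_Rn n v \<le> rate n d / 600000 * (3201 * (l1_Rn n v / sqrt (real s)))"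
            using nv r0 by (intro mult_left_mono) auto
          also have "\<dots> = (rate n d * 3201) * (l1_Rn n v / (600000 * sqrt (real s)))" by simp
          also have "\<dots> \<le> (600000 * sqrt (real s)) * (l1_Rn n v / (600000 * sqrt (real s)))"
            using rs l1_Rn_nonneg[of n v] by (intro mult_right_mono) auto
          also have "\<dots> = l1_Rn n v" using s1 by simp
          finally show ?thesis .
        qed
        then show "G \<in> ?X -` ?A \<inter> space (gauss_mat n)" using Xg elim(2) by auto
      qed
    qed
    then have "P.prob E \<le> P.prob (?X -` ?A \<inter> space (gauss_mat n))"
      by (rule P.finite_measure_mono_AE) (rule mA)
    then show ?thesis unfolding eq using E(2) by linarith
  qed
qed

section \<open>Extremality of the cube\<close>

text \<open>The event \<open>?E\<close> speaks of the l1-norm alone and is the same for every body;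
  the support bound carries it into the inradius event of each K, which is how the infimum is
  controlled.\<close>

lemma prob_inradius_ge_half:
  fixes c :: real
  assumes d: "1 \<le> d" "d < n" and K: "K \<in> unc_isotropic n"
  defines "c \<equiv> sqrt (1 / (8 * pi * exp 1) / 1032) / 600000"
  shows "1 / 2 \<le> prob_inradius_ge n d K (c * rate n d)"
proof -
  have dn: "d \<le> n" and n: "0 < n" using d by auto
  define c0 where "c0 = sqrt (1 / (8 * pi * exp 1) / 1032)"
  have c0: "0 < c0" by (simp add: c0_def)
  have cc: "c = c0 / 600000" by (simp add: c_def c0_def)
  have r1: "1 \<le> rate n d" by (simp add: rate_def)
  have "convex_body n K" using K by (simp add: unc_isotropic_def isotropic_def)
  note Kc = convex_body_facts[OF this]
  have supp: "c0 * l1_Rn n \<theta> \<le> supp_Rn n K \<theta>" for \<theta>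
    using unc_isotropic_supp_ge[OF n K] by (simp add: c0_def)
  have supp': "c0 * norm_Rn n \<theta> \<le> supp_Rn n K \<theta>" for \<theta>
    using supp[of \<theta>] mult_left_mono[OF norm_le_l1_Rn[of \<theta> n], of c0] c0 by linarith
  have pos: "0 < c * rate n d" using c0 r1 by (simp add: cc)
  have iff: "c * rate n d \<le> proj_inradius n K F \<longleftrightarrow> (\<forall>\<theta>\<in>F. c * rate n d * norm_Rn n \<theta> \<le> supp_Rn n K \<theta>)"
    if "F \<in> grassmannian n (n - d)" for F
    by (rule proj_inradius_ge_iff[OF d(2) that Kc(1,3,2,4) c0 supp' pos])
  let ?E = "{F \<in> grassmannian n (n - d). \<forall>\<theta>\<in>F. rate n d / 600000 * norm_Rn n \<theta> \<le> l1_Rn n \<theta>}"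
  let ?H = "haar_grassmannian n (n - d)"
  have haar: "is_haar_grassmannian n (n - d) ?H"
    unfolding haar_grassmannian_eq[OF dn] by (rule is_haar_gauss_kernel[OF dn])
  interpret prob_space ?H using haar by (simp add: is_haar_grassmannian_def)
  have sH: "sets ?H = sets (grassmannian_borel n (n - d))" using haar by (simp add: is_haar_grassmannian_def)
  have "?E \<subseteq> {F \<in> grassmannian n (n - d). \<forall>\<theta>\<in>F. c * rate n d * norm_Rn n \<theta> \<le> supp_Rn n K \<theta>}"
  proof
    fix F assume F: "F \<in> ?E"
    have "c * rate n d * norm_Rn n \<theta> \<le> supp_Rn n K \<theta>" if "\<theta> \<in> F" for \<theta>
    proof -
      have "c0 * (rate n d / 600000 * norm_Rn n \<theta>) \<le> c0 * l1_Rn n \<theta>"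
        using F that c0 by (intro mult_left_mono) auto
      also have "\<dots> \<le> supp_Rn n K \<theta>" by (rule supp)
      finally show ?thesis by (simp add: cc)
    qed
    then show "F \<in> {F \<in> grassmannian n (n - d). \<forall>\<theta>\<in>F. c * rate n d * norm_Rn n \<theta> \<le> supp_Rn n K \<theta>}"
      using F by auto
  qed
  then have "prob ?E \<le> prob {F \<in> grassmannian n (n - d). \<forall>\<theta>\<in>F. c * rate n d * norm_Rn n \<theta> \<le> supp_Rn n K \<theta>}"
    using sets_supp_ge[OF dn Kc(1,3)] by (intro finite_measure_mono) (simp_all add: sH)
  also have "{F \<in> grassmannian n (n - d). \<forall>\<theta>\<in>F. c * rate n d * norm_Rn n \<theta> \<le> supp_Rn n K \<theta>}
      = {F \<in> grassmannian n (n - d). proj_inradius n K F \<ge> c * rate n d}"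
    using iff by auto
  finally show ?thesis
    using haar_l1_ge[OF d] unfolding prob_inradius_ge_def by linarith
qed

text \<open>Every F contains a vector whose l1-norm is too small, so the event is empty. Half of
  80000 appears because the support function of the cube is half the l1-norm.\<close>

lemma prob_inradius_unit_cube_eq_0:
  assumes d: "1 \<le> d" "d < n" and s: "40000 * rate n d < s"
  shows "prob_inradius_ge n d (unit_cube n) s = 0"
proof -
  note Q = convex_body_facts[OF convex_body_unit_cube[of n]]
  have "1 \<le> rate n d" by (simp add: rate_def)
  then have s0: "0 < s" using s by linarith
  have low: "1 / 2 * norm_Rn n \<theta> \<le> supp_Rn n (unit_cube n) \<theta>" for \<theta>
    using norm_le_l1_Rn[of \<theta> n] by (simp add: supp_unit_cube)
  have "\<not> s \<le> proj_inradius n (unit_cube n) F" if F: "F \<in> grassmannian n (n - d)" for F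
  proof
    assume "s \<le> proj_inradius n (unit_cube n) F"
    then have h: "\<forall>\<theta>\<in>F. s * norm_Rn n \<theta> \<le> supp_Rn n (unit_cube n) \<theta>"
      using proj_inradius_ge_iff[OF d(2) F Q(1,3,2,4) _ low s0] by simp
    obtain v where v: "v \<in> F" "v \<noteq> 0" "l1_Rn n v \<le> 80000 * rate n d * norm_Rn n v"
      using Gelfand_lower_bound[OF d F] by blast
    have "v \<in> Rn n" using v(1) grassmannian_subset_Rn[OF F] by blast
    then have nz: "0 < norm_Rn n v" using v(2) norm_Rn_eq_0 L2_set_nonneg[of v "{..<n}"] by (metis less_le)
    have "s * norm_Rn n v \<le> 40000 * rate n d * norm_Rn n v"
      using h v(1,3) by (auto simp: supp_unit_cube)
    then show False using nz s by simp
  qed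
  then have "{F \<in> grassmannian n (n - d). s \<le> proj_inradius n (unit_cube n) F} = {}" by blast
  then show ?thesis unfolding prob_inradius_ge_def by (simp only: measure_empty)
qed

theorem theorem1p4:
  shows "\<exists>c C :: real. c > 0 \<and> C > 0 \<and>
    (\<forall>n d :: nat. 1 \<le> d \<and> d < n \<longrightarrow>
       c * max 1 (sqrt (real d / ln (exp 1 * real n / real d))) \<le> r_unc n d \<and>
       r_unc n d \<le> C * max 1 (sqrt (real d / ln (exp 1 * real n / real d))) \<and>
       r_unc n d \<le> r_body n d (unit_cube n) \<and>
       r_body n d (unit_cube n) \<le> C * r_unc n d)"
proof -
  define c :: real where "c = sqrt (1 / (8 * pi * exp 1) / 1032) / 600000"
  have c: "0 < c" by (simp add: c_def)
  \<comment> \<open>The first entry bounds \<open>r_unc\<close> by the rate; the second passes from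
    the rate back to \<open>r_unc\<close> through the lower bound with c.\<close>
  define C where "C = max 40000 (40000 / c)"
  have "c * rate n d \<le> r_unc n d \<and> r_unc n d \<le> C * rate n d \<and>
      r_unc n d \<le> r_body n d (unit_cube n) \<and> r_body n d (unit_cube n) \<le> C * r_unc n d"
    if d: "1 \<le> d" "d < n" for n d
  proof -
    let ?Q = "unit_cube n"
    define I where "I s = (INF K\<in>unc_isotropic n. prob_inradius_ge n d K s)" for s
    define S where "S = {s. s > 0 \<and> I s \<ge> 1 / 2}"
    define T where "T = {s. s > 0 \<and> prob_inradius_ge n d ?Q s \<ge> 1 / 2}"
    have r1: "1 \<le> rate n d" by (simp add: rate_def)
    have bdd: "bdd_below ((\<lambda>K. prob_inradius_ge n d K s) ` unc_isotropic n)" for s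
      by (rule bdd_belowI2[where m=0]) (simp add: prob_inradius_ge_def)
    have IQ: "I s \<le> prob_inradius_ge n d ?Q s" for s
      unfolding I_def by (rule cINF_lower[OF bdd unit_cube_unc_isotropic])
    have ST: "S \<subseteq> T" unfolding S_def T_def using IQ order_trans by blast
    have "1 / 2 \<le> I (c * rate n d)"
      unfolding I_def c_def using unit_cube_unc_isotropic[of n] prob_inradius_ge_half[OF d]
      by (intro cINF_greatest) auto
    \<comment> \<open>\<open>Sup\<close> on the reals needs a nonempty set bounded above. This
      member shows that both sets are nonempty, and the bound for \<open>T\<close>, inherited by
      \<open>S\<close>, supplies the rest.\<close>
    then have mem: "c * rate n d \<in> S" using c r1 by (simp add: S_def)
    have Tb: "s \<le> 40000 * rate n d" if "s \<in> T" for s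
      using that prob_inradius_unit_cube_eq_0[OF d, of s] by (force simp: T_def not_le[symmetric])
    then have bT: "bdd_above T" by (auto simp: bdd_above_def)
    then have bS: "bdd_above S" using ST by (rule bdd_above_mono)
    have unc: "r_unc n d = Sup S" by (simp add: r_unc_def S_def I_def)
    have body: "r_body n d ?Q = Sup T" by (simp add: r_body_def T_def)
    have 1: "c * rate n d \<le> r_unc n d" unfolding unc by (rule cSup_upper[OF mem bS])
    have 2: "r_unc n d \<le> r_body n d ?Q"
      unfolding unc body using mem by (intro cSup_subset_mono ST bT) auto
    have 3: "r_body n d ?Q \<le> 40000 * rate n d"
      unfolding body using mem ST Tb by (intro cSup_least) auto
    have "40000 * rate n d = 40000 / c * (c * rate n d)" using c by simp
    also have "\<dots> \<le> 40000 / c * r_unc n d" using 1 c by (intro mult_left_mono) auto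
    also have "\<dots> \<le> C * r_unc n d"
      using 1 mult_pos_pos[OF c, of "rate n d"] r1 by (intro mult_right_mono) (auto simp: C_def)
    finally have 4: "r_body n d ?Q \<le> C * r_unc n d" using 3 by linarith
    have "40000 * rate n d \<le> C * rate n d" using r1 by (intro mult_right_mono) (auto simp: C_def)
    then show ?thesis using 1 2 3 4 by linarith
  qed
  then show ?thesis
    using c by (intro exI[of _ c] exI[of _ C]) (auto simp: C_def rate_def)
qed

end
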